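(* Let $k\in\mathbb{Z}$ and $m\in\mathbb{Z}_{\ge0}$. Let $\phi\in J^{\mathrm{wh}}_{k,m}$ be a basic theta block, having $q$-order $A\in\mathbb{Z}$, baby theta block $b$ and germ $G$, so that $\phi(\tau,z)=q^A b(\zeta)(1-G(\zeta)q+\cdots)$, and let its decomposition as a product of atoms be $$\phi(\tau,z)=\eta(\tau)^{\nu(0)-\nu(1)}\prod_{r\ge1}\mathrm{atom}_r(\tau,z)^{\nu(r)}.$$ Then the following conditions are equivalent: (1) $(\phi|V_2)/\phi$ is weakly holomorphic, i.e. lies in $J^{\mathrm{wh}}_{0,m}$; (2) $b(\zeta)$ divides $b(\zeta^2)$ in $\mathbb{C}[\zeta,\zeta^{-1}]$; (3) $\nu(r)\ge\nu(2r)$ for all $r\ge1$. Moreover, when these conditions hold, $(\phi|V_2)/\phi\in J^{\mathrm{wh}}_{0,m}(\mathbb{Z})$, i.e. it is a weakly holomorphic Jacobi form of weight $0$ and index $m$ all of whose Fourier coefficients are integers.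
   Context: Notation: $e(w)=e^{2\pi iw}$, $q=e(\tau)$, $\zeta=e(z)$, $\tau\in\mathbb{H}$ (upper half plane), $z\in\mathbb{C}$. For integer $k$ and $m\ge0$, $J^{\mathrm{wh}}_{k,m}$ is the space of weakly holomorphic Jacobi forms of weight $k$, index $m$, level one and trivial character: holomorphic $g$ on $\mathbb{H}\times\mathbb{C}$ with $g(\frac{a\tau+b}{c\tau+d},\frac{z}{c\tau+d})=(c\tau+d)^ke(\frac{mcz^2}{c\tau+d})g(\tau,z)$ for all $\left(\begin{smallmatrix}a&b\\c&d\end{smallmatrix}\right)\in SL_2(\mathbb{Z})$, $g(\tau,z+\lambda\tau+\mu)=e(-m\lambda^2\tau-2m\lambda z)g(\tau,z)$ for $\lambda,\mu\in\mathbb{Z}$, and Fourier expansion $\sum_{n,r\in\mathbb{Z}}c(n,r)q^n\zeta^r$ with $n$ bounded below on the support. Let $\eta(\tau)=q^{1/24}\prod_{n\ge1}(1-q^n)$ and $\vartheta(\tau,z)=q^{1/8}(\zeta^{1/2}-\zeta^{-1/2})\prod_{n\ge1}(1-q^n\zeta)(1-q^n\zeta^{-1})(1-q^n)$, and $\vartheta_r(\tau,z)=\vartheta(\tau,rz)$ for $r\ge1$. A theta block is a function $\eta^{\varphi(0)}\prod_{r\ge1}(\vartheta_r/\eta)^{\varphi(r)}$ with $\varphi:\mathbb{Z}_{\ge0}\to\mathbb{Z}$ finitely supported; it equals $q^Ab(\zeta)\prod_{n\ge1,r\in\mathbb{Z}}(1-q^n\zeta^r)^{\varphi(|r|)}$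 where the $q$-order is $A=\frac1{24}\varphi(0)+\frac1{12}\sum_{r\ge1}\varphi(r)$, the baby theta block is $b(\zeta)=\prod_{r\ge1}(\zeta^{r/2}-\zeta^{-r/2})^{\varphi(r)}$, and the germ is $G(\zeta)=\sum_{r\in\mathbb{Z}}\varphi(|r|)\zeta^r$. A theta block is basic if it is a weakly holomorphic Jacobi form (in $J^{\mathrm{wh}}_{k,m}$) of integral weight $k$ and nonnegative integral index $m$. For $r\ge1$ the $r$-th atom is $\mathrm{atom}_r=\prod_{s\mid r}\vartheta_s^{\mu(r/s)}$ ($\mu$ the Möbius function; $\mathrm{atom}_1=\vartheta$); every theta block can be written as $\eta^{\nu(0)-\nu(1)}\prod_{r\ge1}\mathrm{atom}_r^{\nu(r)}$ with $\nu(0)=\varphi(0)$ and $\nu(r)=\sum_{t\ge1}\varphi(tr)$ for $r\ge1$. The index-raising Hecke operator $V_2$ acts on $\phi\in J^{\mathrm{wh}}_{k,m}$ by $(\phi|V_2)(\tau,z)=2^{k-1}\phi(2\tau,2z)+\frac12\big(\phi(\tfrac12\tau,z)+\phi(\tfrac12\tau+\tfrac12,z)\big)$, giving an element of $J^{\mathrm{wh}}_{k,2m}$.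
   Formalization: The final integrality claim is stated only for weight k ≥ 1; for k ≤ 0 it is false (e.g. φ = 1, k = m = 0 gives (φ|V₂)/φ = 3/2, and it always fails for k ≤ 0). The equivalence of (1), (2), (3) is for all k. *)

theory Defs
  imports
    "HOL-Analysis.Analysis"
    "HOL-Library.Poly_Mapping"
    "HOL-Computational_Algebra.Squarefree"
begin

definition ee :: "complex \<Rightarrow> complex" where
  "ee w = exp (2 * of_real pi * \<i> * w)"


section \<open>Weakly holomorphic Jacobi forms\<close>

text \<open>
  Functions on the product of the upper half plane and the complex plane are curried total functions
  of \<open>\<tau>\<close> and \<open>z\<close>; their values for \<open>Im \<tau> \<le> 0\<close> are irrelevant.
  Holomorphy in two variables is complex Frechet differentiability: the derivative at every
  point is a complex-linear map.
\<close>

definition holomorphic_HC :: "(complex \<Rightarrow> complex \<Rightarrow> complex) \<Rightarrow> bool" where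
  "holomorphic_HC g \<longleftrightarrow>
     (\<forall>\<tau> z. 0 < Im \<tau> \<longrightarrow>
        (\<exists>a b. ((\<lambda>p. g (fst p) (snd p)) has_derivative (\<lambda>h. a * fst h + b * snd h)) (at (\<tau>, z))))"

definition jacobi_fourier ::
    "(complex \<Rightarrow> complex \<Rightarrow> complex) \<Rightarrow> (int \<Rightarrow> int \<Rightarrow> complex) \<Rightarrow> bool" where
  "jacobi_fourier g c \<longleftrightarrow>
     (\<exists>N. \<forall>n r. c n r \<noteq> 0 \<longrightarrow> N \<le> n) \<and>
     (\<forall>\<tau> z. 0 < Im \<tau> \<longrightarrow>
        ((\<lambda>(n, r). c n r * ee (of_int n * \<tau>) * ee (of_int r * z)) has_sum g \<tau> z) UNIV)"

definition Jwh :: "int \<Rightarrow> nat \<Rightarrow> (complex \<Rightarrow> complex \<Rightarrow> complex) set" where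
  "Jwh k m = {g.
     holomorphic_HC g \<and>
     (\<forall>a b c d :: int. \<forall>\<tau> z. a * d - b * c = 1 \<longrightarrow> 0 < Im \<tau> \<longrightarrow>
        g ((of_int a * \<tau> + of_int b) / (of_int c * \<tau> + of_int d)) (z / (of_int c * \<tau> + of_int d)) =
          (of_int c * \<tau> + of_int d) powi k *
          ee (of_nat m * of_int c * z\<^sup>2 / (of_int c * \<tau> + of_int d)) * g \<tau> z) \<and>
     (\<forall>l u :: int. \<forall>\<tau> z. 0 < Im \<tau> \<longrightarrow>
        g \<tau> (z + of_int l * \<tau> + of_int u) =
          ee (- (of_nat m * (of_int l)\<^sup>2 * \<tau>) - 2 * of_nat m * of_int l * z) * g \<tau> z) \<and>
     (\<exists>c. jacobi_fourier g c)}"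

definition Jwh_int :: "int \<Rightarrow> nat \<Rightarrow> (complex \<Rightarrow> complex \<Rightarrow> complex) set" where
  "Jwh_int k m = {g \<in> Jwh k m. \<exists>c. jacobi_fourier g c \<and> (\<forall>n r. c n r \<in> \<int>)}"

text \<open>
  For \<open>k \<le> 0\<close> the factor \<open>2\<^bsup>k-1\<^esup>\<close> is not an integer, so this operator preserves integrality of
  Fourier coefficients only for \<open>k \<ge> 1\<close>; for example it sends the constant \<open>1\<close> (weight \<open>0\<close>,
  index \<open>0\<close>) to \<open>3/2\<close>.
\<close>

definition hecke_V2 ::
    "int \<Rightarrow> (complex \<Rightarrow> complex \<Rightarrow> complex) \<Rightarrow> complex \<Rightarrow> complex \<Rightarrow> complex" where
  "hecke_V2 k f \<tau> z =
     2 powi (k - 1) * f (2 * \<tau>) (2 * z) + 1/2 * (f (\<tau> / 2) z + f (\<tau> / 2 + 1/2) z)"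

text \<open>
  The meromorphic function \<open>f / h\<close> on the product of the upper half plane and the complex plane is
  (extends to) \<open>g\<close>. Since division by zero yields zero, nothing is required at the zeros of \<open>h\<close>;
  if \<open>g\<close> is holomorphic and \<open>h\<close> is holomorphic and not identically zero, then \<open>g\<close> is determined
  by continuity.
\<close>

definition extends_quotient ::
    "(complex \<Rightarrow> complex \<Rightarrow> complex) \<Rightarrow> (complex \<Rightarrow> complex \<Rightarrow> complex) \<Rightarrow>
     (complex \<Rightarrow> complex \<Rightarrow> complex) \<Rightarrow> bool" where
  "extends_quotient g f h \<longleftrightarrow>
     (\<forall>\<tau> z. 0 < Im \<tau> \<longrightarrow> h \<tau> z \<noteq> 0 \<longrightarrow> g \<tau> z = f \<tau> z / h \<tau> z)"


section \<open>Theta blocks\<close>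

definition eta :: "complex \<Rightarrow> complex" where
  "eta \<tau> = ee (\<tau> / 24) * prodinf (\<lambda>n. 1 - ee (of_nat (Suc n) * \<tau>))"

definition theta :: "complex \<Rightarrow> complex \<Rightarrow> complex" where
  "theta \<tau> z = ee (\<tau> / 8) * (ee (z / 2) - ee (- z / 2)) *
     prodinf (\<lambda>n. (1 - ee (of_nat (Suc n) * \<tau>) * ee z) * (1 - ee (of_nat (Suc n) * \<tau>) * ee (- z)) *
           (1 - ee (of_nat (Suc n) * \<tau>)))"

definition theta_r :: "nat \<Rightarrow> complex \<Rightarrow> complex \<Rightarrow> complex" where
  "theta_r r \<tau> z = theta \<tau> (of_nat r * z)"

definition theta_block :: "(nat \<Rightarrow> int) \<Rightarrow> complex \<Rightarrow> complex \<Rightarrow> complex" where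
  "theta_block \<phi> \<tau> z =
     eta \<tau> powi \<phi> 0 * (\<Prod>r | 1 \<le> r \<and> \<phi> r \<noteq> 0. (theta_r r \<tau> z / eta \<tau>) powi \<phi> r)"

text \<open>
  Theta blocks are meromorphic, and a holomorphic one may still be written with theta functions in
  the denominator. That a holomorphic \<open>f\<close> is the given theta block therefore means that the two
  agree wherever none of the theta functions in the denominator vanishes.
\<close>

definition is_theta_block :: "(complex \<Rightarrow> complex \<Rightarrow> complex) \<Rightarrow> (nat \<Rightarrow> int) \<Rightarrow> bool" where
  "is_theta_block f \<phi> \<longleftrightarrow>
     finite {r. \<phi> r \<noteq> 0} \<and>
     (\<forall>\<tau> z. 0 < Im \<tau> \<longrightarrow> (\<forall>r\<ge>1. \<phi> r < 0 \<longrightarrow> theta_r r \<tau> z \<noteq> 0) \<longrightarrow>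
        f \<tau> z = theta_block \<phi> \<tau> z)"

definition basic_theta_block ::
    "int \<Rightarrow> nat \<Rightarrow> (complex \<Rightarrow> complex \<Rightarrow> complex) \<Rightarrow> (nat \<Rightarrow> int) \<Rightarrow> bool" where
  "basic_theta_block k m f \<phi> \<longleftrightarrow> is_theta_block f \<phi> \<and> f \<in> Jwh k m"

definition q_order :: "(nat \<Rightarrow> int) \<Rightarrow> rat" where
  "q_order \<phi> = of_int (\<phi> 0) / 24 + (\<Sum>r | 1 \<le> r \<and> \<phi> r \<noteq> 0. of_int (\<phi> r)) / 12"

definition moebius :: "nat \<Rightarrow> int" where
  "moebius n = (if squarefree n then (- 1) ^ card (prime_factors n) else 0)"

definition atom :: "nat \<Rightarrow> complex \<Rightarrow> complex \<Rightarrow> complex" where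
  "atom r \<tau> z = (\<Prod>s | s dvd r. theta_r s \<tau> z powi moebius (r div s))"

definition atom_product :: "(nat \<Rightarrow> int) \<Rightarrow> complex \<Rightarrow> complex \<Rightarrow> complex" where
  "atom_product \<nu> \<tau> z =
     eta \<tau> powi (\<nu> 0 - \<nu> 1) * (\<Prod>r | 1 \<le> r \<and> \<nu> r \<noteq> 0. atom r \<tau> z powi \<nu> r)"

text \<open>
  As for theta blocks, the equality is one of meromorphic functions; it is required wherever no
  theta function occurring in an atom of the product vanishes.
\<close>

definition atom_decomposition :: "(complex \<Rightarrow> complex \<Rightarrow> complex) \<Rightarrow> (nat \<Rightarrow> int) \<Rightarrow> bool" where
  "atom_decomposition f \<nu> \<longleftrightarrow>
     finite {r. \<nu> r \<noteq> 0} \<and>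
     (\<forall>\<tau> z. 0 < Im \<tau> \<longrightarrow>
        (\<forall>r\<ge>1. \<nu> r \<noteq> 0 \<longrightarrow> (\<forall>s. s dvd r \<longrightarrow> theta_r s \<tau> z \<noteq> 0)) \<longrightarrow>
        f \<tau> z = atom_product \<nu> \<tau> z)"


section \<open>Baby theta blocks as Laurent polynomials\<close>

text \<open>
  The Laurent polynomial ring in \<open>\<zeta>\<close> over the complex numbers is the group algebra of the integers.
\<close>

type_synonym laurent_poly = "int \<Rightarrow>\<^sub>0 complex"

definition laurent_eval :: "laurent_poly \<Rightarrow> complex \<Rightarrow> complex" where
  "laurent_eval p w = (\<Sum>n \<in> Poly_Mapping.keys p. Poly_Mapping.lookup p n * w powi n)"

text \<open>The substitution of \<open>\<zeta>\<^sup>2\<close> for \<open>\<zeta>\<close>.\<close>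

definition subst_square :: "laurent_poly \<Rightarrow> laurent_poly" where
  "subst_square p = (\<Sum>n \<in> Poly_Mapping.keys p. Poly_Mapping.single (2 * n) (Poly_Mapping.lookup p n))"

text \<open>As a function of \<open>z\<close>, with \<open>\<zeta>\<^bsup>r/2\<^esup> = ee (r z / 2)\<close>.\<close>

definition baby_theta :: "(nat \<Rightarrow> int) \<Rightarrow> complex \<Rightarrow> complex" where
  "baby_theta \<phi> z =
     (\<Prod>r | 1 \<le> r \<and> \<phi> r \<noteq> 0. (ee (of_nat r * z / 2) - ee (- (of_nat r * z / 2))) powi \<phi> r)"

text \<open>
  The Laurent polynomial \<open>p\<close> is the baby theta block of \<open>\<phi>\<close>; it is unique if it exists.
\<close>

definition is_baby_theta :: "laurent_poly \<Rightarrow> (nat \<Rightarrow> int) \<Rightarrow> bool" where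
  "is_baby_theta p \<phi> \<longleftrightarrow>
     (\<forall>z. (\<forall>r\<ge>1. \<phi> r < 0 \<longrightarrow> ee (of_nat r * z / 2) \<noteq> ee (- (of_nat r * z / 2))) \<longrightarrow>
        laurent_eval p (ee z) = baby_theta \<phi> z)"

end

theory Submission
  imports Defs "HOL-Complex_Analysis.Complex_Analysis"
    "HOL-Computational_Algebra.Fundamental_Theorem_Algebra"
begin

text \<open>
  Every theta function \<open>\<vartheta>\<^sub>s\<close> vanishes to order 0 or 1 along the lines \<open>z = \<alpha> \<tau> + \<beta>\<close>, so that a theta
  block has a constant vanishing order along each such line. At a torsion point of exact order \<open>r\<close> it
  is \<open>\<nu>(r)\<close>; hence \<open>\<nu>(r) \<ge> 0\<close> when the block is holomorphic. The three terms of \<open>\<phi> | V\<^sub>2\<close> are \<open>\<phi>\<close>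
  for the three lattices that contain \<open>\<int> \<tau> + \<int>\<close> with index two. For odd \<open>r\<close> the point keeps its order in each
  of them, for even \<open>r\<close> the order drops to \<open>r/2\<close> in exactly one. So \<open>\<phi>\<close> divides \<open>\<phi> | V\<^sub>2\<close> iff
  \<open>\<nu>(r/2) \<ge> \<nu>(r)\<close> for all even \<open>r\<close>, and comparing the orders of \<open>b(\<zeta>)\<close> and \<open>b(\<zeta>\<^sup>2)\<close> at roots of
  unity gives the same condition for the baby theta blocks.

  For the Fourier expansion write \<open>\<phi> = q\<^sup>A b(\<zeta>) P(q, \<zeta>)\<close>, where \<open>P\<close> is a power series in \<open>q\<close> with
  constant term 1 and integral Laurent polynomials in \<open>\<zeta>\<close> as coefficients. In the quotient
  \<open>b(\<zeta>)\<close> cancels, and \<open>b(\<zeta>\<^sup>2) / b(\<zeta>)\<close> is integral because \<open>b\<close> has extreme coefficients \<open>\<plusminus>1\<close>. This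
  expansion is valid near \<open>q = 0\<close> for fixed \<open>\<zeta>\<close> only; Cauchy's estimates on tori, applied to the
  holomorphic quotient, extend it as an absolutely convergent double series to the whole domain.
\<close>


section \<open>Holomorphic functions of two variables\<close>

text \<open>Every condition of the theorem is compared with the single inequality
  \<open>zero_mult \<phi> (2 * t) \<le> zero_mult \<phi> t\<close>. This works because \<tau> and 1
  form a real basis of the plane: every point (\<tau>0, z0) lies on a line z = \<alpha> \<tau> +
  \<beta> with real \<alpha> and \<beta>, and near it each theta function is a power of the one
  function z - \<alpha> \<tau> - \<beta> times a unit. Divisibility of germs in two variables
  thereby becomes a comparison of exponents. The obstacle throughout is that \<open>f\<close> is
  known to equal the quotient of theta products only where no denominator vanishes; identities are
  therefore proved off the line, or where \<open>f\<close> is nonzero, and carried over by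
  continuity in z alone. The factor 1/2 of the Hecke operator disappears in the sum over the two
  square roots of q, so 2^(k-1) is the only possible source of denominators; for this reason
  integrality is asserted for k \<ge> 1.\<close>

definition cdiff2 :: "(complex \<times> complex \<Rightarrow> complex) \<Rightarrow> complex \<times> complex \<Rightarrow> bool" where
  "cdiff2 F p \<longleftrightarrow> (\<exists>a b. (F has_derivative (\<lambda>h. a * fst h + b * snd h)) (at p))"

text \<open>Differentiability on a whole neighbourhood makes this a property of germs: it survives
  replacing a function by one that agrees with it nearby, and continuity is available at the
  neighbouring points as well.\<close>

definition hol_at :: "(complex \<times> complex \<Rightarrow> complex) \<Rightarrow> complex \<times> complex \<Rightarrow> bool" where
  "hol_at F p \<longleftrightarrow> eventually (cdiff2 F) (nhds p)"

text \<open>The units of the local ring of germs: exactly the germs that may be raised to negative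
  powers, as the exponents of theta blocks require.\<close>

definition unit_at :: "(complex \<times> complex \<Rightarrow> complex) \<Rightarrow> complex \<times> complex \<Rightarrow> bool" where
  "unit_at F p \<longleftrightarrow> hol_at F p \<and> F p \<noteq> 0"

lemma cdiff2_isCont: "cdiff2 F p \<Longrightarrow> isCont F p"
  unfolding cdiff2_def by (auto intro: has_derivative_continuous)

lemma cdiff2_comp:
  assumes "cdiff2 F (G p, H p)" "cdiff2 G p" "cdiff2 H p"
  shows "cdiff2 (\<lambda>p. F (G p, H p)) p"
proof -
  obtain a b where F: "(F has_derivative (\<lambda>h. a * fst h + b * snd h)) (at (G p, H p))"
    using assms(1) by (auto simp: cdiff2_def)
  obtain c d where G: "(G has_derivative (\<lambda>h. c * fst h + d * snd h)) (at p)"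
    using assms(2) by (auto simp: cdiff2_def)
  obtain e f where H: "(H has_derivative (\<lambda>h. e * fst h + f * snd h)) (at p)"
    using assms(3) by (auto simp: cdiff2_def)
  have "((\<lambda>p. F (G p, H p)) has_derivative
      (\<lambda>h. a * fst (c * fst h + d * snd h, e * fst h + f * snd h) +
           b * snd (c * fst h + d * snd h, e * fst h + f * snd h))) (at p)"
    by (rule has_derivative_compose[OF has_derivative_Pair[OF G H] F])
  also have "(\<lambda>h. a * fst (c * fst h + d * snd h, e * fst h + f * snd h) +
           b * snd (c * fst h + d * snd h, e * fst h + f * snd h)) =
     (\<lambda>h. (a * c + b * e) * fst h + (a * d + b * f) * snd h)"
    by (auto simp: algebra_simps)
  finally show ?thesis unfolding cdiff2_def by blast
qed

lemma cdiff2_const [simp, intro]: "cdiff2 (\<lambda>_. c) p"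
proof -
  have "((\<lambda>_. c) has_derivative (\<lambda>h. 0 * fst h + 0 * snd h)) (at p)" by simp
  thus ?thesis unfolding cdiff2_def by blast
qed

lemma cdiff2_fst [simp, intro]: "cdiff2 fst p"
proof -
  have "(fst has_derivative (\<lambda>h. 1 * fst h + 0 * snd h)) (at p)"
    by (simp add: has_derivative_fst[OF has_derivative_ident])
  thus ?thesis unfolding cdiff2_def by blast
qed

lemma cdiff2_snd [simp, intro]: "cdiff2 snd p"
proof -
  have "(snd has_derivative (\<lambda>h. 0 * fst h + 1 * snd h)) (at p)"
    by (simp add: has_derivative_snd[OF has_derivative_ident])
  thus ?thesis unfolding cdiff2_def by blast
qed

lemma cdiff2_comp1:
  assumes "(h has_field_derivative d) (at (F p))" "cdiff2 F p"
  shows "cdiff2 (\<lambda>p. h (F p)) p"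
proof -
  obtain a b where F: "(F has_derivative (\<lambda>h. a * fst h + b * snd h)) (at p)"
    using assms(2) by (auto simp: cdiff2_def)
  have "((\<lambda>p. h (F p)) has_derivative (\<lambda>h. d * (a * fst h + b * snd h))) (at p)"
    using has_derivative_compose[OF F] assms(1) by (simp add: has_field_derivative_def)
  hence "((\<lambda>p. h (F p)) has_derivative (\<lambda>h. (d * a) * fst h + (d * b) * snd h)) (at p)"
    by (simp add: algebra_simps)
  thus ?thesis unfolding cdiff2_def by blast
qed

lemma cdiff2_add:
  assumes "cdiff2 F p" "cdiff2 G p" shows "cdiff2 (\<lambda>p. F p + G p) p"
proof -
  have "cdiff2 (\<lambda>q. fst q + snd q) (F p, G p)"
  proof -
    have "((\<lambda>q::complex\<times>complex. fst q + snd q) has_derivative (\<lambda>h. 1 * fst h + 1 * snd h)) (at (F p, G p))"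
      by (auto intro!: derivative_eq_intros)
    thus ?thesis unfolding cdiff2_def by blast
  qed
  from cdiff2_comp[OF this assms] show ?thesis by simp
qed

lemma cdiff2_mult:
  assumes "cdiff2 F p" "cdiff2 G p" shows "cdiff2 (\<lambda>p. F p * G p) p"
proof -
  have "cdiff2 (\<lambda>q. fst q * snd q) (F p, G p)"
  proof -
    have "((\<lambda>q::complex\<times>complex. fst q * snd q) has_derivative (\<lambda>h. G p * fst h + F p * snd h)) (at (F p, G p))"
      by (auto intro!: derivative_eq_intros simp: algebra_simps)
    thus ?thesis unfolding cdiff2_def by blast
  qed
  from cdiff2_comp[OF this assms] show ?thesis by simp
qed

lemma cdiff2_cong_ev:
  assumes "eventually (\<lambda>p. F p = G p) (nhds p)" "cdiff2 F p"
  shows "cdiff2 G p"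
proof -
  obtain a b where F: "(F has_derivative (\<lambda>h. a * fst h + b * snd h)) (at p)"
    using assms(2) by (auto simp: cdiff2_def)
  have "(G has_derivative (\<lambda>h. a * fst h + b * snd h)) (at p)"
    by (rule has_derivative_transform_eventually[OF F])
       (use assms(1) eventually_nhds_x_imp_x in \<open>auto simp: eventually_at_filter elim: eventually_mono\<close>)
  thus ?thesis unfolding cdiff2_def by blast
qed

lemma hol_at_imp_cdiff2: "hol_at F p \<Longrightarrow> cdiff2 F p"
  unfolding hol_at_def by (rule eventually_nhds_x_imp_x)

lemma hol_at_isCont: "hol_at F p \<Longrightarrow> isCont F p"
  by (simp add: cdiff2_isCont hol_at_imp_cdiff2)

lemma hol_at_tendsto: "hol_at F p \<Longrightarrow> (F \<longlongrightarrow> F p) (nhds p)"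
  using hol_at_isCont[of F p] by (simp add: isCont_def tendsto_at_iff_tendsto_nhds)

lemma hol_at_cong_ev:
  assumes "eventually (\<lambda>p. F p = G p) (nhds p)" "hol_at F p"
  shows "hol_at G p"
proof -
  have "eventually (\<lambda>p. eventually (\<lambda>p. F p = G p) (nhds p)) (nhds p)"
    using assms(1) by (simp add: eventually_eventually)
  with assms(2) show ?thesis unfolding hol_at_def
    by eventually_elim (auto intro: cdiff2_cong_ev)
qed

lemma hol_at_const [simp, intro]: "hol_at (\<lambda>_. c) p"
  and hol_at_fst [simp, intro]: "hol_at fst p"
  and hol_at_snd [simp, intro]: "hol_at snd p"
  by (auto simp: hol_at_def intro!: always_eventually)

lemma hol_at_add: "hol_at F p \<Longrightarrow> hol_at G p \<Longrightarrow> hol_at (\<lambda>p. F p + G p) p"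
  unfolding hol_at_def by (auto intro: cdiff2_add elim: eventually_elim2)

lemma hol_at_mult: "hol_at F p \<Longrightarrow> hol_at G p \<Longrightarrow> hol_at (\<lambda>p. F p * G p) p"
  unfolding hol_at_def by (auto intro: cdiff2_mult elim: eventually_elim2)

lemma eventually_hol_at:
  assumes "hol_at F p" "eventually P (nhds (F p))"
  shows "eventually (\<lambda>p. P (F p)) (nhds p)"
proof -
  have "filterlim F (nhds (F p)) (nhds p)"
    by (intro hol_at_tendsto assms)
  thus ?thesis using assms(2) by (rule eventually_compose_filterlim[rotated])
qed

lemma hol_at_comp1:
  assumes "h holomorphic_on S" "open S" "F p \<in> S" "hol_at F p"
  shows "hol_at (\<lambda>p. h (F p)) p"
proof -
  have "eventually (\<lambda>p. F p \<in> S) (nhds p)"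
    by (rule eventually_hol_at[OF assms(4)]) (use assms in \<open>auto intro: eventually_nhds_in_open\<close>)
  with assms(4) show ?thesis unfolding hol_at_def
  proof eventually_elim
    case (elim p)
    have "(h has_field_derivative deriv h (F p)) (at (F p))"
      using assms elim by (auto intro: holomorphic_derivI)
    thus ?case using elim by (auto intro: cdiff2_comp1)
  qed
qed

lemma hol_at_comp:
  assumes "hol_at F (G p, H p)" "hol_at G p" "hol_at H p"
  shows "hol_at (\<lambda>p. F (G p, H p)) p"
proof -
  have "filterlim (\<lambda>p. (G p, H p)) (nhds (G p, H p)) (nhds p)"
    by (intro tendsto_Pair hol_at_tendsto assms)
  hence "eventually (\<lambda>p. cdiff2 F (G p, H p)) (nhds p)"
    using assms(1) unfolding hol_at_def by (rule eventually_compose_filterlim[rotated])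
  with assms(2,3) show ?thesis unfolding hol_at_def
    by eventually_elim (auto intro: cdiff2_comp)
qed

lemma hol_at_cmult: "hol_at F p \<Longrightarrow> hol_at (\<lambda>p. c * F p) p"
  by (intro hol_at_mult hol_at_const)

lemma hol_at_minus: "hol_at F p \<Longrightarrow> hol_at (\<lambda>p. - F p) p"
  using hol_at_cmult[of F p "-1"] by simp

lemma hol_at_diff: "hol_at F p \<Longrightarrow> hol_at G p \<Longrightarrow> hol_at (\<lambda>p. F p - G p) p"
  using hol_at_add[OF _ hol_at_minus, of F p G] by simp

lemma hol_at_divide_const: "hol_at F p \<Longrightarrow> hol_at (\<lambda>p. F p / c) p"
  using hol_at_cmult[of F p "inverse c"] by (simp add: field_simps)

lemma hol_at_power: "hol_at F p \<Longrightarrow> hol_at (\<lambda>p. F p ^ n) p"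
  by (induction n) (auto intro: hol_at_mult)

lemma ee_has_field_derivative: "(ee has_field_derivative 2 * of_real pi * \<i> * ee w) (at w)"
  unfolding ee_def by (auto intro!: derivative_eq_intros)

lemma ee_holomorphic [holomorphic_intros]: "ee holomorphic_on S"
  unfolding ee_def by (intro holomorphic_intros)

lemma hol_at_ee: "hol_at F p \<Longrightarrow> hol_at (\<lambda>p. ee (F p)) p"
  by (rule hol_at_comp1[of ee UNIV]) (auto intro: ee_holomorphic)

lemmas hol_at_intros = hol_at_const hol_at_fst hol_at_snd hol_at_add hol_at_mult hol_at_minus
  hol_at_diff hol_at_divide_const hol_at_power hol_at_ee

lemma unit_at_const: "c \<noteq> 0 \<Longrightarrow> unit_at (\<lambda>_. c) p"
  by (simp add: unit_at_def)

lemma unit_at_mult: "unit_at F p \<Longrightarrow> unit_at G p \<Longrightarrow> unit_at (\<lambda>p. F p * G p) p"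
  by (simp add: unit_at_def hol_at_mult)

lemma unit_at_powi: "unit_at F p \<Longrightarrow> unit_at (\<lambda>p. F p powi n) p"
  unfolding unit_at_def
  by (auto intro!: hol_at_comp1[of "\<lambda>x. x powi n" "-{0}" F] holomorphic_intros)

lemma unit_at_divide: "unit_at F p \<Longrightarrow> unit_at G p \<Longrightarrow> unit_at (\<lambda>p. F p / G p) p"
  using unit_at_mult[OF _ unit_at_powi[of G p "-1"], of F] by (simp add: field_simps power_int_minus)

lemma unit_at_prod: "(\<And>i. i \<in> I \<Longrightarrow> unit_at (F i) p) \<Longrightarrow> unit_at (\<lambda>p. \<Prod>i\<in>I. F i p) p"
  by (induction I rule: infinite_finite_induct) (auto intro: unit_at_mult unit_at_const)

lemma unit_at_comp:
  assumes "unit_at F (G p, H p)" "hol_at G p" "hol_at H p"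
  shows "unit_at (\<lambda>p. F (G p, H p)) p"
  using assms hol_at_comp unfolding unit_at_def by auto

lemma unit_at_nonzero:
  assumes "unit_at F p" shows "eventually (\<lambda>p. F p \<noteq> 0) (nhds p)"
proof -
  have "eventually (\<lambda>x. x \<in> -{0::complex}) (nhds (F p))"
    by (rule eventually_nhds_in_open) (use assms in \<open>auto simp: unit_at_def\<close>)
  thus ?thesis using assms eventually_hol_at[of F p "\<lambda>x. x \<noteq> 0"] by (simp add: unit_at_def)
qed

section \<open>Osgood's lemma: joint differentiability from continuity and separate
  holomorphy\<close>

lemma deriv_partial_continuous:
  fixes F :: "complex \<times> complex \<Rightarrow> complex"
  assumes "open S" "open T" "continuous_on (S \<times> T) F"
    and holT: "\<And>x. x \<in> S \<Longrightarrow> (\<lambda>y. F (x, y)) holomorphic_on T"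
    and "a \<in> S" "b \<in> T"
  shows "((\<lambda>(x, y). deriv (\<lambda>y. F (x, y)) y) \<longlongrightarrow> deriv (\<lambda>y. F (a, y)) b) (at (a, b))"
proof (rule tendstoI)
  fix e :: real assume "e > 0"
  obtain s where s: "s > 0" "cball a s \<subseteq> S" using assms open_contains_cball by blast
  obtain r0 where r0: "r0 > 0" "cball b r0 \<subseteq> T" using assms open_contains_cball by blast
  \<comment> \<open>Half the radius, so that for y within r of b the disc of radius r about y stays
    inside the compact disc \<open>cball b r0\<close>.\<close>
  define r where "r = r0 / 2"
  have r: "r > 0" using r0 by (simp add: r_def)
  have sub: "cball y r \<subseteq> cball b r0" if "dist y b < r" for y
    using that unfolding r_def by (smt (verit) dist_commute dist_triangle field_sum_of_halves mem_cball subsetI)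
  have "uniformly_continuous_on (cball a s \<times> cball b r0) F"
    by (rule compact_uniformly_continuous)
       (use assms(3) s r0 in \<open>auto intro: continuous_on_subset compact_Times\<close>)
  \<comment> \<open>The tolerance carries the factor r because Cauchy's inequality below divides by
    the radius.\<close>
  then obtain d where d: "d > 0" "\<And>u v. u \<in> cball a s \<times> cball b r0 \<Longrightarrow> v \<in> cball a s \<times> cball b r0 \<Longrightarrow>
     dist v u < d \<Longrightarrow> dist (F v) (F u) < e / 2 * r"
    using r \<open>e > 0\<close> unfolding uniformly_continuous_on_def
    by (metis half_gt_zero mult_pos_pos)
  have "isCont (deriv (\<lambda>y. F (a, y))) b"
    using holomorphic_deriv[OF holT[OF \<open>a \<in> S\<close>] \<open>open T\<close>] assms
    by (meson continuous_on_eq_continuous_at holomorphic_on_imp_continuous_on)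
  hence "eventually (\<lambda>y. dist (deriv (\<lambda>y. F (a, y)) y) (deriv (\<lambda>y. F (a, y)) b) < e / 2) (nhds b)"
    unfolding isCont_def tendsto_at_iff_tendsto_nhds using \<open>e > 0\<close> by (intro tendstoD) auto
  then obtain t where t: "t > 0" "\<And>y. dist y b < t \<Longrightarrow>
      dist (deriv (\<lambda>y. F (a, y)) y) (deriv (\<lambda>y. F (a, y)) b) < e / 2"
    by (auto simp: eventually_nhds_metric)
  have main: "dist (deriv (\<lambda>y. F (x, y)) y) (deriv (\<lambda>y. F (a, y)) b) < e"
    if x: "dist x a < min s d" and y: "dist y b < min r t" for x y
  proof -
    have xS: "x \<in> cball a s" using x by (auto simp: dist_commute)
    have yT: "cball y r \<subseteq> cball b r0" using sub y by auto
    have holx: "(\<lambda>y. F (x, y)) holomorphic_on T" "(\<lambda>y. F (a, y)) holomorphic_on T"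
      using holT xS s assms by auto
    \<comment> \<open>Cauchy's estimate for the difference of the slices x and a: uniform closeness
      on the circle about y bounds the difference of the derivatives. What remains is continuity of
      the derivative in the fixed slice a.\<close>
    have "norm ((deriv ^^ 1) (\<lambda>y. F (x, y) - F (a, y)) y) \<le> fact 1 * (e / 2 * r) / r ^ 1"
    proof (rule Cauchy_inequality)
      show "(\<lambda>y. F (x, y) - F (a, y)) holomorphic_on ball y r"
        by (intro holomorphic_intros holomorphic_on_subset[OF holx(1)] holomorphic_on_subset[OF holx(2)])
           (use yT r0 in \<open>auto simp: subset_eq\<close>)
      show "continuous_on (cball y r) (\<lambda>y. F (x, y) - F (a, y))"
        by (intro holomorphic_on_imp_continuous_on holomorphic_intros
             holomorphic_on_subset[OF holx(1)] holomorphic_on_subset[OF holx(2)])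
           (use yT r0 in \<open>auto simp: subset_eq\<close>)
      fix w assume "norm (y - w) = r"
      hence w: "w \<in> cball b r0" using yT by (auto simp: dist_norm)
      have "dist (F (x, w)) (F (a, w)) < e / 2 * r"
        by (rule d(2)) (use w xS x s in \<open>auto simp: dist_Pair_Pair\<close>)
      thus "norm (F (x, w) - F (a, w)) \<le> e / 2 * r" by (simp add: dist_norm)
    qed (use r in auto)
    moreover have "deriv (\<lambda>y. F (x, y) - F (a, y)) y = deriv (\<lambda>y. F (x, y)) y - deriv (\<lambda>y. F (a, y)) y"
    proof (rule deriv_diff)
      have "y \<in> T" using yT r r0 by (auto simp: subset_eq)
      thus "(\<lambda>y. F (x, y)) field_differentiable at y" "(\<lambda>y. F (a, y)) field_differentiable at y"
        using holx \<open>open T\<close> holomorphic_on_imp_differentiable_at by blast+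
    qed
    ultimately have "dist (deriv (\<lambda>y. F (x, y)) y) (deriv (\<lambda>y. F (a, y)) y) \<le> e / 2"
      using r by (simp add: dist_norm)
    moreover have "dist (deriv (\<lambda>y. F (a, y)) y) (deriv (\<lambda>y. F (a, y)) b) < e / 2"
      using t y by auto
    ultimately show ?thesis
      using dist_triangle[of "deriv (\<lambda>y. F (x, y)) y" "deriv (\<lambda>y. F (a, y)) b" "deriv (\<lambda>y. F (a, y)) y"]
      by linarith
  qed
  show "eventually (\<lambda>p. dist (case p of (x, y) \<Rightarrow> deriv (\<lambda>y. F (x, y)) y) (deriv (\<lambda>y. F (a, y)) b) < e) (at (a, b))"
    unfolding eventually_at
  proof (intro exI[of _ "Min {s, d, r, t}"] conjI ballI impI)
    show "Min {s, d, r, t} > 0" using s d r t by auto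
    fix p assume "p \<in> UNIV" and p: "p \<noteq> (a, b) \<and> dist p (a, b) < Min {s, d, r, t}"
    obtain x y where [simp]: "p = (x, y)" by force
    have "dist x a \<le> dist p (a, b)" "dist y b \<le> dist p (a, b)"
      using dist_fst_le[of p "(a,b)"] dist_snd_le[of p "(a,b)"] by auto
    thus "dist (case p of (x, y) \<Rightarrow> deriv (\<lambda>y. F (x, y)) y) (deriv (\<lambda>y. F (a, y)) b) < e"
      using main[of x y] p by auto
  qed
qed

text \<open>A function is differentiable at a point once one partial derivative exists there and the
  other is jointly continuous; the preceding lemma supplies this continuity.\<close>

lemma osgood:
  fixes F :: "complex \<times> complex \<Rightarrow> complex"
  assumes "open S" "open T" "continuous_on (S \<times> T) F"
    and holS: "\<And>y. y \<in> T \<Longrightarrow> (\<lambda>x. F (x, y)) holomorphic_on S"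
    and holT: "\<And>x. x \<in> S \<Longrightarrow> (\<lambda>y. F (x, y)) holomorphic_on T"
    and "p \<in> S \<times> T"
  shows "cdiff2 F p"
proof -
  obtain a b where p: "p = (a, b)" "a \<in> S" "b \<in> T" using assms(6) by auto
  \<comment> \<open>The criterion for partial derivatives asks for a convex second factor, so T is
    shrunk to a ball.\<close>
  obtain r where r: "r > 0" "ball b r \<subseteq> T" using assms p open_contains_ball by blast
  define D where "D = (\<lambda>x y. blinfun_mult_right (deriv (\<lambda>y. F (x, y)) y))"
  have "((\<lambda>(x, y). F (x, y)) has_derivative
     (\<lambda>(tx, ty). (deriv (\<lambda>x. F (x, b)) a) * tx + blinfun_apply (D a b) ty)) (at (a, b) within S \<times> ball b r)"
  proof (rule has_derivative_partialsI)
    show "((\<lambda>x. F (x, b)) has_derivative (*) (deriv (\<lambda>x. F (x, b)) a)) (at a within S)"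
      using holomorphic_derivI[OF holS[OF p(3)] assms(1) p(2)]
      by (simp add: has_field_derivative_def has_derivative_at_withinI)
    show "((\<lambda>y. F (x, y)) has_derivative blinfun_apply (D x y)) (at y within ball b r)"
      if "x \<in> S" "y \<in> ball b r" for x y
    proof -
      have "y \<in> T" using that r(2) by blast
      from holomorphic_derivI[OF holT[OF that(1)] assms(2) this]
      have "((\<lambda>y. F (x, y)) has_derivative (*) (deriv (\<lambda>y. F (x, y)) y)) (at y within ball b r)"
        by (simp add: has_field_derivative_def has_derivative_at_withinI)
      moreover have "blinfun_apply (D x y) = (*) (deriv (\<lambda>y. F (x, y)) y)"
        by (auto simp: D_def fun_eq_iff)
      ultimately show ?thesis by simp
    qed
    have "((\<lambda>p. blinfun_mult_right (case p of (x, y) \<Rightarrow> deriv (\<lambda>y. F (x, y)) y)) \<longlongrightarrow>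
        blinfun_mult_right (deriv (\<lambda>y. F (a, y)) b)) (at (a, b))"
      by (intro bounded_linear.tendsto[OF bounded_linear_blinfun_mult_right]
            deriv_partial_continuous[OF assms(1,2,3) holT p(2,3)])
    hence "((\<lambda>(x, y). D x y) \<longlongrightarrow> D a b) (at (a, b))"
      by (simp add: D_def case_prod_unfold)
    thus "continuous (at (a, b) within S \<times> ball b r) (\<lambda>(x, y). D x y)"
      by (auto simp: continuous_within intro: tendsto_within_subset)
  qed (use r in auto)
  moreover have "at (a, b) within S \<times> ball b r = at (a, b)"
    by (rule at_within_open) (use p r assms in \<open>auto intro: open_Times\<close>)
  ultimately have "(F has_derivative (\<lambda>h. deriv (\<lambda>x. F (x, b)) a * fst h + deriv (\<lambda>y. F (a, y)) b * snd h)) (at p)"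
    by (simp add: p(1) D_def case_prod_unfold)
  thus ?thesis unfolding cdiff2_def by blast
qed

section \<open>The infinite product (q w; q), its zeros and its functional equation\<close>

definition qp :: "complex \<Rightarrow> complex \<Rightarrow> complex" where
  "qp q w = prodinf (\<lambda>n. 1 - q ^ Suc n * w)"

lemma qp_abs_convergent:
  fixes q w :: complex
  assumes "norm q < 1" shows "abs_convergent_prod (\<lambda>n. 1 - q ^ Suc n * w)"
proof (rule summable_imp_abs_convergent_prod)
  have "summable (\<lambda>n. (norm q * norm w) * norm q ^ n)"
    using assms by (intro summable_mult summable_geometric) auto
  thus "summable (\<lambda>n. norm (1 - q ^ Suc n * w - 1))"
    by (simp add: norm_mult norm_power mult_ac)
qed

lemma qp_convergent:
  fixes q w :: complex
  shows "norm q < 1 \<Longrightarrow> convergent_prod (\<lambda>n. 1 - q ^ Suc n * w)"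
  by (intro abs_convergent_prod_imp_convergent_prod qp_abs_convergent)

lemma qp_LIMSEQ:
  assumes "norm q < 1" shows "(\<lambda>N. \<Prod>n<N. 1 - q ^ Suc n * w) \<longlonglongrightarrow> qp q w"
  using convergent_prod_LIMSEQ[OF qp_convergent[OF assms, of w]]
  unfolding qp_def by (rule LIMSEQ_lessThan_iff_atMost[THEN iffD2])

text \<open>The bound \<open>r ^ Suc n * R\<close> is summable and independent of the point.
  Uniformity in both variables at once gives joint continuity and, on fixing one variable,
  holomorphy in the other.\<close>

lemma qp_uniform:
  assumes "0 < r" "r < 1" "0 < R"
  shows "uniform_limit (cball 0 r \<times> cball 0 R) (\<lambda>N p. \<Prod>n<N. 1 - fst p ^ Suc n * snd p)
           (\<lambda>p. qp (fst p) (snd p)) sequentially"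
proof -
  have "uniformly_convergent_on (cball 0 r \<times> cball 0 R) (\<lambda>N p. \<Prod>n<N. 1 - fst p ^ Suc n * snd p :: complex)"
  proof (rule uniformly_convergent_on_prod')
    show "uniformly_convergent_on (cball 0 r \<times> cball 0 R)
       (\<lambda>N x. \<Sum>n<N. norm (1 - fst x ^ Suc n * snd x - 1 :: complex))"
    proof (rule Weierstrass_m_test'_ev)
      have "summable (\<lambda>n. (r * R) * r ^ n)"
        using assms by (intro summable_mult summable_geometric) auto
      thus "summable (\<lambda>n. r ^ Suc n * R)" by (simp add: mult_ac)
      show "\<forall>\<^sub>F n in sequentially. \<forall>x\<in>cball 0 r \<times> cball 0 R.
          norm (norm (1 - fst x ^ Suc n * snd x - 1 :: complex)) \<le> r ^ Suc n * R"
        by (intro always_eventually allI ballI)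
           (auto simp: norm_mult norm_power simp del: power_Suc intro!: mult_mono power_mono zero_le_power less_imp_le[OF assms(1)])
    qed
  qed (auto intro!: continuous_intros compact_Times)
  hence "uniform_limit (cball 0 r \<times> cball 0 R) (\<lambda>N p. \<Prod>n<N. 1 - fst p ^ Suc n * snd p :: complex)
      (\<lambda>p. lim (\<lambda>N. \<Prod>n<N. 1 - fst p ^ Suc n * snd p)) sequentially"
    by (simp add: uniformly_convergent_uniform_limit_iff)
  moreover have "lim (\<lambda>N. \<Prod>n<N. 1 - fst p ^ Suc n * snd p) = qp (fst p) (snd p)"
    if "p \<in> cball 0 r \<times> cball 0 R" for p
    using that assms by (intro limI qp_LIMSEQ) auto
  ultimately show ?thesis
    by (metis (mono_tags, lifting) uniform_limit_cong')
qed

lemma qp_uniform_pt: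
  fixes q w :: complex
  assumes "norm q < 1"
  obtains r R where "0 < r" "r < 1" "0 < R" "q \<in> ball 0 r" "w \<in> ball 0 R"
proof -
  obtain r where "norm q < r" "r < 1" using assms dense by blast
  moreover have "0 < r" using calculation(1) by (meson le_less_trans norm_ge_zero)
  moreover have "w \<in> ball 0 (norm w + 1)" "norm w + 1 > 0"
    by (auto intro: add_nonneg_pos)
  ultimately show ?thesis by (auto intro: that)
qed

lemma qp_continuous: "continuous_on (ball 0 1 \<times> UNIV) (\<lambda>p. qp (fst p) (snd p))"
proof -
  have "isCont (\<lambda>p. qp (fst p) (snd p)) p" if "p \<in> ball 0 1 \<times> UNIV" for p
  proof -
    have "norm (fst p) < 1" using that by (auto simp: mem_Times_iff)
    from qp_uniform_pt[OF this, of "snd p"]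
    obtain r R where r: "0 < r" "r < 1" "0 < R" "fst p \<in> ball 0 r" "snd p \<in> ball 0 R"
      by blast
    have "continuous_on (cball 0 r \<times> cball 0 R) (\<lambda>p. qp (fst p) (snd p))"
      by (rule uniform_limit_theorem[OF _ qp_uniform[OF r(1,2,3)]])
         (auto intro!: always_eventually continuous_intros)
    hence "continuous_on (ball 0 r \<times> ball 0 R) (\<lambda>p. qp (fst p) (snd p))"
      by (rule continuous_on_subset) auto
    moreover have "open (ball (0::complex) r \<times> ball (0::complex) R)" by (intro open_Times) auto
    ultimately show ?thesis
      using r(4,5) by (metis continuous_on_eq_continuous_at mem_Times_iff)
  qed
  thus ?thesis by (simp add: continuous_at_imp_continuous_on)
qed

lemma qp_holomorphic_fst: "(\<lambda>q. qp q w) holomorphic_on ball 0 1"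
proof (rule holomorphic_uniform_sequence)
  fix q :: complex assume "q \<in> ball 0 1"
  then obtain r R where r: "0 < r" "r < 1" "0 < R" "q \<in> ball 0 r" "w \<in> ball 0 R"
    using qp_uniform_pt[of q w] by (auto simp: dist_norm)
  obtain d where d: "d > 0" "cball q d \<subseteq> ball 0 r" using r(4) open_contains_cball open_ball by blast
  have "uniform_limit ((\<lambda>q. (q, w)) -` (cball 0 r \<times> cball 0 R)) (\<lambda>N q. \<Prod>n<N. 1 - q ^ Suc n * w) (\<lambda>q. qp q w) sequentially"
    using uniform_limit_compose'[OF qp_uniform[OF r(1,2,3)], of "\<lambda>q. (q, w)"] by simp
  hence "uniform_limit (cball q d) (\<lambda>N q. \<Prod>n<N. 1 - q ^ Suc n * w) (\<lambda>q. qp q w) sequentially"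
    by (rule uniform_limit_on_subset) (use d r in \<open>auto simp: subset_eq dist_norm less_imp_le\<close>)
  moreover have "cball q d \<subseteq> ball 0 1"
    using d(2) r(2) by (meson less_imp_le order_trans subset_ball)
  ultimately show "\<exists>d>0. cball q d \<subseteq> ball 0 1 \<and>
      uniform_limit (cball q d) (\<lambda>N q. \<Prod>n<N. 1 - q ^ Suc n * w) (\<lambda>q. qp q w) sequentially"
    using d by blast
qed (auto intro!: holomorphic_intros)

lemma qp_holomorphic_snd:
  assumes "norm q < 1" shows "(\<lambda>w. qp q w) holomorphic_on UNIV"
proof (rule holomorphic_uniform_sequence)
  fix w :: complex
  obtain r R where r: "0 < r" "r < 1" "0 < R" "q \<in> ball 0 r" "w \<in> ball 0 R"
    using qp_uniform_pt[OF assms, of w] by blast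
  obtain d where d: "d > 0" "cball w d \<subseteq> ball 0 R" using r(5) open_contains_cball open_ball by blast
  have "uniform_limit ((\<lambda>w. (q, w)) -` (cball 0 r \<times> cball 0 R)) (\<lambda>N w. \<Prod>n<N. 1 - q ^ Suc n * w) (\<lambda>w. qp q w) sequentially"
    using uniform_limit_compose'[OF qp_uniform[OF r(1,2,3)], of "\<lambda>w. (q, w)"] by simp
  hence "uniform_limit (cball w d) (\<lambda>N w. \<Prod>n<N. 1 - q ^ Suc n * w) (\<lambda>w. qp q w) sequentially"
    by (rule uniform_limit_on_subset) (use d r in \<open>auto simp: subset_eq dist_norm less_imp_le\<close>)
  thus "\<exists>d>0. cball w d \<subseteq> UNIV \<and>
      uniform_limit (cball w d) (\<lambda>N w. \<Prod>n<N. 1 - q ^ Suc n * w) (\<lambda>w. qp q w) sequentially"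
    using d by blast
qed (auto intro!: holomorphic_intros)

text \<open>Joint continuity and the two separate holomorphies enter through \<open>osgood\<close>;
  composition then admits arbitrary holomorphic arguments.\<close>

lemma hol_at_qp:
  assumes "hol_at F p" "hol_at G p" "norm (F p) < 1"
  shows "hol_at (\<lambda>p. qp (F p) (G p)) p"
proof -
  have "cdiff2 (\<lambda>p. qp (fst p) (snd p)) p" if "p \<in> ball 0 1 \<times> UNIV" for p
    by (rule osgood[of "ball 0 1" UNIV])
       (use that in \<open>auto intro: qp_continuous qp_holomorphic_fst qp_holomorphic_snd\<close>)
  moreover have "eventually (\<lambda>p::complex\<times>complex. p \<in> ball 0 1 \<times> UNIV) (nhds (F p, G p))"
    using assms(3) by (intro eventually_nhds_in_open open_Times) auto
  ultimately have "hol_at (\<lambda>p. qp (fst p) (snd p)) (F p, G p)"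
    unfolding hol_at_def by (metis (mono_tags, lifting) eventually_mono)
  from hol_at_comp[OF this assms(1,2)] show ?thesis by simp
qed

text \<open>A product that converges in the strict sense is zero only if one of its factors is. This
  makes all zeros of the theta functions explicit.\<close>

lemma qp_eq_0_iff:
  assumes "norm q < 1" shows "qp q w = 0 \<longleftrightarrow> (\<exists>n. q ^ Suc n * w = 1)"
proof
  assume "qp q w = 0"
  thus "\<exists>n. q ^ Suc n * w = 1"
    using prodinf_nonzero[OF qp_convergent[OF assms, of w]] unfolding qp_def
    by (metis right_minus_eq)
next
  assume "\<exists>n. q ^ Suc n * w = 1"
  then obtain m where m: "q ^ Suc m * w = 1" by blast
  have "eventually (\<lambda>N. (\<Prod>n<N. 1 - q ^ Suc n * w) = 0) sequentially"
    using eventually_gt_at_top[of m]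
  proof eventually_elim
    case (elim N)
    thus ?case using m by (intro prod_zero) auto
  qed
  hence "(\<lambda>N. \<Prod>n<N. 1 - q ^ Suc n * w) \<longlonglongrightarrow> 0"
    by (rule tendsto_eventually)
  thus "qp q w = 0" using qp_LIMSEQ[OF assms] LIMSEQ_unique by blast
qed

text \<open>Shifting w by q drops the factor with exponent 1, which the prefactor restores. The
  quasi-periodicity of theta originates here.\<close>

lemma qp_shift:
  assumes "norm q < 1" shows "(1 - q * w) * qp q (q * w) = qp q w"
proof -
  have "(\<lambda>N. (1 - q * w) * (\<Prod>n<N. 1 - q ^ Suc n * (q * w))) \<longlonglongrightarrow> (1 - q * w) * qp q (q * w)"
    by (intro tendsto_intros qp_LIMSEQ assms)
  moreover have "(1 - q * w) * (\<Prod>n<N. 1 - q ^ Suc n * (q * w)) = (\<Prod>n<Suc N. 1 - q ^ Suc n * w)" for N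
    by (subst prod.lessThan_Suc_shift) (simp add: mult_ac)
  ultimately have "(\<lambda>N. \<Prod>n<Suc N. 1 - q ^ Suc n * w) \<longlonglongrightarrow> (1 - q * w) * qp q (q * w)"
    by simp
  hence "(\<lambda>N. \<Prod>n<N. 1 - q ^ Suc n * w) \<longlonglongrightarrow> (1 - q * w) * qp q (q * w)"
    by (rule LIMSEQ_imp_Suc)
  thus ?thesis using qp_LIMSEQ[OF assms] LIMSEQ_unique by blast
qed


section \<open>Theta functions\<close>

lemma ee_0 [simp]: "ee 0 = 1"
  by (simp add: ee_def)

lemma ee_nonzero [simp]: "ee w \<noteq> 0"
  by (simp add: ee_def)

lemma ee_add: "ee (a + b) = ee a * ee b"
  by (simp add: ee_def exp_add algebra_simps)

lemma ee_minus: "ee (- a) = inverse (ee a)"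
  by (simp add: ee_def exp_minus)

lemma ee_diff: "ee (a - b) = ee a / ee b"
  using ee_add[of a "-b"] by (simp add: ee_minus field_simps)

lemma ee_eq_1_iff: "ee w = 1 \<longleftrightarrow> (\<exists>n::int. w = of_int n)"
proof -
  have "ee w = 1 \<longleftrightarrow> Im w = 0 \<and> (\<exists>n::int. Re w = of_int n)"
    by (simp add: ee_def exp_eq_1)
  thus ?thesis by (auto simp: complex_eq_iff)
qed

lemma ee_of_int [simp]: "ee (of_int n) = 1"
  using ee_eq_1_iff by blast

lemma ee_1 [simp]: "ee 1 = 1"
  using ee_of_int[of 1] by simp

lemma ee_half: "ee (1/2) = -1"
  by (simp add: ee_def)

lemma norm_ee: "norm (ee w) = exp (- 2 * pi * Im w)"
  by (simp add: ee_def)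

lemma norm_ee_less_1 [simp]: "0 < Im w \<Longrightarrow> norm (ee w) < 1"
  by (simp add: norm_ee)

lemma ee_of_nat_mult: "ee (of_nat n * w) = ee w ^ n"
  by (induction n) (auto simp: ee_add algebra_simps)

lemma ee_of_int_mult: "ee (of_int n * w) = ee w powi n"
proof (cases "n \<ge> 0")
  case True
  thus ?thesis using ee_of_nat_mult[of "nat n" w] by (simp add: power_int_def)
next
  case False
  hence "complex_of_int n = - of_nat (nat (- n))" by simp
  hence "ee (of_int n * w) = ee (- (of_nat (nat (- n)) * w))"
    by (simp only: mult_minus_left)
  also have "\<dots> = inverse (ee w ^ nat (- n))"
    by (simp only: ee_minus ee_of_nat_mult)
  also have "\<dots> = ee w powi n"
    using False by (simp add: power_int_def power_inverse)
  finally show ?thesis .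
qed

lemma eta_qp:
  assumes "0 < Im \<tau>" shows "eta \<tau> = ee (\<tau> / 24) * qp (ee \<tau>) 1"
  unfolding eta_def qp_def by (simp add: ee_of_nat_mult del: of_nat_Suc)

text \<open>Because \<open>qp\<close> starts at exponent 1, the zeros of theta at integers z stay in
  the elementary factor \<open>ee (z / 2) - ee (- z / 2)\<close>.\<close>

lemma theta_qp:
  assumes "0 < Im \<tau>"
  shows "theta \<tau> z = ee (\<tau> / 8) * (ee (z / 2) - ee (- z / 2)) *
           (qp (ee \<tau>) (ee z) * qp (ee \<tau>) (ee (- z)) * qp (ee \<tau>) 1)"
proof -
  note c = qp_convergent[OF norm_ee_less_1[OF assms]]
  have "qp (ee \<tau>) (ee z) * qp (ee \<tau>) (ee (- z)) * qp (ee \<tau>) 1 =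
     prodinf (\<lambda>n. (1 - ee \<tau> ^ Suc n * ee z) * (1 - ee \<tau> ^ Suc n * ee (- z)) * (1 - ee \<tau> ^ Suc n * 1))"
    unfolding qp_def by (subst prodinf_mult prodinf_mult; (intro convergent_prod_mult c)?)+ simp
  thus ?thesis unfolding theta_def by (simp add: ee_of_nat_mult del: of_nat_Suc)
qed

lemma qp_1_nonzero: "norm q < 1 \<Longrightarrow> qp q 1 \<noteq> 0"
proof
  assume q: "norm q < 1" and "qp q 1 = 0"
  then obtain n where "q ^ Suc n = 1" using qp_eq_0_iff[OF q] by auto
  hence "norm q ^ Suc n = 1" by (metis norm_one norm_power)
  moreover have "norm q ^ Suc n \<le> norm q ^ 1" using q by (intro power_decreasing) auto
  ultimately show False using q by simp
qed

lemma eta_nonzero: "0 < Im \<tau> \<Longrightarrow> eta \<tau> \<noteq> 0"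
  by (simp add: eta_qp qp_1_nonzero)

lemma theta_add_1: "theta \<tau> (z + 1) = - theta \<tau> z"
proof -
  have "ee ((z + 1) / 2) = - ee (z / 2)" "ee (- (z + 1) / 2) = - ee (- z / 2)"
    using ee_add[of "z/2" "1/2"] ee_diff[of "-z/2" "1/2"] by (simp_all add: ee_half add_divide_distrib diff_divide_distrib)
  moreover have "ee (z + 1) = ee z" "ee (- (z + 1)) = ee (- z)"
    using ee_add[of z 1] ee_diff[of "-z" 1] by simp_all
  ultimately show ?thesis unfolding theta_def by (simp add: algebra_simps)
qed

text \<open>In terms of the square roots x of zeta and y of q this is a rational identity: one of
  the products loses its leading factor and the other gains one.\<close>

lemma theta_add_tau:
  assumes "0 < Im \<tau>"
  shows "theta \<tau> (z + \<tau>) = - ee (- \<tau> / 2 - z) * theta \<tau> z"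
proof -
  define x where "x = ee (z / 2)"
  define y where "y = ee (\<tau> / 2)"
  have nz: "x \<noteq> 0" "y \<noteq> 0" by (auto simp: x_def y_def)
  have x2: "ee z = x ^ 2" using ee_of_nat_mult[of 2 "z/2"] by (simp add: x_def)
  have y2: "ee \<tau> = y ^ 2" using ee_of_nat_mult[of 2 "\<tau>/2"] by (simp add: y_def)
  have n: "norm (y ^ 2) < 1" using norm_ee_less_1[OF assms] by (simp add: y2)
  define A where "A = qp (y ^ 2) (y ^ 2 * x ^ 2)"
  define B where "B = qp (y ^ 2) (inverse (x ^ 2))"
  have 1: "qp (y ^ 2) (x ^ 2) = (1 - y ^ 2 * x ^ 2) * A"
    using qp_shift[OF n] by (simp add: A_def)
  have 2: "qp (y ^ 2) (inverse (y ^ 2 * x ^ 2)) = (1 - inverse (x ^ 2)) * B"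
    using qp_shift[OF n, of "inverse (y ^ 2 * x ^ 2)"] nz by (simp add: B_def field_simps)
  have 3: "ee ((z + \<tau>) / 2) = x * y" "ee (- (z + \<tau>) / 2) = inverse (x * y)"
     "ee (- z / 2) = inverse x" "ee (- \<tau> / 2 - z) = inverse (y * x ^ 2)"
    using ee_add[of "z/2" "\<tau>/2"] ee_minus[of "z/2 + \<tau>/2"] ee_minus[of "z/2"] ee_minus[of "\<tau>/2 + z"] ee_add[of "\<tau>/2" z]
    by (simp_all add: x_def[symmetric] y_def[symmetric] x2 add_divide_distrib diff_divide_distrib)
  have 4: "ee (z + \<tau>) = y ^ 2 * x ^ 2" "ee (- (z + \<tau>)) = inverse (y ^ 2 * x ^ 2)" "ee (- z) = inverse (x ^ 2)"
    using ee_add[of z \<tau>] ee_minus[of "z + \<tau>"] by (simp_all add: x2 y2 ee_minus mult_ac)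
  show ?thesis
    unfolding theta_qp[OF assms] 3 4 x2 y2 1 2 A_def[symmetric] B_def[symmetric] x_def[symmetric]
    using nz by (simp add: field_simps power2_eq_square)
qed

lemma theta_diff_tau:
  assumes "0 < Im \<tau>"
  shows "theta \<tau> (z - \<tau>) = - ee (- \<tau> / 2 + z) * theta \<tau> z"
proof -
  have "theta \<tau> z = - ee (- \<tau> / 2 - (z - \<tau>)) * theta \<tau> (z - \<tau>)"
    using theta_add_tau[OF assms, of "z - \<tau>"] by simp
  moreover have "ee (- \<tau> / 2 - (z - \<tau>)) * ee (- \<tau> / 2 + z) = 1"
    by (subst ee_add[symmetric]) simp
  ultimately show ?thesis by (simp add: mult_ac)
qed

lemma theta_add_int: "theta \<tau> (z + of_int b) = (-1) powi b * theta \<tau> z"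
proof (induction b rule: int_induct[where k = 0])
  case (step1 i)
  thus ?case using theta_add_1[of \<tau> "z + of_int i"] by (simp add: add_ac power_int_add)
next
  case (step2 i)
  thus ?case using theta_add_1[of \<tau> "z + of_int i - 1"] by (simp add: add_ac power_int_diff algebra_simps)
qed simp

text \<open>The one-step law is iterated, and its exponents add up to a quadratic in a. With
  \<open>theta_add_int\<close> it moves every lattice zero to the origin.\<close>

lemma theta_add_int_tau:
  assumes "0 < Im \<tau>"
  shows "theta \<tau> (z + of_int a * \<tau>) =
    (-1) powi a * ee (- (of_int a)\<^sup>2 * \<tau> / 2 - of_int a * z) * theta \<tau> z"
proof (induction a rule: int_induct[where k = 0])
  case (step1 i)
  have "theta \<tau> (z + of_int (i + 1) * \<tau>) = theta \<tau> (z + of_int i * \<tau> + \<tau>)"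
    by (simp add: algebra_simps)
  also have "\<dots> = - ((-1) powi i) * (ee (- \<tau> / 2 - (z + of_int i * \<tau>)) * ee (- (of_int i)\<^sup>2 * \<tau> / 2 - of_int i * z)) * theta \<tau> z"
    unfolding theta_add_tau[OF assms] step1 by simp
  also have "ee (- \<tau> / 2 - (z + of_int i * \<tau>)) * ee (- (of_int i)\<^sup>2 * \<tau> / 2 - of_int i * z) =
     ee (- (of_int (i+1))\<^sup>2 * \<tau> / 2 - of_int (i+1) * z)"
    by (subst ee_add[symmetric], rule arg_cong[of _ _ ee]) (simp add: field_simps power2_eq_square)
  finally show ?case by (simp add: power_int_add)
next
  case (step2 i)
  have "theta \<tau> (z + of_int (i - 1) * \<tau>) = theta \<tau> (z + of_int i * \<tau> - \<tau>)"
    by (simp add: algebra_simps)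
  also have "\<dots> = - ((-1) powi i) * (ee (- \<tau> / 2 + (z + of_int i * \<tau>)) * ee (- (of_int i)\<^sup>2 * \<tau> / 2 - of_int i * z)) * theta \<tau> z"
    unfolding theta_diff_tau[OF assms] step2 by simp
  also have "ee (- \<tau> / 2 + (z + of_int i * \<tau>)) * ee (- (of_int i)\<^sup>2 * \<tau> / 2 - of_int i * z) =
     ee (- (of_int (i-1))\<^sup>2 * \<tau> / 2 - of_int (i-1) * z)"
    by (subst ee_add[symmetric], rule arg_cong[of _ _ ee]) (simp add: field_simps power2_eq_square)
  finally show ?case by (simp add: power_int_diff)
qed simp

section \<open>The simple zero of theta at the origin and its lattice translates\<close>

definition snc :: "complex \<Rightarrow> complex" where
  "snc z = (if z = 0 then 2 * of_real pi * \<i> else (ee (z / 2) - ee (- z / 2)) / z)"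

text \<open>The singularity at 0 is removable, and the value 2 pi i put there is the derivative of
  the numerator.\<close>

lemma snc_holomorphic: "snc holomorphic_on UNIV"
proof -
  define s where "s = (\<lambda>z. ee (z / 2) - ee (- z / 2))"
  have d: "deriv s 0 = 2 * of_real pi * \<i>"
  proof (rule DERIV_imp_deriv)
    show "(s has_field_derivative 2 * of_real pi * \<i>) (at 0)"
      unfolding s_def ee_def by (auto intro!: derivative_eq_intros)
  qed
  have "s holomorphic_on UNIV" unfolding s_def ee_def by (intro holomorphic_intros) auto
  hence "(\<lambda>z. if z = 0 then deriv s 0 else s z / z - s 0 / (z - 0)) holomorphic_on UNIV"
    by (rule pole_theorem_open) auto
  moreover have "(if z = 0 then deriv s 0 else s z / z - s 0 / (z - 0)) = snc z" for z
    unfolding d snc_def by (simp add: s_def)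
  ultimately show ?thesis by simp
qed

text \<open>Theta with its zero at z = 0 divided out. At z = 0 it takes the value 2 pi i eta^3,
  hence is a unit there.\<close>

definition thetac :: "complex \<Rightarrow> complex \<Rightarrow> complex" where
  "thetac \<tau> z = ee (\<tau> / 8) * snc z * (qp (ee \<tau>) (ee z) * qp (ee \<tau>) (ee (- z)) * qp (ee \<tau>) 1)"

lemma theta_eq_thetac: "0 < Im \<tau> \<Longrightarrow> theta \<tau> z = z * thetac \<tau> z"
  by (simp add: theta_qp thetac_def snc_def)

lemma hol_at_thetac:
  assumes "hol_at F p" "hol_at G p" "0 < Im (F p)"
  shows "hol_at (\<lambda>p. thetac (F p) (G p)) p"
  unfolding thetac_def
  by (intro hol_at_intros hol_at_qp hol_at_comp1[OF snc_holomorphic] assms norm_ee_less_1) auto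

lemma eventually_Im_pos:
  assumes "hol_at F p" "0 < Im (F p)" shows "eventually (\<lambda>p. 0 < Im (F p)) (nhds p)"
  by (rule eventually_hol_at[OF assms(1)])
     (use assms(2) open_halfspace_Im_gt[of 0] in \<open>auto intro: eventually_nhds_in_open[where s = "{x. Im x > 0}", simplified]\<close>)

lemma hol_at_theta:
  assumes "hol_at F p" "hol_at G p" "0 < Im (F p)"
  shows "hol_at (\<lambda>p. theta (F p) (G p)) p"
proof (rule hol_at_cong_ev)
  show "hol_at (\<lambda>p. G p * thetac (F p) (G p)) p"
    by (intro hol_at_mult hol_at_thetac assms)
  show "eventually (\<lambda>p. G p * thetac (F p) (G p) = theta (F p) (G p)) (nhds p)"
    using eventually_Im_pos[OF assms(1,3)] by eventually_elim (simp add: theta_eq_thetac)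
qed

lemma unit_at_eta:
  assumes "hol_at F p" "0 < Im (F p)"
  shows "unit_at (\<lambda>p. eta (F p)) p"
proof -
  have "hol_at (\<lambda>p. eta (F p)) p"
  proof (rule hol_at_cong_ev)
    show "hol_at (\<lambda>p. ee (F p / 24) * qp (ee (F p)) 1) p"
      by (intro hol_at_intros hol_at_qp assms norm_ee_less_1)
    show "eventually (\<lambda>p. ee (F p / 24) * qp (ee (F p)) 1 = eta (F p)) (nhds p)"
      using eventually_Im_pos[OF assms] by eventually_elim (simp add: eta_qp)
  qed
  thus ?thesis using assms by (simp add: unit_at_def eta_nonzero)
qed

lemma thetac_0_nonzero: "0 < Im \<tau> \<Longrightarrow> thetac \<tau> 0 \<noteq> 0"
  by (simp add: thetac_def snc_def qp_1_nonzero)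

text \<open>Each factor of the product vanishes at lattice points only: the elementary one at
  integers, the two infinite products at z = - n \<tau> + b and z = n \<tau> + b with n \<ge>
  1.\<close>

lemma theta_eq_0D:
  assumes "0 < Im \<tau>" "theta \<tau> z = 0"
  obtains a b :: int where "z = of_int a * \<tau> + of_int b"
proof -
  have q: "norm (ee \<tau>) < 1" using assms by simp
  have *: "\<exists>b::int. w = of_int (- int (Suc n)) * \<tau> + of_int b" if "ee \<tau> ^ Suc n * ee w = 1" for n w
  proof -
    have "ee (of_nat (Suc n) * \<tau> + w) = 1"
      using that by (simp only: ee_add ee_of_nat_mult)
    then obtain b :: int where "of_nat (Suc n) * \<tau> + w = of_int b" using ee_eq_1_iff by blast
    thus ?thesis by (intro exI[of _ b]) (auto simp: algebra_simps)
  qed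
  consider "ee (z / 2) = ee (- z / 2)" | "qp (ee \<tau>) (ee z) = 0" | "qp (ee \<tau>) (ee (- z)) = 0"
    using assms q by (auto simp: theta_qp qp_1_nonzero)
  thus ?thesis
  proof cases
    case 1
    have "ee z = ee (z / 2) / ee (- z / 2)" by (subst ee_diff[symmetric]) simp
    hence "ee z = 1" using 1 by simp
    then obtain b :: int where "z = of_int b" using ee_eq_1_iff by blast
    thus ?thesis using that[of 0 b] by simp
  next
    case 2
    then obtain n where "ee \<tau> ^ Suc n * ee z = 1" using qp_eq_0_iff[OF q] by blast
    from *[OF this] show ?thesis using that by blast
  next
    case 3
    then obtain n where "ee \<tau> ^ Suc n * ee (- z) = 1" using qp_eq_0_iff[OF q] by blast
    from *[OF this] obtain b :: int where "- z = of_int (- int (Suc n)) * \<tau> + of_int b" by blast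
    hence "z = of_int (int (Suc n)) * \<tau> + of_int (- b)"
      by (simp add: algebra_simps minus_equation_iff[of z])
    thus ?thesis using that by blast
  qed
qed

text \<open>
  The line of points \<open>z = \<alpha> \<tau> + \<beta>\<close>. Its points are torsion points for the lattice \<open>\<int> \<tau> + \<int>\<close> iff some
  \<open>s \<ge> 1\<close> annihilates \<open>(\<alpha>, \<beta>)\<close> modulo \<open>\<int>\<^sup>2\<close>.
\<close>

definition torsion_line :: "real \<Rightarrow> real \<Rightarrow> complex \<times> complex \<Rightarrow> complex" where
  "torsion_line \<alpha> \<beta> p = snd p - of_real \<alpha> * fst p - of_real \<beta>"

definition annihilates :: "real \<Rightarrow> real \<Rightarrow> nat \<Rightarrow> bool" where
  "annihilates \<alpha> \<beta> s \<longleftrightarrow> of_nat s * \<alpha> \<in> \<int> \<and> of_nat s * \<beta> \<in> \<int>"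

lemma hol_at_torsion_line [simp]: "hol_at (torsion_line \<alpha> \<beta>) p"
  unfolding torsion_line_def by (intro hol_at_intros)

text \<open>If s annihilates (\<alpha>, \<beta>), then s z differs from s times
  \<open>torsion_line\<close> by a \<tau> + b with fixed integers a and b, for every nearby \<tau>.
  Quasi-periodicity then replaces the point by the origin, where theta is z times a unit. Otherwise
  s z0 is no lattice point and the theta function itself is a unit.\<close>

lemma theta_r_local:
  assumes "0 < Im \<tau>0" and z0: "z0 = of_real \<alpha> * \<tau>0 + of_real \<beta>" and s: "s \<ge> 1"
  obtains U where "unit_at U (\<tau>0, z0)"
    "eventually (\<lambda>p. theta_r s (fst p) (snd p) =
       torsion_line \<alpha> \<beta> p powi (if annihilates \<alpha> \<beta> s then 1 else 0) * U p) (nhds (\<tau>0, z0))"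
proof (cases "annihilates \<alpha> \<beta> s")
  case True
  then obtain a b :: int where ab: "of_nat s * \<alpha> = of_int a" "of_nat s * \<beta> = of_int b"
    by (auto simp: annihilates_def elim!: Ints_cases)
  define U where "U = (\<lambda>p. (-1) powi (a + b) *
     ee (- (of_int a)\<^sup>2 * fst p / 2 - of_int a * (of_nat s * torsion_line \<alpha> \<beta> p)) *
     of_nat s * thetac (fst p) (of_nat s * torsion_line \<alpha> \<beta> p))"
  have "hol_at U (\<tau>0, z0)"
    unfolding U_def by (intro hol_at_intros hol_at_thetac hol_at_torsion_line) (use assms in auto)
  moreover have "torsion_line \<alpha> \<beta> (\<tau>0, z0) = 0" by (simp add: torsion_line_def z0)
  hence "U (\<tau>0, z0) \<noteq> 0" using s assms(1) by (simp add: U_def thetac_0_nonzero)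
  ultimately have U: "unit_at U (\<tau>0, z0)" by (simp add: unit_at_def)
  have "eventually (\<lambda>p. 0 < Im (fst p)) (nhds (\<tau>0, z0))"
    by (rule eventually_Im_pos) (use assms in auto)
  hence "eventually (\<lambda>p. theta_r s (fst p) (snd p) = torsion_line \<alpha> \<beta> p powi 1 * U p) (nhds (\<tau>0, z0))"
  proof eventually_elim
    case (elim p)
    have eqs: "complex_of_nat s * of_real \<alpha> = of_int a" "complex_of_nat s * of_real \<beta> = of_int b"
      using ab by (metis of_real_mult of_real_of_nat_eq of_real_of_int_eq)+
    have "of_nat s * snd p = of_nat s * torsion_line \<alpha> \<beta> p + (of_nat s * of_real \<alpha>) * fst p + of_nat s * of_real \<beta>"
      by (simp add: torsion_line_def algebra_simps)
    hence "of_nat s * snd p = of_nat s * torsion_line \<alpha> \<beta> p + of_int a * fst p + of_int b"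
      by (simp only: eqs)
    hence "theta_r s (fst p) (snd p) =
        theta (fst p) (of_nat s * torsion_line \<alpha> \<beta> p + of_int a * fst p + of_int b)"
      by (simp only: theta_r_def)
    also have "\<dots> = torsion_line \<alpha> \<beta> p powi 1 * U p"
      unfolding theta_add_int theta_add_int_tau[OF elim] theta_eq_thetac[OF elim, of "of_nat s * torsion_line \<alpha> \<beta> p"]
      by (simp add: U_def power_int_add mult_ac)
    finally show ?case .
  qed
  thus ?thesis using that U True by simp
next
  case False
  define U where "U = (\<lambda>p. theta_r s (fst p) (snd p))"
  have "hol_at U (\<tau>0, z0)"
    unfolding U_def theta_r_def by (intro hol_at_intros hol_at_theta) (use assms in auto)
  moreover have "U (\<tau>0, z0) \<noteq> 0"
  proof
    assume "U (\<tau>0, z0) = 0"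
    then obtain a b :: int where ab: "of_nat s * z0 = of_int a * \<tau>0 + of_int b"
      using theta_eq_0D[OF assms(1)] by (auto simp: U_def theta_r_def)
    \<comment> \<open>Since Im \<tau>0 is nonzero, the real coordinates of s z0 are unique and must
      be the integers a and b.\<close>
    hence "Im (of_nat s * z0) = of_int a * Im \<tau>0" by simp
    hence a: "of_nat s * \<alpha> = of_int a" using assms(1) by (simp add: z0)
    have "Re (of_nat s * z0) = of_int a * Re \<tau>0 + of_int b" using ab by simp
    hence "of_nat s * \<beta> = of_int b" by (simp add: z0 a[symmetric] algebra_simps)
    hence "annihilates \<alpha> \<beta> s" using a by (simp add: annihilates_def)
    thus False using False by simp
  qed
  ultimately have "unit_at U (\<tau>0, z0)" by (simp add: unit_at_def)
  thus ?thesis using that[of U] False by (simp add: U_def)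
qed


section \<open>Vanishing orders along torsion points\<close>

text \<open>If a exceeded b, dividing by the power with exponent b would make the left side tend to
  0 and the right side to \<open>v z0\<close>. The function u may itself vanish at z0, whence an
  inequality and not an equality.\<close>

lemma order_le:
  fixes u v :: "complex \<Rightarrow> complex"
  assumes eq: "eventually (\<lambda>z. (z - z0) powi a * u z = (z - z0) powi b * v z) (at z0)"
    and u: "isCont u z0" and v: "isCont v z0" "v z0 \<noteq> 0"
  shows "a \<le> b"
proof (rule ccontr)
  assume "\<not> a \<le> b"
  have "eventually (\<lambda>z. (z - z0) ^ nat (a - b) * u z = v z) (at z0)"
    using eq eventually_neq_at_within[of z0 z0 UNIV]
  proof eventually_elim
    case (elim z)
    have "(z - z0) powi a = (z - z0) powi b * (z - z0) powi (a - b)"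
      using elim by (subst power_int_add[symmetric]) auto
    hence "(z - z0) powi b * ((z - z0) powi (a - b) * u z) = (z - z0) powi b * v z"
      using elim by (simp add: mult_ac)
    moreover have "(z - z0) powi b \<noteq> 0" using elim by simp
    ultimately have "(z - z0) powi (a - b) * u z = v z" by (metis mult_left_cancel)
    thus ?case using \<open>\<not> a \<le> b\<close> by (simp add: power_int_def)
  qed
  moreover have "((\<lambda>z. (z - z0) ^ nat (a - b) * u z) \<longlongrightarrow> (z0 - z0) ^ nat (a - b) * u z0) (at z0)"
    using u unfolding isCont_def by (intro tendsto_intros) auto
  ultimately have "(v \<longlongrightarrow> (z0 - z0) ^ nat (a - b) * u z0) (at z0)"
    using tendsto_cong by fast
  moreover have "(z0 - z0) ^ nat (a - b) * u z0 = 0" using \<open>\<not> a \<le> b\<close> by simp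
  ultimately have "(v \<longlongrightarrow> 0) (at z0)" by metis
  thus False using v LIM_unique unfolding isCont_def by blast
qed

lemma eventually_line:
  assumes "eventually P (nhds (\<tau>, z))" shows "eventually (\<lambda>w. P (\<tau>, w)) (at z)"
proof -
  have "((\<lambda>w. (\<tau>, w)) \<longlongrightarrow> (\<tau>, z)) (at z)" by (intro tendsto_intros)
  with assms show ?thesis by (rule eventually_compose_filterlim)
qed

lemma isCont_line:
  fixes F :: "complex \<times> complex \<Rightarrow> complex"
  shows "isCont F (\<tau>, z) \<Longrightarrow> isCont (\<lambda>w. F (\<tau>, w)) z"
  by (rule isCont_o2[of z "\<lambda>w. (\<tau>, w)" F]) (intro continuous_intros)

lemma unit_at_line:
  assumes "unit_at U (\<tau>, z)" shows "isCont (\<lambda>w. U (\<tau>, w)) z" "U (\<tau>, z) \<noteq> 0"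
  using assms isCont_line[where F = U] hol_at_isCont[where F = U] by (simp_all add: unit_at_def)

text \<open>In a slice with fixed \<tau> the line is a single point, so values on it are limits in z
  of values off it. As everything is assumed near p, this applies at every nearby point of the
  line.\<close>

lemma eventually_eq_across_line:
  assumes "hol_at F p" "hol_at G p"
    and "eventually (\<lambda>p. torsion_line \<alpha> \<beta> p \<noteq> 0 \<longrightarrow> F p = G p) (nhds p)"
  shows "eventually (\<lambda>p. F p = G p) (nhds p)"
proof -
  have "eventually (\<lambda>p. eventually (\<lambda>p. torsion_line \<alpha> \<beta> p \<noteq> 0 \<longrightarrow> F p = G p) (nhds p)) (nhds p)"
    using assms(3) by (simp add: eventually_eventually)
  with assms(1,2)[unfolded hol_at_def] show ?thesis
  proof eventually_elim
    case (elim p)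
    show ?case
    proof (cases "torsion_line \<alpha> \<beta> p = 0")
      case True
      obtain \<tau> z where p: "p = (\<tau>, z)" by force
      have tl: "torsion_line \<alpha> \<beta> (\<tau>, w) = w - z" for w
        using True by (simp add: p torsion_line_def algebra_simps)
      have "eventually (\<lambda>w. torsion_line \<alpha> \<beta> (\<tau>, w) \<noteq> 0 \<longrightarrow> F (\<tau>, w) = G (\<tau>, w)) (at z)"
        using eventually_line elim(3) unfolding p by fast
      hence ev: "eventually (\<lambda>w. F (\<tau>, w) = G (\<tau>, w)) (at z)"
        using eventually_neq_at_within[of z z UNIV] by eventually_elim (simp add: tl)
      have F: "((\<lambda>w. F (\<tau>, w)) \<longlongrightarrow> F (\<tau>, z)) (at z)"
        using isCont_line[OF cdiff2_isCont[OF elim(1)[unfolded p]]] by (simp add: isCont_def)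
      have G: "((\<lambda>w. G (\<tau>, w)) \<longlongrightarrow> G (\<tau>, z)) (at z)"
        using isCont_line[OF cdiff2_isCont[OF elim(2)[unfolded p]]] by (simp add: isCont_def)
      have "F (\<tau>, z) = G (\<tau>, z)"
        using F unfolding tendsto_cong[OF ev] by (rule LIM_unique[OF _ G])
      thus ?thesis by (simp add: p)
    qed (use eventually_nhds_x_imp_x[OF elim(3)] in auto)
  qed
qed

lemma powi_sum:
  assumes "x \<noteq> (0::complex)" shows "x powi (\<Sum>i\<in>A. f i) = (\<Prod>i\<in>A. x powi f i)"
  by (induction A rule: infinite_finite_induct) (auto simp: power_int_add assms)

text \<open>Index 0 is left out because eta has no zeros in the upper half plane.\<close>

definition vanishing_order :: "(nat \<Rightarrow> int) \<Rightarrow> real \<Rightarrow> real \<Rightarrow> int" where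
  "vanishing_order \<phi> \<alpha> \<beta> = (\<Sum>r | 1 \<le> r \<and> \<phi> r \<noteq> 0. if annihilates \<alpha> \<beta> r then \<phi> r else 0)"

lemma theta_r_local':
  assumes "0 < Im \<tau>0" "z0 = of_real \<alpha> * \<tau>0 + of_real \<beta>"
  obtains V where "\<And>s. s \<ge> 1 \<Longrightarrow> unit_at (V s) (\<tau>0, z0)"
    "\<And>s. s \<ge> 1 \<Longrightarrow> eventually (\<lambda>p. theta_r s (fst p) (snd p) =
       torsion_line \<alpha> \<beta> p powi (if annihilates \<alpha> \<beta> s then 1 else 0) * V s p) (nhds (\<tau>0, z0))"
proof -
  have "\<forall>s. \<exists>U. s \<ge> 1 \<longrightarrow> unit_at U (\<tau>0, z0) \<and>
    eventually (\<lambda>p. theta_r s (fst p) (snd p) =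
       torsion_line \<alpha> \<beta> p powi (if annihilates \<alpha> \<beta> s then 1 else 0) * U p) (nhds (\<tau>0, z0))"
  proof
    fix s show "\<exists>U. s \<ge> 1 \<longrightarrow> unit_at U (\<tau>0, z0) \<and>
      eventually (\<lambda>p. theta_r s (fst p) (snd p) =
       torsion_line \<alpha> \<beta> p powi (if annihilates \<alpha> \<beta> s then 1 else 0) * U p) (nhds (\<tau>0, z0))"
    proof (cases "s \<ge> 1")
      case True
      from theta_r_local[OF assms this] show ?thesis by blast
    qed auto
  qed
  then obtain V where "\<forall>s. s \<ge> 1 \<longrightarrow> unit_at (V s) (\<tau>0, z0) \<and>
    eventually (\<lambda>p. theta_r s (fst p) (snd p) =
       torsion_line \<alpha> \<beta> p powi (if annihilates \<alpha> \<beta> s then 1 else 0) * V s p) (nhds (\<tau>0, z0))"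
    unfolding choice_iff by blast
  thus ?thesis using that by blast
qed

lemma powi_if_mult:
  "(x powi (if c then 1 else 0)) powi (n::int) = (x::complex) powi (if c then n else 0)"
  by simp

text \<open>Off the line all factors are nonzero, so integer powers obey the exponent laws; on it,
  negative powers would take the default value 0. The nonvanishing of the theta functions is
  recorded because there \<open>f\<close> is known to equal the block.\<close>

lemma theta_block_local:
  assumes "finite {r. \<phi> r \<noteq> 0}" "0 < Im \<tau>0" "z0 = of_real \<alpha> * \<tau>0 + of_real \<beta>"
  obtains U where "unit_at U (\<tau>0, z0)"
    "eventually (\<lambda>p. torsion_line \<alpha> \<beta> p \<noteq> 0 \<longrightarrow>
        (\<forall>r\<ge>1. \<phi> r \<noteq> 0 \<longrightarrow> theta_r r (fst p) (snd p) \<noteq> 0) \<and>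
        theta_block \<phi> (fst p) (snd p) = torsion_line \<alpha> \<beta> p powi vanishing_order \<phi> \<alpha> \<beta> * U p) (nhds (\<tau>0, z0))"
proof -
  define S where "S = {r. 1 \<le> r \<and> \<phi> r \<noteq> 0}"
  have S: "finite S" using assms(1) by (auto simp: S_def)
  obtain V where V: "\<And>s. s \<ge> 1 \<Longrightarrow> unit_at (V s) (\<tau>0, z0)"
    "\<And>s. s \<ge> 1 \<Longrightarrow> eventually (\<lambda>p. theta_r s (fst p) (snd p) =
       torsion_line \<alpha> \<beta> p powi (if annihilates \<alpha> \<beta> s then 1 else 0) * V s p) (nhds (\<tau>0, z0))"
    using theta_r_local'[OF assms(2,3)] by blast
  define U where "U = (\<lambda>p. eta (fst p) powi \<phi> 0 * (\<Prod>s\<in>S. (V s p / eta (fst p)) powi \<phi> s))"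
  have "unit_at U (\<tau>0, z0)" unfolding U_def
    by (intro unit_at_mult unit_at_powi unit_at_prod unit_at_divide unit_at_eta V)
       (use assms in \<open>auto simp: S_def\<close>)
  moreover have "eventually (\<lambda>p. \<forall>s\<in>S. V s p \<noteq> 0 \<and> theta_r s (fst p) (snd p) =
       torsion_line \<alpha> \<beta> p powi (if annihilates \<alpha> \<beta> s then 1 else 0) * V s p) (nhds (\<tau>0, z0))"
    using S by (intro eventually_ball_finite ballI eventually_conj V unit_at_nonzero) (auto simp: S_def)
  hence "eventually (\<lambda>p. torsion_line \<alpha> \<beta> p \<noteq> 0 \<longrightarrow>
        (\<forall>r\<ge>1. \<phi> r \<noteq> 0 \<longrightarrow> theta_r r (fst p) (snd p) \<noteq> 0) \<and>
        theta_block \<phi> (fst p) (snd p) = torsion_line \<alpha> \<beta> p powi vanishing_order \<phi> \<alpha> \<beta> * U p) (nhds (\<tau>0, z0))"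
  proof eventually_elim
    case (elim p)
    show ?case
    proof (intro impI conjI allI)
      assume nz: "torsion_line \<alpha> \<beta> p \<noteq> 0"
      show "theta_r r (fst p) (snd p) \<noteq> 0" if "1 \<le> r" "\<phi> r \<noteq> 0" for r
        using elim nz that by (auto simp: S_def)
      have "theta_block \<phi> (fst p) (snd p) =
         eta (fst p) powi \<phi> 0 * (\<Prod>s\<in>S. torsion_line \<alpha> \<beta> p powi (if annihilates \<alpha> \<beta> s then \<phi> s else 0) *
            (V s p / eta (fst p)) powi \<phi> s)"
        unfolding theta_block_def S_def[symmetric]
      proof (intro arg_cong2[of _ _ _ _ "(*)"] refl prod.cong)
        fix s assume "s \<in> S"
        hence "theta_r s (fst p) (snd p) / eta (fst p) =
           torsion_line \<alpha> \<beta> p powi (if annihilates \<alpha> \<beta> s then 1 else 0) * (V s p / eta (fst p))"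
          using elim by simp
        thus "(theta_r s (fst p) (snd p) / eta (fst p)) powi \<phi> s =
            torsion_line \<alpha> \<beta> p powi (if annihilates \<alpha> \<beta> s then \<phi> s else 0) * (V s p / eta (fst p)) powi \<phi> s"
          by (simp only: power_int_mult_distrib powi_if_mult)
      qed
      also have "\<dots> = torsion_line \<alpha> \<beta> p powi vanishing_order \<phi> \<alpha> \<beta> * U p"
        unfolding vanishing_order_def U_def S_def[symmetric] powi_sum[OF nz]
        by (simp add: prod.distrib)
      finally show "theta_block \<phi> (fst p) (snd p) = torsion_line \<alpha> \<beta> p powi vanishing_order \<phi> \<alpha> \<beta> * U p" .
    qed
  qed
  ultimately show ?thesis using that by blast
qed

text \<open>The same computation with the units grouped by atoms. Only divisors of indices in the
  support occur, hence finitely many theta functions.\<close>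

lemma atom_product_local:
  assumes "finite {r. \<nu> r \<noteq> 0}" "0 < Im \<tau>0" "z0 = of_real \<alpha> * \<tau>0 + of_real \<beta>"
  obtains U where "unit_at U (\<tau>0, z0)"
    "eventually (\<lambda>p. torsion_line \<alpha> \<beta> p \<noteq> 0 \<longrightarrow>
        (\<forall>r\<ge>1. \<nu> r \<noteq> 0 \<longrightarrow> (\<forall>s. s dvd r \<longrightarrow> theta_r s (fst p) (snd p) \<noteq> 0)) \<and>
        atom_product \<nu> (fst p) (snd p) = torsion_line \<alpha> \<beta> p powi
          (\<Sum>r | 1 \<le> r \<and> \<nu> r \<noteq> 0. \<nu> r * (\<Sum>s | s dvd r. if annihilates \<alpha> \<beta> s then moebius (r div s) else 0)) * U p)
      (nhds (\<tau>0, z0))"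
proof -
  define S where "S = {r. 1 \<le> r \<and> \<nu> r \<noteq> 0}"
  have S: "finite S" using assms(1) by (auto simp: S_def)
  define D where "D = (\<Union>r\<in>S. {s. s dvd r})"
  have D: "finite D" unfolding D_def using S by (intro finite_UN_I) (auto simp: S_def)
  have D1: "s \<ge> 1" if "s \<in> D" for s
    using that by (auto simp: D_def S_def Suc_le_eq intro!: Nat.gr0I)
  obtain V where V: "\<And>s. s \<ge> 1 \<Longrightarrow> unit_at (V s) (\<tau>0, z0)"
    "\<And>s. s \<ge> 1 \<Longrightarrow> eventually (\<lambda>p. theta_r s (fst p) (snd p) =
       torsion_line \<alpha> \<beta> p powi (if annihilates \<alpha> \<beta> s then 1 else 0) * V s p) (nhds (\<tau>0, z0))"
    using theta_r_local'[OF assms(2,3)] by blast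
  define W where "W = (\<lambda>r p. \<Prod>s | s dvd r. V s p powi moebius (r div s))"
  define U where "U = (\<lambda>p. eta (fst p) powi (\<nu> 0 - \<nu> 1) * (\<Prod>r\<in>S. W r p powi \<nu> r))"
  have "unit_at U (\<tau>0, z0)" unfolding U_def W_def
    by (intro unit_at_mult unit_at_powi unit_at_prod unit_at_divide unit_at_eta V)
       (use assms D1 in \<open>auto simp: D_def\<close>)
  moreover have "eventually (\<lambda>p. \<forall>s\<in>D. V s p \<noteq> 0 \<and> theta_r s (fst p) (snd p) =
       torsion_line \<alpha> \<beta> p powi (if annihilates \<alpha> \<beta> s then 1 else 0) * V s p) (nhds (\<tau>0, z0))"
    using D D1 by (intro eventually_ball_finite ballI eventually_conj V unit_at_nonzero) auto
  hence "eventually (\<lambda>p. torsion_line \<alpha> \<beta> p \<noteq> 0 \<longrightarrow>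
        (\<forall>r\<ge>1. \<nu> r \<noteq> 0 \<longrightarrow> (\<forall>s. s dvd r \<longrightarrow> theta_r s (fst p) (snd p) \<noteq> 0)) \<and>
        atom_product \<nu> (fst p) (snd p) = torsion_line \<alpha> \<beta> p powi
          (\<Sum>r | 1 \<le> r \<and> \<nu> r \<noteq> 0. \<nu> r * (\<Sum>s | s dvd r. if annihilates \<alpha> \<beta> s then moebius (r div s) else 0)) * U p)
      (nhds (\<tau>0, z0))"
  proof eventually_elim
    case (elim p)
    show ?case
    proof (intro impI conjI allI)
      assume nz: "torsion_line \<alpha> \<beta> p \<noteq> 0"
      show "theta_r s (fst p) (snd p) \<noteq> 0" if "1 \<le> r" "\<nu> r \<noteq> 0" "s dvd r" for r s
        using elim nz that by (auto simp: S_def D_def)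
      have atom: "atom r (fst p) (snd p) =
          torsion_line \<alpha> \<beta> p powi (\<Sum>s | s dvd r. if annihilates \<alpha> \<beta> s then moebius (r div s) else 0) * W r p"
        if "r \<in> S" for r
      proof -
        have "atom r (fst p) (snd p) = (\<Prod>s | s dvd r.
           torsion_line \<alpha> \<beta> p powi (if annihilates \<alpha> \<beta> s then moebius (r div s) else 0) * V s p powi moebius (r div s))"
          unfolding atom_def
        proof (rule prod.cong[OF refl])
          fix s assume "s \<in> {s. s dvd r}"
          hence "theta_r s (fst p) (snd p) =
             torsion_line \<alpha> \<beta> p powi (if annihilates \<alpha> \<beta> s then 1 else 0) * V s p"
            using elim that by (auto simp: D_def)
          thus "theta_r s (fst p) (snd p) powi moebius (r div s) =
            torsion_line \<alpha> \<beta> p powi (if annihilates \<alpha> \<beta> s then moebius (r div s) else 0) * V s p powi moebius (r div s)"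
            by (simp only: power_int_mult_distrib powi_if_mult)
        qed
        thus ?thesis unfolding W_def powi_sum[OF nz] by (simp add: prod.distrib)
      qed
      have "atom_product \<nu> (fst p) (snd p) = eta (fst p) powi (\<nu> 0 - \<nu> 1) *
         (\<Prod>r\<in>S. torsion_line \<alpha> \<beta> p powi (\<nu> r * (\<Sum>s | s dvd r. if annihilates \<alpha> \<beta> s then moebius (r div s) else 0)) * W r p powi \<nu> r)"
        unfolding atom_product_def S_def[symmetric]
        by (intro arg_cong2[of _ _ _ _ "(*)"] refl prod.cong)
           (simp add: atom power_int_mult_distrib power_int_mult[symmetric] mult.commute)
      thus "atom_product \<nu> (fst p) (snd p) = torsion_line \<alpha> \<beta> p powi
          (\<Sum>r | 1 \<le> r \<and> \<nu> r \<noteq> 0. \<nu> r * (\<Sum>s | s dvd r. if annihilates \<alpha> \<beta> s then moebius (r div s) else 0)) * U p"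
        unfolding U_def S_def[symmetric] powi_sum[OF nz] by (simp add: prod.distrib)
    qed
  qed
  ultimately show ?thesis using that by blast
qed

section \<open>Moebius inversion at the torsion points 1/t\<close>

lemma annihilates_0_inverse:
  assumes "t \<ge> 1" shows "annihilates 0 (1 / of_nat t) s \<longleftrightarrow> t dvd s"
proof
  assume "annihilates 0 (1 / of_nat t) s"
  then obtain k where "of_nat s * (1 / of_nat t) = (of_int k :: real)"
    by (auto simp: annihilates_def elim!: Ints_cases)
  hence "of_int (int s) = (of_int (k * int t) :: real)" using assms by (simp add: field_simps)
  hence "int s = k * int t" by (simp only: of_int_eq_iff)
  hence "int t dvd int s" by simp
  thus "t dvd s" by (simp only: int_dvd_int_iff)
next
  assume "t dvd s"
  then obtain c where "s = t * c" ..
  thus "annihilates 0 (1 / of_nat t) s" using assms by (simp add: annihilates_def)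
qed

text \<open>The squarefree divisors of n are the products of subsets of its prime factors, so the
  sum is the expansion of the product of (-1 + 1) over these primes.\<close>

lemma sum_moebius_divisors:
  assumes "n \<ge> 1" shows "(\<Sum>d | d dvd n. moebius d) = (if n = 1 then 1 else 0)"
proof -
  define P where "P = prime_factors n"
  have fP: "finite P" and pr: "\<And>p. p \<in> P \<Longrightarrow> prime p"
    by (auto simp: P_def)
  have pf: "prime_factors (\<Prod>T) = T \<and> squarefree (\<Prod>T) \<and> \<Prod>T \<noteq> 0" if "T \<subseteq> P" for T
  proof -
    have fT: "finite T" using that fP finite_subset by blast
    have nz: "\<Prod>T \<noteq> 0" using fT that pr[of 0] by (auto simp: prod_zero_iff)
    have 1: "prime_factors (\<Prod>T) = T"
    proof (rule set_eqI)
      fix p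
      have "p \<in> prime_factors (\<Prod>T) \<longleftrightarrow> prime p \<and> p dvd \<Prod>T"
        using nz by (simp add: prime_factors_dvd)
      also have "\<dots> \<longleftrightarrow> prime p \<and> (\<exists>x\<in>T. p dvd x)"
        using prime_dvd_prod_iff[OF fT, of p "\<lambda>x. x"] by auto
      also have "\<dots> \<longleftrightarrow> p \<in> T"
        using that pr primes_dvd_imp_eq by (metis dvd_refl subsetD)
      finally show "p \<in> prime_factors (\<Prod>T) \<longleftrightarrow> p \<in> T" .
    qed
    have "squarefree (prod id T)"
    proof (rule squarefree_prod_coprime)
      show "coprime (id a) (id b)" if "a \<in> T" "b \<in> T" "a \<noteq> b" for a b
      proof -
        have "prime a" "prime b" using that pr \<open>T \<subseteq> P\<close> by auto
        thus ?thesis using that primes_coprime[of a b] by simp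
      qed
      show "squarefree (id a)" if "a \<in> T" for a
      proof -
        have "prime a" using that pr \<open>T \<subseteq> P\<close> by auto
        thus ?thesis using squarefree_prime[of a] by simp
      qed
    qed
    thus ?thesis using 1 nz by simp
  qed
  have dvd: "\<Prod>T dvd n" if "T \<subseteq> P" for T
  proof -
    have "\<Prod>T dvd \<Prod>P" using that fP by (intro prod_dvd_prod_subset)
    also have "\<Prod>P dvd n" unfolding P_def
    proof -
      have "(\<Prod>p\<in>prime_factors n. p) dvd (\<Prod>p\<in>prime_factors n. p ^ multiplicity p n)"
        by (intro prod_dvd_prod dvd_power) (auto simp: prime_factors_multiplicity)
      also have "\<dots> = n" using prime_factorization_nat[of n] assms by simp
      finally show "\<Prod>(prime_factors n) dvd n" by simp
    qed
    finally show ?thesis .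
  qed
  have bij: "bij_betw (\<lambda>T. \<Prod>T) (Pow P) {d. d dvd n \<and> squarefree d}"
  proof (rule bij_betw_byWitness[where f' = prime_factors])
    show "\<forall>T\<in>Pow P. prime_factors (\<Prod>T) = T" using pf by auto
    show "\<forall>d\<in>{d. d dvd n \<and> squarefree d}. \<Prod>(prime_factors d) = d"
    proof clarify
      fix d assume d: "d dvd n" "squarefree d"
      hence "d > 0" using assms by (auto intro!: Nat.gr0I)
      hence "d = (\<Prod>p\<in>prime_factors d. p ^ multiplicity p d)" by (rule prime_factorization_nat)
      also have "\<dots> = (\<Prod>p\<in>prime_factors d. p)"
      proof (rule prod.cong[OF refl])
        fix p assume p: "p \<in> prime_factors d"
        have "multiplicity p d = 1"
          using p d squarefree_factorial_semiring'[of d] \<open>d > 0\<close>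
          by (auto simp: prime_factors_multiplicity)
        thus "p ^ multiplicity p d = p" by simp
      qed
      finally show "\<Prod>(prime_factors d) = d" by simp
    qed
    show "(\<lambda>T. \<Prod>T) ` Pow P \<subseteq> {d. d dvd n \<and> squarefree d}" using pf dvd by auto
    show "prime_factors ` {d. d dvd n \<and> squarefree d} \<subseteq> Pow P"
      unfolding P_def using assms by (auto simp: dvd_prime_factors dest: dvd_prime_factors[rotated])
  qed
  have "(\<Sum>d | d dvd n. moebius d) = (\<Sum>d | d dvd n \<and> squarefree d. moebius d)"
    by (rule sum.mono_neutral_right) (use assms in \<open>auto simp: moebius_def\<close>)
  also have "\<dots> = (\<Sum>T\<in>Pow P. moebius (\<Prod>T))"
    by (rule sum.reindex_bij_betw[OF bij, symmetric])
  also have "\<dots> = (\<Sum>T\<in>Pow P. (\<Prod>p\<in>T. -1) * (\<Prod>p\<in>P - T. 1))"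
    using pf by (intro sum.cong) (auto simp: moebius_def)
  also have "\<dots> = (\<Prod>p\<in>P. -1 + 1)"
    by (rule prod_add[OF fP, symmetric])
  also have "\<dots> = (if n = 1 then 1 else 0)"
  proof (cases "n = 1")
    case False
    then obtain p where "prime p" "p dvd n" using prime_factor_nat by blast
    hence "p \<in> P" using assms by (simp add: P_def prime_factors_dvd)
    thus ?thesis using fP False card_gt_0_iff[of P] by auto
  qed (simp add: P_def)
  finally show ?thesis .
qed

text \<open>With r = t c, the substitution d = r / s turns the sum into that of the Moebius function
  over the divisors of c. In terms of theta functions: at z = 1/t the r-th atom has order one if r =
  t and order zero otherwise.\<close>

lemma sum_moebius_multiples:
  assumes "r \<ge> 1" "t \<ge> 1"
  shows "(\<Sum>s | s dvd r. if t dvd s then moebius (r div s) else 0) = (if r = t then 1 else 0)"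
proof -
  have "(\<Sum>s | s dvd r. if t dvd s then moebius (r div s) else 0) = (\<Sum>s | s dvd r \<and> t dvd s. moebius (r div s))"
    using assms by (subst sum.inter_filter[symmetric]) (auto intro: sum.cong)
  also have "\<dots> = (if r = t then 1 else 0)"
  proof (cases "t dvd r")
    case False
    hence "{s. s dvd r \<and> t dvd s} = {}" by (auto intro: dvd_trans)
    thus ?thesis using False by (auto simp del: Collect_empty_eq)
  next
    case True
    then obtain c where c: "r = t * c" ..
    hence c1: "c \<ge> 1" using assms by (auto simp: Suc_le_eq intro!: Nat.gr0I)
    have "(\<Sum>s | s dvd r \<and> t dvd s. moebius (r div s)) = (\<Sum>d | d dvd c. moebius d)"
    proof (rule sum.reindex_bij_witness[where i = "\<lambda>d. t * (c div d)" and j = "\<lambda>s. r div s"])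
      fix s assume "s \<in> {s. s dvd r \<and> t dvd s}"
      hence "t dvd s" "s dvd r" by auto
      then obtain u e where s: "s = t * u" "r = s * e" by (metis dvdE)
      hence ce: "c = u * e" using c assms by auto
      have pos: "u > 0" "e > 0" "t > 0" using ce c1 assms by auto
      show "t * (c div (r div s)) = s" "r div s \<in> {d. d dvd c}" "moebius (r div s) = moebius (r div s)"
        using s ce pos by auto
    next
      fix d assume "d \<in> {d. d dvd c}"
      then obtain e where e: "c = d * e" by auto
      have pos: "d > 0" "e > 0" "t > 0" using e c1 assms by auto
      show "r div (t * (c div d)) = d" "t * (c div d) \<in> {s. s dvd r \<and> t dvd s}"
        using c e pos by auto
    qed
    also have "\<dots> = (if c = 1 then 1 else 0)" by (rule sum_moebius_divisors[OF c1])
    finally show ?thesis using c assms by auto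
  qed
  finally show ?thesis .
qed

text \<open>The exponent \<open>\<nu>(t) = \<Sum> \<phi>(t r)\<close> of the \<open>t\<close>-th atom.\<close>

definition zero_mult :: "(nat \<Rightarrow> int) \<Rightarrow> nat \<Rightarrow> int" where
  "zero_mult \<phi> t = (\<Sum>r | 1 \<le> r \<and> \<phi> r \<noteq> 0. if t dvd r then \<phi> r else 0)"

lemma vanishing_order_inverse:
  "t \<ge> 1 \<Longrightarrow> vanishing_order \<phi> 0 (1 / of_nat t) = zero_mult \<phi> t"
  by (simp add: vanishing_order_def zero_mult_def annihilates_0_inverse)

locale holomorphic_theta_block =
  fixes k :: int and m :: nat and \<phi> :: "nat \<Rightarrow> int" and f :: "complex \<Rightarrow> complex \<Rightarrow> complex"
  assumes basic: "basic_theta_block k m f \<phi>"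
begin

lemma fin: "finite {r. \<phi> r \<noteq> 0}"
  and block: "0 < Im \<tau> \<Longrightarrow> (\<And>r. r \<ge> 1 \<Longrightarrow> \<phi> r < 0 \<Longrightarrow> theta_r r \<tau> z \<noteq> 0) \<Longrightarrow> f \<tau> z = theta_block \<phi> \<tau> z"
  and f_Jwh: "f \<in> Jwh k m"
  using basic by (auto simp: basic_theta_block_def is_theta_block_def)

lemma hol_at_f: "0 < Im \<tau> \<Longrightarrow> hol_at (\<lambda>p. f (fst p) (snd p)) (\<tau>, z)"
proof -
  assume \<tau>: "0 < Im \<tau>"
  have "eventually (\<lambda>p. 0 < Im (fst p)) (nhds (\<tau>, z))"
    by (rule eventually_Im_pos) (use \<tau> in auto)
  moreover have "holomorphic_HC f" using f_Jwh by (simp add: Jwh_def)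
  ultimately have "eventually (cdiff2 (\<lambda>p. f (fst p) (snd p))) (nhds (\<tau>, z))"
    by (auto simp: holomorphic_HC_def cdiff2_def elim!: eventually_mono)
  thus ?thesis by (simp add: hol_at_def)
qed

text \<open>Off the line the local form of the block applies. Comparing it with the continuous
  function \<open>f\<close>, taken with exponent 0, forces a nonnegative order; with a natural
  exponent both sides are holomorphic and agree on the line too.\<close>

lemma f_local:
  assumes "0 < Im \<tau>0" "z0 = of_real \<alpha> * \<tau>0 + of_real \<beta>"
  obtains U where "unit_at U (\<tau>0, z0)" "0 \<le> vanishing_order \<phi> \<alpha> \<beta>"
    "eventually (\<lambda>p. f (fst p) (snd p) = torsion_line \<alpha> \<beta> p ^ nat (vanishing_order \<phi> \<alpha> \<beta>) * U p) (nhds (\<tau>0, z0))"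
proof -
  obtain U where U: "unit_at U (\<tau>0, z0)"
    "eventually (\<lambda>p. torsion_line \<alpha> \<beta> p \<noteq> 0 \<longrightarrow>
        (\<forall>r\<ge>1. \<phi> r \<noteq> 0 \<longrightarrow> theta_r r (fst p) (snd p) \<noteq> 0) \<and>
        theta_block \<phi> (fst p) (snd p) = torsion_line \<alpha> \<beta> p powi vanishing_order \<phi> \<alpha> \<beta> * U p) (nhds (\<tau>0, z0))"
    using theta_block_local[OF fin assms] by blast
  have "eventually (\<lambda>p. 0 < Im (fst p)) (nhds (\<tau>0, z0))"
    by (rule eventually_Im_pos) (use assms in auto)
  with U(2) have ev: "eventually (\<lambda>p. torsion_line \<alpha> \<beta> p \<noteq> 0 \<longrightarrow>
      f (fst p) (snd p) = torsion_line \<alpha> \<beta> p powi vanishing_order \<phi> \<alpha> \<beta> * U p) (nhds (\<tau>0, z0))"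
    by eventually_elim (auto simp: block)
  have tl: "torsion_line \<alpha> \<beta> (\<tau>0, w) = w - z0" for w
    by (simp add: torsion_line_def assms(2))
  have "eventually (\<lambda>z. (z - z0) powi 0 * f \<tau>0 z = (z - z0) powi vanishing_order \<phi> \<alpha> \<beta> * U (\<tau>0, z)) (at z0)"
    using eventually_line[OF ev] eventually_neq_at_within[of z0 z0 UNIV]
    by eventually_elim (simp add: tl)
  hence nn: "0 \<le> vanishing_order \<phi> \<alpha> \<beta>"
  proof (rule order_le)
    show "isCont (f \<tau>0) z0"
      using isCont_line[OF hol_at_isCont[OF hol_at_f[OF assms(1)]]] by simp
    show "isCont (\<lambda>z. U (\<tau>0, z)) z0" "U (\<tau>0, z0) \<noteq> 0"
      using unit_at_line[OF U(1)] by auto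
  qed
  have "eventually (\<lambda>p. f (fst p) (snd p) = torsion_line \<alpha> \<beta> p ^ nat (vanishing_order \<phi> \<alpha> \<beta>) * U p) (nhds (\<tau>0, z0))"
  proof (rule eventually_eq_across_line)
    show "hol_at (\<lambda>p. f (fst p) (snd p)) (\<tau>0, z0)" by (rule hol_at_f[OF assms(1)])
    show "hol_at (\<lambda>p. torsion_line \<alpha> \<beta> p ^ nat (vanishing_order \<phi> \<alpha> \<beta>) * U p) (\<tau>0, z0)"
      using U(1) by (intro hol_at_intros hol_at_torsion_line) (auto simp: unit_at_def)
    show "eventually (\<lambda>p. torsion_line \<alpha> \<beta> p \<noteq> 0 \<longrightarrow> f (fst p) (snd p) =
        torsion_line \<alpha> \<beta> p ^ nat (vanishing_order \<phi> \<alpha> \<beta>) * U p) (nhds (\<tau>0, z0))"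
      using ev nn by (simp add: power_int_def)
  qed
  thus ?thesis using that U(1) nn by blast
qed

text \<open>At z = 1/t every atom but the t-th has order 0, so the atom product has order \<nu>(t),
  while \<open>f\<close> has the order given by the theta exponents. Comparing orders avoids any
  product identity between theta blocks and atoms.\<close>

lemma atom_exponent:
  assumes "atom_decomposition f \<nu>" "t \<ge> 1"
  shows "\<nu> t = zero_mult \<phi> t"
proof -
  define z0 :: complex where "z0 = of_real (1 / of_nat t)"
  have z0: "z0 = of_real 0 * \<i> + of_real (1 / of_nat t)" by (simp add: z0_def)
  have i: "0 < Im \<i>" by simp
  have finv: "finite {r. \<nu> r \<noteq> 0}" using assms(1) by (simp add: atom_decomposition_def)
  obtain U where U: "unit_at U (\<i>, z0)" "0 \<le> vanishing_order \<phi> 0 (1 / of_nat t)"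
    "eventually (\<lambda>p. f (fst p) (snd p) = torsion_line 0 (1 / of_nat t) p ^ nat (vanishing_order \<phi> 0 (1 / of_nat t)) * U p) (nhds (\<i>, z0))"
    using f_local[OF i z0] by blast
  define e where "e = (\<Sum>r | 1 \<le> r \<and> \<nu> r \<noteq> 0. \<nu> r * (\<Sum>s | s dvd r. if annihilates 0 (1 / of_nat t) s then moebius (r div s) else 0))"
  obtain W where W: "unit_at W (\<i>, z0)"
    "eventually (\<lambda>p. torsion_line 0 (1 / of_nat t) p \<noteq> 0 \<longrightarrow>
        (\<forall>r\<ge>1. \<nu> r \<noteq> 0 \<longrightarrow> (\<forall>s. s dvd r \<longrightarrow> theta_r s (fst p) (snd p) \<noteq> 0)) \<and>
        atom_product \<nu> (fst p) (snd p) = torsion_line 0 (1 / of_nat t) p powi e * W p) (nhds (\<i>, z0))"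
    using atom_product_local[OF finv i z0] unfolding e_def by blast
  have "e = (\<Sum>r | 1 \<le> r \<and> \<nu> r \<noteq> 0. \<nu> r * (if r = t then 1 else 0))"
    unfolding e_def annihilates_0_inverse[OF assms(2)]
    by (intro sum.cong refl) (use sum_moebius_multiples assms(2) in auto)
  also have "\<dots> = (\<Sum>r | 1 \<le> r \<and> \<nu> r \<noteq> 0. (if r = t then \<nu> t else 0))"
    by (intro sum.cong) auto
  also have "\<dots> = \<nu> t"
  proof -
    have "finite {r. 1 \<le> r \<and> \<nu> r \<noteq> 0}" by (rule finite_subset[OF _ finv]) auto
    thus ?thesis using assms(2) by (simp add: sum.delta')
  qed
  finally have e: "e = \<nu> t" .
  have tl: "torsion_line 0 (1 / of_nat t) (\<i>, w) = w - z0" for w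
    by (simp add: torsion_line_def z0_def)
  have eq: "eventually (\<lambda>z. (z - z0) powi zero_mult \<phi> t * U (\<i>, z) = (z - z0) powi \<nu> t * W (\<i>, z)) (at z0)"
    using eventually_line[OF U(3)] eventually_line[OF W(2)] eventually_neq_at_within[of z0 z0 UNIV]
  proof eventually_elim
    case (elim z)
    hence "f \<i> z = atom_product \<nu> \<i> z"
      using assms(1) by (auto simp: atom_decomposition_def tl)
    thus ?case using elim U(2)
      by (simp add: tl e vanishing_order_inverse[OF assms(2)] power_int_def)
  qed
  have c: "isCont (\<lambda>z. U (\<i>, z)) z0" "U (\<i>, z0) \<noteq> 0" "isCont (\<lambda>z. W (\<i>, z)) z0" "W (\<i>, z0) \<noteq> 0"
    using unit_at_line[OF U(1)] unit_at_line[OF W(1)] by auto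
  have "zero_mult \<phi> t \<le> \<nu> t" by (rule order_le[OF eq c(1,3,4)])
  moreover have "\<nu> t \<le> zero_mult \<phi> t"
    by (rule order_le[OF _ c(3,1,2)]) (use eq in eventually_elim, simp)
  ultimately show ?thesis by simp
qed

end


section \<open>The quotient by a theta block\<close>

text \<open>Annihilators are closed under remainders, so the least positive one, t, divides all of
  them. It is the exact order of the torsion point.\<close>

lemma annihilates_cases:
  obtains "\<And>s. s \<ge> 1 \<Longrightarrow> \<not> annihilates \<alpha> \<beta> s"
  | t where "t \<ge> 1" "\<And>s. annihilates \<alpha> \<beta> s \<longleftrightarrow> t dvd s"
proof (cases "\<exists>s\<ge>1. annihilates \<alpha> \<beta> s")
  case False
  thus ?thesis using that(1) by blast
next
  case True
  define t where "t = (LEAST s. s \<ge> 1 \<and> annihilates \<alpha> \<beta> s)"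
  have t: "t \<ge> 1" "annihilates \<alpha> \<beta> t"
    using LeastI_ex[OF True] unfolding t_def by auto
  have min: "t \<le> s" if "s \<ge> 1" "annihilates \<alpha> \<beta> s" for s
    unfolding t_def using that by (intro Least_le) auto
  have mod: "annihilates \<alpha> \<beta> (s mod t)" if "annihilates \<alpha> \<beta> s" for s
  proof -
    have "real (s mod t) * x = real s * x - real (s div t) * (real t * x)" for x
    proof -
      have "real s = real (s div t) * real t + real (s mod t)"
        by (metis div_mult_mod_eq of_nat_add of_nat_mult)
      thus ?thesis by (simp add: algebra_simps)
    qed
    thus ?thesis using that t unfolding annihilates_def by (auto intro!: Ints_diff Ints_mult)
  qed
  have "annihilates \<alpha> \<beta> s \<longleftrightarrow> t dvd s" for s
  proof
    assume "annihilates \<alpha> \<beta> s"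
    hence "annihilates \<alpha> \<beta> (s mod t)" by (rule mod)
    moreover have "s mod t < t" using t(1) by (intro mod_less_divisor) simp
    ultimately have "\<not> s mod t \<ge> 1" using min[of "s mod t"] by linarith
    thus "t dvd s" by (simp add: dvd_eq_mod_eq_0)
  next
    assume "t dvd s"
    then obtain c where "s = t * c" ..
    hence e: "real s * x = real c * (real t * x)" for x by simp
    show "annihilates \<alpha> \<beta> s" using t(2) unfolding annihilates_def e by (blast intro: Ints_mult Ints_of_nat)
  qed
  thus ?thesis using that(2) t(1) by blast
qed

text \<open>The exact orders t and t' satisfy t' dvd t and t dvd 2 t', so t is t' or 2 t'; the
  second case is the monotonicity hypothesis. For non-torsion pairs both vanishing orders are
  0.\<close>

lemma vanishing_order_mono:
  assumes mono: "\<And>t. t \<ge> 1 \<Longrightarrow> zero_mult \<phi> (2 * t) \<le> zero_mult \<phi> t"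
    and sub: "\<And>s. annihilates \<alpha> \<beta> s \<Longrightarrow> annihilates \<alpha>' \<beta>' s"
    and dbl: "\<And>s. annihilates \<alpha>' \<beta>' s \<Longrightarrow> annihilates \<alpha> \<beta> (2 * s)"
  shows "vanishing_order \<phi> \<alpha> \<beta> \<le> vanishing_order \<phi> \<alpha>' \<beta>'"
proof (cases rule: annihilates_cases[of \<alpha> \<beta>])
  case 1
  have "\<not> annihilates \<alpha>' \<beta>' s" if "s \<ge> 1" for s
    using dbl[of s] 1[of "2 * s"] that by auto
  hence "vanishing_order \<phi> \<alpha>' \<beta>' = 0"
    unfolding vanishing_order_def by (intro sum.neutral) auto
  moreover have "vanishing_order \<phi> \<alpha> \<beta> = 0"
    unfolding vanishing_order_def using 1 by (intro sum.neutral) auto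
  ultimately show ?thesis by simp
next
  case (2 t)
  have vo: "vanishing_order \<phi> \<alpha> \<beta> = zero_mult \<phi> t"
    by (simp add: vanishing_order_def zero_mult_def 2)
  show ?thesis
  proof (cases rule: annihilates_cases[of \<alpha>' \<beta>'])
    case 1
    thus ?thesis using sub[of t] 2 by auto
  next
    case (2 t')
    have vo': "vanishing_order \<phi> \<alpha>' \<beta>' = zero_mult \<phi> t'"
      by (simp add: vanishing_order_def zero_mult_def 2)
    have "t' dvd t" using sub[of t] 2 \<open>\<And>s. annihilates \<alpha> \<beta> s \<longleftrightarrow> t dvd s\<close> by auto
    then obtain c where c: "t = t' * c" ..
    have "t dvd 2 * t'" using dbl[of t'] 2 \<open>\<And>s. annihilates \<alpha> \<beta> s \<longleftrightarrow> t dvd s\<close> by auto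
    hence "c dvd 2" using 2(1) by (simp add: c mult.commute)
    hence "c = 1 \<or> c = 2" by (metis two_is_prime_nat prime_nat_iff)
    thus ?thesis using mono[OF 2(1)] c vo vo' by (auto simp: mult.commute)
  qed
qed

text \<open>The three pairs are the real coordinates of the arguments of \<open>hecke_V2\<close>: of
  2 z over 2 \<tau>, of z over \<tau>/2, and of z over (\<tau> + 1)/2. Each amounts to a larger
  lattice, which keeps annihilators.\<close>

lemma annihilates_double:
  assumes "annihilates \<alpha> \<beta> s"
  shows "annihilates \<alpha> (2 * \<beta>) s" "annihilates (2 * \<alpha>) \<beta> s" "annihilates (2 * \<alpha>) (\<beta> - \<alpha>) s"
proof -
  obtain a b :: int where "of_nat s * \<alpha> = of_int a" "of_nat s * \<beta> = of_int b"
    using assms by (auto simp: annihilates_def elim!: Ints_cases)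
  hence "of_nat s * (2 * \<alpha>) = of_int (2 * a)" "of_nat s * (2 * \<beta>) = of_int (2 * b)"
    "of_nat s * (\<beta> - \<alpha>) = of_int (b - a)"
    by (simp_all add: algebra_simps)
  thus "annihilates \<alpha> (2 * \<beta>) s" "annihilates (2 * \<alpha>) \<beta> s" "annihilates (2 * \<alpha>) (\<beta> - \<alpha>) s"
    using assms unfolding annihilates_def by (metis Ints_of_int)+
qed

text \<open>The lattices have index two, so doubling an annihilator for the larger lattice gives one
  for the original lattice.\<close>

lemma annihilates_half:
  shows "annihilates \<alpha> (2 * \<beta>) s \<Longrightarrow> annihilates \<alpha> \<beta> (2 * s)"
    and "annihilates (2 * \<alpha>) \<beta> s \<Longrightarrow> annihilates \<alpha> \<beta> (2 * s)"
    and "annihilates (2 * \<alpha>) (\<beta> - \<alpha>) s \<Longrightarrow> annihilates \<alpha> \<beta> (2 * s)"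
proof -
  have dbl: "of_nat (2 * s) * x = 2 * (of_nat s * x)" "of_nat (2 * s) * x = of_nat s * (2 * x)" for x :: real
    by simp_all
  have i2: "2 * y \<in> \<int>" if "y \<in> \<int>" for y :: real using that by (intro Ints_mult) auto
  show "annihilates \<alpha> (2 * \<beta>) s \<Longrightarrow> annihilates \<alpha> \<beta> (2 * s)"
    "annihilates (2 * \<alpha>) \<beta> s \<Longrightarrow> annihilates \<alpha> \<beta> (2 * s)"
    unfolding annihilates_def using dbl i2 by metis+
  assume "annihilates (2 * \<alpha>) (\<beta> - \<alpha>) s"
  moreover have "of_nat (2 * s) * \<beta> = 2 * (of_nat s * (\<beta> - \<alpha>)) + of_nat s * (2 * \<alpha>)"
    by (simp add: algebra_simps)
  ultimately show "annihilates \<alpha> \<beta> (2 * s)"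
    unfolding annihilates_def using dbl(2)[of \<alpha>] i2 by (metis Ints_add)
qed

lemma eventually_unit_line:
  assumes "\<And>w. torsion_line \<alpha> \<beta> (\<tau>, w) = w - z0"
  shows "eventually (\<lambda>w. torsion_line \<alpha> \<beta> (\<tau>, w) \<noteq> 0) (at z)"
proof -
  have "eventually (\<lambda>w. w \<noteq> z0) (at z)" by (cases "z = z0") (auto simp: eventually_neq_at_within)
  thus ?thesis by eventually_elim (simp add: assms)
qed

lemma tl_line: "torsion_line \<alpha> \<beta> (\<tau>, w) = w - (of_real \<alpha> * \<tau> + of_real \<beta>)"
  by (simp add: torsion_line_def)

lemma real_coordinates:
  assumes "0 < Im \<tau>"
  obtains \<alpha> \<beta> where "z = of_real \<alpha> * \<tau> + of_real \<beta>"
proof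
  show "z = of_real (Im z / Im \<tau>) * \<tau> + of_real (Re z - Im z / Im \<tau> * Re \<tau>)"
    using assms by (auto simp: complex_eq_iff)
qed

lemma eventually_compose_pair:
  assumes "eventually P (nhds (G p, H p))" "hol_at G p" "hol_at H p"
  shows "eventually (\<lambda>p. P (G p, H p)) (nhds p)"
proof -
  have "((\<lambda>p. (G p, H p)) \<longlongrightarrow> (G p, H p)) (nhds p)"
    by (intro tendsto_Pair hol_at_tendsto assms)
  with assms(1) show ?thesis by (rule eventually_compose_filterlim)
qed

lemma powi_diff_split:
  assumes "(0::int) \<le> a" "a \<le> b" shows "(x::complex) ^ nat b = x ^ nat a * x ^ nat (b - a)"
  using assms by (simp add: power_add[symmetric] nat_add_distrib[symmetric])

lemma Im_moebius_pos:
  assumes "a * d - b * c = (1::int)" "0 < Im \<tau>"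
  shows "of_int c * \<tau> + of_int d \<noteq> 0"
    "0 < Im ((of_int a * \<tau> + of_int b) / (of_int c * \<tau> + of_int d))"
proof -
  define j where "j = of_int c * \<tau> + of_int d"
  have "j \<noteq> 0"
  proof
    assume "j = 0"
    hence "Im j = 0" "Re j = 0" by auto
    hence "c = 0" "d = 0" using assms(2) by (auto simp: j_def)
    thus False using assms(1) by simp
  qed
  thus "of_int c * \<tau> + of_int d \<noteq> 0" by (simp add: j_def)
  have "Im ((of_int a * \<tau> + of_int b) / j) = Im ((of_int a * \<tau> + of_int b) * cnj j) / (cmod j)\<^sup>2"
    by (subst complex_div_cnj) (simp add: Im_divide_of_real flip: of_real_power)
  also have "Im ((of_int a * \<tau> + of_int b) * cnj j) = of_int (a * d - b * c) * Im \<tau>"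
    by (simp add: j_def algebra_simps)
  finally show "0 < Im ((of_int a * \<tau> + of_int b) / (of_int c * \<tau> + of_int d))"
    using assms \<open>j \<noteq> 0\<close> by (simp add: j_def[symmetric])
qed

lemma eq_by_density:
  fixes u v :: "complex \<Rightarrow> complex"
  assumes "isCont u z" "isCont v z" "eventually (\<lambda>w. u w = v w) (at z)"
  shows "u z = v z"
proof -
  have "(u \<longlongrightarrow> u z) (at z)" "(v \<longlongrightarrow> v z) (at z)"
    using assms(1,2) by (simp_all add: isCont_def)
  thus ?thesis unfolding tendsto_cong[OF assms(3)] by (rule LIM_unique)
qed

section \<open>Orders of the Hecke image and extension of the quotient\<close>

context holomorphic_theta_block
begin

text \<open>Each of the three substitutions pulls the line in its own coordinates back to the
  original line, the first up to a factor 2. All three terms are therefore powers of one function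
  times units.\<close>

lemma hecke_V2_local:
  assumes "0 < Im \<tau>0" "z0 = of_real \<alpha> * \<tau>0 + of_real \<beta>"
  obtains U1 U2 U3 where "unit_at U1 (\<tau>0, z0)" "unit_at U2 (\<tau>0, z0)" "unit_at U3 (\<tau>0, z0)"
    "0 \<le> vanishing_order \<phi> \<alpha> (2 * \<beta>)" "0 \<le> vanishing_order \<phi> (2 * \<alpha>) \<beta>"
    "0 \<le> vanishing_order \<phi> (2 * \<alpha>) (\<beta> - \<alpha>)"
    "eventually (\<lambda>p. hecke_V2 k f (fst p) (snd p) =
        torsion_line \<alpha> \<beta> p ^ nat (vanishing_order \<phi> \<alpha> (2 * \<beta>)) * U1 p +
        torsion_line \<alpha> \<beta> p ^ nat (vanishing_order \<phi> (2 * \<alpha>) \<beta>) * U2 p +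
        torsion_line \<alpha> \<beta> p ^ nat (vanishing_order \<phi> (2 * \<alpha>) (\<beta> - \<alpha>)) * U3 p) (nhds (\<tau>0, z0))"
proof -
  define e1 where "e1 = vanishing_order \<phi> \<alpha> (2 * \<beta>)"
  define e2 where "e2 = vanishing_order \<phi> (2 * \<alpha>) \<beta>"
  define e3 where "e3 = vanishing_order \<phi> (2 * \<alpha>) (\<beta> - \<alpha>)"
  obtain U1 where U1: "unit_at U1 (2 * \<tau>0, 2 * z0)" "0 \<le> e1"
    "eventually (\<lambda>p. f (fst p) (snd p) = torsion_line \<alpha> (2 * \<beta>) p ^ nat e1 * U1 p) (nhds (2 * \<tau>0, 2 * z0))"
    unfolding e1_def by (rule f_local[of "2 * \<tau>0" "2 * z0" \<alpha> "2 * \<beta>"]) (use assms in \<open>auto simp: algebra_simps\<close>)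
  obtain U2 where U2: "unit_at U2 (\<tau>0 / 2, z0)" "0 \<le> e2"
    "eventually (\<lambda>p. f (fst p) (snd p) = torsion_line (2 * \<alpha>) \<beta> p ^ nat e2 * U2 p) (nhds (\<tau>0 / 2, z0))"
    unfolding e2_def by (rule f_local[of "\<tau>0 / 2" z0 "2 * \<alpha>" \<beta>]) (use assms in \<open>auto simp: algebra_simps\<close>)
  obtain U3 where U3: "unit_at U3 (\<tau>0 / 2 + 1 / 2, z0)" "0 \<le> e3"
    "eventually (\<lambda>p. f (fst p) (snd p) = torsion_line (2 * \<alpha>) (\<beta> - \<alpha>) p ^ nat e3 * U3 p) (nhds (\<tau>0 / 2 + 1 / 2, z0))"
    unfolding e3_def by (rule f_local[of "\<tau>0 / 2 + 1 / 2" z0 "2 * \<alpha>" "\<beta> - \<alpha>"]) (use assms in \<open>auto simp: algebra_simps\<close>)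
  have h: "hol_at (\<lambda>p::complex\<times>complex. 2 * fst p) p" "hol_at (\<lambda>p::complex\<times>complex. 2 * snd p) p"
    "hol_at (\<lambda>p::complex\<times>complex. fst p / 2) p" "hol_at (\<lambda>p::complex\<times>complex. fst p / 2 + 1 / 2) p" for p
    by (intro hol_at_intros)+
  \<comment> \<open>The power of 2 with exponent e1 comes from \<open>torsion_line\<close> at the
    doubled arguments.\<close>
  define V1 where "V1 = (\<lambda>p. (2 powi (k - 1) * 2 ^ nat e1) * U1 (2 * fst p, 2 * snd p))"
  define V2 where "V2 = (\<lambda>p. (1/2) * U2 (fst p / 2, snd p))"
  define V3 where "V3 = (\<lambda>p. (1/2) * U3 (fst p / 2 + 1 / 2, snd p))"
  have "unit_at V1 (\<tau>0, z0)" unfolding V1_def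
    by (intro unit_at_mult unit_at_const unit_at_comp h) (use U1 in auto)
  moreover have "unit_at V2 (\<tau>0, z0)" unfolding V2_def
    by (intro unit_at_mult unit_at_const unit_at_comp h hol_at_snd) (use U2 in auto)
  moreover have "unit_at V3 (\<tau>0, z0)" unfolding V3_def
    by (intro unit_at_mult unit_at_const unit_at_comp h hol_at_snd) (use U3 in auto)
  moreover have "eventually (\<lambda>p. hecke_V2 k f (fst p) (snd p) = torsion_line \<alpha> \<beta> p ^ nat e1 * V1 p +
        torsion_line \<alpha> \<beta> p ^ nat e2 * V2 p + torsion_line \<alpha> \<beta> p ^ nat e3 * V3 p) (nhds (\<tau>0, z0))"
  proof -
    have "eventually (\<lambda>p. f (2 * fst p) (2 * snd p) =
        torsion_line \<alpha> (2 * \<beta>) (2 * fst p, 2 * snd p) ^ nat e1 * U1 (2 * fst p, 2 * snd p)) (nhds (\<tau>0, z0))"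
      using eventually_compose_pair[where p = "(\<tau>0, z0)" and G = "\<lambda>p. 2 * fst p" and H = "\<lambda>p. 2 * snd p",
          unfolded fst_conv snd_conv, OF U1(3) h(1) h(2)]
      by simp
    moreover have "eventually (\<lambda>p. f (fst p / 2) (snd p) =
        torsion_line (2 * \<alpha>) \<beta> (fst p / 2, snd p) ^ nat e2 * U2 (fst p / 2, snd p)) (nhds (\<tau>0, z0))"
      using eventually_compose_pair[where p = "(\<tau>0, z0)" and G = "\<lambda>p. fst p / 2" and H = snd,
          unfolded fst_conv snd_conv, OF U2(3) h(3) hol_at_snd]
      by simp
    moreover have "eventually (\<lambda>p. f (fst p / 2 + 1 / 2) (snd p) =
        torsion_line (2 * \<alpha>) (\<beta> - \<alpha>) (fst p / 2 + 1 / 2, snd p) ^ nat e3 * U3 (fst p / 2 + 1 / 2, snd p)) (nhds (\<tau>0, z0))"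
      using eventually_compose_pair[where p = "(\<tau>0, z0)" and G = "\<lambda>p. fst p / 2 + 1 / 2" and H = snd,
          unfolded fst_conv snd_conv, OF U3(3) h(4) hol_at_snd]
      by simp
    ultimately show ?thesis
    proof eventually_elim
      case (elim p)
      have tl: "torsion_line \<alpha> (2 * \<beta>) (2 * fst p, 2 * snd p) = 2 * torsion_line \<alpha> \<beta> p"
        "torsion_line (2 * \<alpha>) \<beta> (fst p / 2, snd p) = torsion_line \<alpha> \<beta> p"
        "torsion_line (2 * \<alpha>) (\<beta> - \<alpha>) (fst p / 2 + 1 / 2, snd p) = torsion_line \<alpha> \<beta> p"
        by (simp_all add: torsion_line_def algebra_simps)
      show ?case unfolding hecke_V2_def elim tl V1_def V2_def V3_def
        by (simp add: power_mult_distrib algebra_simps)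
    qed
  qed
  ultimately show ?thesis using that U1(2) U2(2) U3(2) unfolding e1_def e2_def e3_def by blast
qed

text \<open>In every slice the zeros of \<open>f\<close> are isolated, so identities proved where
  \<open>f\<close> is nonzero extend by continuity.\<close>

lemma f_nonzero_near:
  assumes "0 < Im \<tau>" shows "eventually (\<lambda>w. f \<tau> w \<noteq> 0) (at z)"
proof -
  obtain \<alpha> \<beta> where z: "z = of_real \<alpha> * \<tau> + of_real \<beta>" using real_coordinates[OF assms] by blast
  obtain U where U: "unit_at U (\<tau>, z)"
    "eventually (\<lambda>p. f (fst p) (snd p) = torsion_line \<alpha> \<beta> p ^ nat (vanishing_order \<phi> \<alpha> \<beta>) * U p) (nhds (\<tau>, z))"
    using f_local[OF assms z] by blast
  show ?thesis
    using eventually_line[OF U(2)] eventually_line[OF unit_at_nonzero[OF U(1)]]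
      eventually_unit_line[OF tl_line, of \<alpha> \<beta> \<tau> z]
    by eventually_elim auto
qed

text \<open>At z = 1/(2r) the second and third terms have the same order
  \<open>zero_mult \<phi> (2 * r)\<close> as \<open>f\<close>, the first has order
  \<open>zero_mult \<phi> r\<close>. Were the latter smaller, nothing could cancel this term, and
  the quotient would have a pole.\<close>

lemma quotient_imp_zero_mult_mono:
  assumes g: "g \<in> Jwh 0 m" and ext: "extends_quotient g (hecke_V2 k f) f" and r: "r \<ge> 1"
  shows "zero_mult \<phi> (2 * r) \<le> zero_mult \<phi> r"
proof (rule ccontr)
  assume "\<not> ?thesis"
  hence lt: "zero_mult \<phi> r < zero_mult \<phi> (2 * r)" by simp
  define \<beta> where "\<beta> = (1 / of_nat (2 * r) :: real)"
  define z0 :: complex where "z0 = of_real \<beta>"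
  have z0: "z0 = of_real 0 * \<i> + of_real \<beta>" by (simp add: z0_def)
  have i: "0 < Im \<i>" by simp
  have r2: "2 * r \<ge> 1" using r by simp
  have \<beta>2: "2 * \<beta> = 1 / of_nat r" by (simp add: \<beta>_def)
  have vo: "vanishing_order \<phi> 0 \<beta> = zero_mult \<phi> (2 * r)" "vanishing_order \<phi> 0 (2 * \<beta>) = zero_mult \<phi> r"
    using vanishing_order_inverse[OF r2] vanishing_order_inverse[OF r] unfolding \<beta>2 by (simp_all add: \<beta>_def)
  obtain U where U: "unit_at U (\<i>, z0)" "0 \<le> vanishing_order \<phi> 0 \<beta>"
    "eventually (\<lambda>p. f (fst p) (snd p) = torsion_line 0 \<beta> p ^ nat (vanishing_order \<phi> 0 \<beta>) * U p) (nhds (\<i>, z0))"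
    using f_local[OF i z0] by blast
  obtain U1 U2 U3 where V: "unit_at U1 (\<i>, z0)" "unit_at U2 (\<i>, z0)" "unit_at U3 (\<i>, z0)"
    "0 \<le> vanishing_order \<phi> 0 (2 * \<beta>)"
    "eventually (\<lambda>p. hecke_V2 k f (fst p) (snd p) =
        torsion_line 0 \<beta> p ^ nat (vanishing_order \<phi> 0 (2 * \<beta>)) * U1 p +
        torsion_line 0 \<beta> p ^ nat (vanishing_order \<phi> (2 * 0) \<beta>) * U2 p +
        torsion_line 0 \<beta> p ^ nat (vanishing_order \<phi> (2 * 0) (\<beta> - 0)) * U3 p) (nhds (\<i>, z0))"
    using hecke_V2_local[OF i z0] by blast
  define n where "n = nat (zero_mult \<phi> (2 * r) - zero_mult \<phi> r)"
  have n: "n > 0" using lt by (simp add: n_def)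
  \<comment> \<open>The Hecke image divided by the lower power of z - z0; at z0 only the first unit
    survives since n > 0.\<close>
  define W where "W = (\<lambda>z. U1 (\<i>, z) + (z - z0) ^ n * (U2 (\<i>, z) + U3 (\<i>, z)))"
  note c = unit_at_line[OF U(1)] unit_at_line[OF V(1)] unit_at_line[OF V(2)] unit_at_line[OF V(3)]
  have tl: "torsion_line 0 \<beta> (\<i>, w) = w - z0" for w by (simp add: tl_line z0_def)
  have "eventually (\<lambda>z. (z - z0) powi zero_mult \<phi> (2 * r) * (g \<i> z * U (\<i>, z)) =
      (z - z0) powi zero_mult \<phi> r * W z) (at z0)"
    using eventually_line[OF U(3)[unfolded vo]]
      eventually_line[OF V(5)[unfolded mult_zero_right diff_zero vo]] f_nonzero_near[OF i]
  proof eventually_elim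
    case (elim z)
    have "g \<i> z * f \<i> z = hecke_V2 k f \<i> z"
      using ext elim(3) by (simp add: extends_quotient_def)
    moreover have "(z - z0) ^ nat (zero_mult \<phi> (2 * r)) = (z - z0) ^ nat (zero_mult \<phi> r) * (z - z0) ^ n"
      unfolding n_def using V(4) lt vo by (intro powi_diff_split) auto
    ultimately show ?case
      using elim(1,2) U(2)[unfolded vo] V(4)[unfolded vo] by (simp add: tl power_int_def W_def algebra_simps)
  qed
  hence "zero_mult \<phi> (2 * r) \<le> zero_mult \<phi> r"
  proof (rule order_le)
    have "isCont (\<lambda>p. g (fst p) (snd p)) (\<i>, z0)"
      using g i unfolding Jwh_def holomorphic_HC_def by (auto intro!: cdiff2_isCont simp: cdiff2_def)
    hence "isCont (g \<i>) z0" using isCont_line by fastforce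
    thus "isCont (\<lambda>z. g \<i> z * U (\<i>, z)) z0" using c by (intro continuous_intros)
    show "isCont W z0" unfolding W_def by (intro continuous_intros c)
    show "W z0 \<noteq> 0" using c n by (simp add: W_def zero_power)
  qed
  thus False using lt by simp
qed

lemma quotient_extension:
  assumes mono: "\<And>t. t \<ge> 1 \<Longrightarrow> zero_mult \<phi> (2 * t) \<le> zero_mult \<phi> t"
  obtains g where "\<And>\<tau> z. 0 < Im \<tau> \<Longrightarrow> hol_at (\<lambda>p. g (fst p) (snd p)) (\<tau>, z)"
    "\<And>\<tau> z. 0 < Im \<tau> \<Longrightarrow> f \<tau> z \<noteq> 0 \<Longrightarrow> g \<tau> z = hecke_V2 k f \<tau> z / f \<tau> z"
proof -
  \<comment> \<open>A limit in z alone defines g everywhere without gluing local quotients; the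
    local functions h below show that it exists and is holomorphic.\<close>
  define g where "g = (\<lambda>\<tau> z. Lim (at z) (\<lambda>w. hecke_V2 k f \<tau> w / f \<tau> w))"
  have loc: "\<exists>h. hol_at h (\<tau>0, z0) \<and> eventually (\<lambda>p. g (fst p) (snd p) = h p \<and>
      (f (fst p) (snd p) \<noteq> 0 \<longrightarrow> h p = hecke_V2 k f (fst p) (snd p) / f (fst p) (snd p))) (nhds (\<tau>0, z0))"
    if \<tau>0: "0 < Im \<tau>0" for \<tau>0 z0
  proof -
    obtain \<alpha> \<beta> where z0: "z0 = of_real \<alpha> * \<tau>0 + of_real \<beta>" using real_coordinates[OF \<tau>0] by blast
    define e where "e = vanishing_order \<phi> \<alpha> \<beta>"
    define e1 where "e1 = vanishing_order \<phi> \<alpha> (2 * \<beta>)"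
    define e2 where "e2 = vanishing_order \<phi> (2 * \<alpha>) \<beta>"
    define e3 where "e3 = vanishing_order \<phi> (2 * \<alpha>) (\<beta> - \<alpha>)"
    have le: "e \<le> e1" "e \<le> e2" "e \<le> e3"
      unfolding e_def e1_def e2_def e3_def
      by (rule vanishing_order_mono[OF mono annihilates_double(1) annihilates_half(1)],
          simp, assumption, assumption,
          rule vanishing_order_mono[OF mono annihilates_double(2) annihilates_half(2)],
          simp, assumption, assumption,
          rule vanishing_order_mono[OF mono annihilates_double(3) annihilates_half(3)],
          simp, assumption, assumption)
    obtain U where U: "unit_at U (\<tau>0, z0)" "0 \<le> e"
      "eventually (\<lambda>p. f (fst p) (snd p) = torsion_line \<alpha> \<beta> p ^ nat e * U p) (nhds (\<tau>0, z0))"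
      using f_local[OF \<tau>0 z0] unfolding e_def by blast
    obtain U1 U2 U3 where V: "unit_at U1 (\<tau>0, z0)" "unit_at U2 (\<tau>0, z0)" "unit_at U3 (\<tau>0, z0)"
      "eventually (\<lambda>p. hecke_V2 k f (fst p) (snd p) = torsion_line \<alpha> \<beta> p ^ nat e1 * U1 p +
        torsion_line \<alpha> \<beta> p ^ nat e2 * U2 p + torsion_line \<alpha> \<beta> p ^ nat e3 * U3 p) (nhds (\<tau>0, z0))"
      using hecke_V2_local[OF \<tau>0 z0] unfolding e1_def e2_def e3_def by blast
    define h where "h = (\<lambda>p. torsion_line \<alpha> \<beta> p ^ nat (e1 - e) * (U1 p / U p) +
      torsion_line \<alpha> \<beta> p ^ nat (e2 - e) * (U2 p / U p) + torsion_line \<alpha> \<beta> p ^ nat (e3 - e) * (U3 p / U p))"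
    have u: "hol_at (\<lambda>p. U1 p / U p) (\<tau>0, z0)" "hol_at (\<lambda>p. U2 p / U p) (\<tau>0, z0)" "hol_at (\<lambda>p. U3 p / U p) (\<tau>0, z0)"
      using unit_at_divide[OF V(1) U(1)] unit_at_divide[OF V(2) U(1)] unit_at_divide[OF V(3) U(1)]
      by (simp_all add: unit_at_def)
    have h: "hol_at h (\<tau>0, z0)"
      unfolding h_def by (intro hol_at_add hol_at_mult hol_at_power hol_at_torsion_line u)
    have ev: "eventually (\<lambda>p. f (fst p) (snd p) = torsion_line \<alpha> \<beta> p ^ nat e * U p \<and> U p \<noteq> 0 \<and>
       hecke_V2 k f (fst p) (snd p) = torsion_line \<alpha> \<beta> p ^ nat e * U p * h p) (nhds (\<tau>0, z0))"
      using U(3) V(4) unit_at_nonzero[OF U(1)]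
    proof eventually_elim
      case (elim p)
      show ?case unfolding elim(2) h_def powi_diff_split[OF U(2) le(1)] powi_diff_split[OF U(2) le(2)]
         powi_diff_split[OF U(2) le(3)]
        using elim(1,3) by (simp add: algebra_simps)
    qed
    \<comment> \<open>The factorisation is needed on a neighbourhood of each nearby p, because the
      limit defining g at p looks at points around p.\<close>
    have "eventually (\<lambda>p. eventually (\<lambda>p. f (fst p) (snd p) = torsion_line \<alpha> \<beta> p ^ nat e * U p \<and> U p \<noteq> 0 \<and>
       hecke_V2 k f (fst p) (snd p) = torsion_line \<alpha> \<beta> p ^ nat e * U p * h p) (nhds p)) (nhds (\<tau>0, z0))"
      using ev by (simp add: eventually_eventually)
    with h[unfolded hol_at_def] ev have "eventually (\<lambda>p. g (fst p) (snd p) = h p \<and>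
      (f (fst p) (snd p) \<noteq> 0 \<longrightarrow> h p = hecke_V2 k f (fst p) (snd p) / f (fst p) (snd p))) (nhds (\<tau>0, z0))"
    proof eventually_elim
      case (elim p)
      obtain \<tau> z where p: "p = (\<tau>, z)" by force
      have "eventually (\<lambda>w. h (\<tau>, w) = hecke_V2 k f \<tau> w / f \<tau> w) (at z)"
        using eventually_line[OF elim(3)[unfolded p]] eventually_unit_line[OF tl_line, of \<alpha> \<beta> \<tau> z]
        by eventually_elim auto
      moreover have "((\<lambda>w. h (\<tau>, w)) \<longlongrightarrow> h (\<tau>, z)) (at z)"
        using isCont_line[OF cdiff2_isCont[OF elim(1)[unfolded p]]] by (simp add: isCont_def)
      ultimately have "((\<lambda>w. hecke_V2 k f \<tau> w / f \<tau> w) \<longlongrightarrow> h (\<tau>, z)) (at z)"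
        using tendsto_cong by fast
      hence "g \<tau> z = h p" unfolding g_def p by (intro tendsto_Lim) auto
      thus ?case using elim(2) by (auto simp: p)
    qed
    thus ?thesis using h by blast
  qed
  have "hol_at (\<lambda>p. g (fst p) (snd p)) (\<tau>, z)" if im: "0 < Im \<tau>" for \<tau> z
  proof -
    obtain h where h: "hol_at h (\<tau>, z)" "eventually (\<lambda>p. g (fst p) (snd p) = h p \<and>
      (f (fst p) (snd p) \<noteq> 0 \<longrightarrow> h p = hecke_V2 k f (fst p) (snd p) / f (fst p) (snd p))) (nhds (\<tau>, z))"
      using loc[OF im] by blast
    show ?thesis by (rule hol_at_cong_ev[OF _ h(1)]) (use h(2) in eventually_elim, simp)
  qed
  moreover have "g \<tau> z = hecke_V2 k f \<tau> z / f \<tau> z" if im: "0 < Im \<tau>" "f \<tau> z \<noteq> 0" for \<tau> z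
  proof -
    obtain h where h: "eventually (\<lambda>p. g (fst p) (snd p) = h p \<and>
      (f (fst p) (snd p) \<noteq> 0 \<longrightarrow> h p = hecke_V2 k f (fst p) (snd p) / f (fst p) (snd p))) (nhds (\<tau>, z))"
      using loc[OF im(1)] by blast
    show ?thesis using eventually_nhds_x_imp_x[OF h] im by simp
  qed
  ultimately show ?thesis using that by blast
qed

end


section \<open>Transformation laws\<close>

context holomorphic_theta_block
begin

lemma f_modular:
  assumes "A * D - B * C = (1::int)" "0 < Im \<sigma>"
  shows "f ((of_int A * \<sigma> + of_int B) / (of_int C * \<sigma> + of_int D)) (w / (of_int C * \<sigma> + of_int D)) =
    (of_int C * \<sigma> + of_int D) powi k * ee (of_nat m * of_int C * w\<^sup>2 / (of_int C * \<sigma> + of_int D)) * f \<sigma> w"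
  using f_Jwh assms unfolding Jwh_def by blast

text \<open>With denominators cleared, matching a matrix to its arguments amounts to checking linear
  equations.\<close>

lemma f_modular':
  assumes "A * D - B * C = (1::int)" "0 < Im \<sigma>" "of_int C * \<sigma> + of_int D = J" "J \<noteq> 0"
    "\<rho> * J = of_int A * \<sigma> + of_int B" "y * J = w"
  shows "f \<rho> y = J powi k * ee (of_nat m * of_int C * w\<^sup>2 / J) * f \<sigma> w"
proof -
  have "\<rho> = (of_int A * \<sigma> + of_int B) / J" "y = w / J"
    using assms(4-6) by (auto simp: field_simps)
  thus ?thesis using f_modular[OF assms(1,2), of w] by (simp add: assms(3))
qed

lemma f_elliptic:
  assumes "0 < Im \<tau>"
  shows "f \<tau> (z + of_int l * \<tau> + of_int u) =
    ee (- (of_nat m * (of_int l)\<^sup>2 * \<tau>) - 2 * of_nat m * of_int l * z) * f \<tau> z"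
  using f_Jwh assms unfolding Jwh_def by blast

text \<open>The matrix diag(2, 1) times the given one is an element of SL2(Z) times one of three
  representatives of determinant 2; the parities of the bottom row decide which. Writing 2^k as
  \<open>2 * 2 powi (k - 1)\<close> gives the terms the form they have in twice the Hecke
  operator.\<close>

lemma hecke_V2_double:
  fixes z :: complex
  assumes det: "a * d - b * c = (1::int)" and \<tau>: "0 < Im \<tau>" and J: "J = of_int c * \<tau> + of_int d"
    and \<rho>: "\<rho> * J = of_int a * \<tau> + of_int b"
  defines "F \<equiv> J powi k * ee (of_nat (2 * m) * of_int c * z\<^sup>2 / J)"
  shows "2 * 2 powi (k - 1) * f (2 * \<rho>) (2 * (z / J)) =
    (if even c then F * 2 * 2 powi (k - 1) * f (2 * \<tau>) (2 * z)
     else if even d then F * f (\<tau> / 2) z else F * f (\<tau> / 2 + 1 / 2) z)"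
proof -
  have J0: "J \<noteq> 0" using Im_moebius_pos(1)[OF det \<tau>] J by simp
  have p: "2 * 2 powi (k - 1) = (2 powi k :: complex)" by (simp add: power_int_diff)
  have hp: "2 powi k * (J / 2) powi k = J powi k"
    by (simp add: power_int_mult_distrib[symmetric])
  consider (1) c' where "c = 2 * c'" | (2) d' where "odd c" "d = 2 * d'"
    | (3) d' where "odd c" "odd d" "d - c = 2 * d'"
    by (metis dvdE even_diff odd_even_add)
  thus ?thesis
  proof cases
    case 1
    \<comment> \<open>The matrix (a, 2b; c/2, d) acting on 2 \<tau>.\<close>
    have "f (2 * \<rho>) (2 * (z / J)) = J powi k * ee (of_nat m * of_int c' * (2 * z)\<^sup>2 / J) * f (2 * \<tau>) (2 * z)"
    proof (rule f_modular'[of a d "2 * b" c'])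
      show "2 * \<rho> * J = of_int a * (2 * \<tau>) + of_int (2 * b)"
        using \<rho> by (simp add: mult.assoc)
    qed (use det \<tau> J0 in \<open>simp_all add: 1 J\<close>)
    also have "of_nat m * of_int c' * (2 * z)\<^sup>2 / J = of_nat (2 * m) * of_int c * z\<^sup>2 / J"
      by (simp add: 1 power2_eq_square)
    finally have "f (2 * \<rho>) (2 * (z / J)) = F * f (2 * \<tau>) (2 * z)" by (simp only: F_def)
    thus ?thesis using 1 by simp
  next
    case 2
    \<comment> \<open>The matrix (2a, b; c, d/2) acting on \<tau>/2. Its automorphy factor is J/2,
      whose k-th power absorbs 2^k.\<close>
    have "f (2 * \<rho>) (2 * (z / J)) = (J / 2) powi k * ee (of_nat m * of_int c * z\<^sup>2 / (J / 2)) * f (\<tau> / 2) z"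
    proof (rule f_modular'[of "2 * a" d' b c])
      show "2 * \<rho> * (J / 2) = of_int (2 * a) * (\<tau> / 2) + of_int b"
        using \<rho> by simp
      show "of_int c * (\<tau> / 2) + of_int d' = J / 2" by (simp add: 2 J field_simps)
      show "2 * (z / J) * (J / 2) = z" using J0 by simp
    qed (use det \<tau> J0 in \<open>simp_all add: 2 mult_ac\<close>)
    also have "of_nat m * of_int c * z\<^sup>2 / (J / 2) = of_nat (2 * m) * of_int c * z\<^sup>2 / J"
      by simp
    finally have "2 * 2 powi (k - 1) * f (2 * \<rho>) (2 * (z / J)) = F * f (\<tau> / 2) z"
      by (simp only: p F_def hp[symmetric] mult.assoc)
    thus ?thesis using 2 by simp
  next
    case 3
    have d: "d = 2 * d' + c" using 3 by simp
    \<comment> \<open>The matrix (2a, b - a; c, (d - c)/2) acting on (\<tau> + 1)/2.\<close>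
    have "f (2 * \<rho>) (2 * (z / J)) = (J / 2) powi k * ee (of_nat m * of_int c * z\<^sup>2 / (J / 2)) * f (\<tau> / 2 + 1 / 2) z"
    proof (rule f_modular'[of "2 * a" d' "b - a" c])
      show "2 * \<rho> * (J / 2) = of_int (2 * a) * (\<tau> / 2 + 1 / 2) + of_int (b - a)"
        using \<rho> by (simp add: algebra_simps)
      show "of_int c * (\<tau> / 2 + 1 / 2) + of_int d' = J / 2" by (simp add: d J field_simps)
      show "2 * (z / J) * (J / 2) = z" using J0 by simp
    qed (use det \<tau> J0 in \<open>simp_all add: d algebra_simps\<close>)
    also have "of_nat m * of_int c * z\<^sup>2 / (J / 2) = of_nat (2 * m) * of_int c * z\<^sup>2 / J"
      by simp
    finally have "2 * 2 powi (k - 1) * f (2 * \<rho>) (2 * (z / J)) = F * f (\<tau> / 2 + 1 / 2) z"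
      by (simp only: p F_def hp[symmetric] mult.assoc)
    thus ?thesis using 3 by simp
  qed
qed

text \<open>The same with diag(1, 2), where the top row decides. The matrices are (a/2, b; c, 2d) on
  2 \<tau>, (a, b/2; 2c, d) on \<tau>/2 and (a, (b - a)/2; 2c, d - c) on (\<tau> + 1)/2.\<close>

lemma hecke_V2_half:
  fixes z :: complex
  assumes det: "a * d - b * c = (1::int)" and \<tau>: "0 < Im \<tau>" and J: "J = of_int c * \<tau> + of_int d"
    and \<rho>: "\<rho> * J = of_int a * \<tau> + of_int b"
  defines "F \<equiv> J powi k * ee (of_nat (2 * m) * of_int c * z\<^sup>2 / J)"
  shows "f (\<rho> / 2) (z / J) =
    (if even a then F * 2 * 2 powi (k - 1) * f (2 * \<tau>) (2 * z)
     else if even b then F * f (\<tau> / 2) z else F * f (\<tau> / 2 + 1 / 2) z)"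
proof -
  have J0: "J \<noteq> 0" using Im_moebius_pos(1)[OF det \<tau>] J by simp
  have p: "2 * 2 powi (k - 1) = (2 powi k :: complex)" by (simp add: power_int_diff)
  consider (1) a' where "a = 2 * a'" | (2) b' where "odd a" "b = 2 * b'"
    | (3) b' where "odd a" "odd b" "b - a = 2 * b'"
    by (metis dvdE even_diff odd_even_add)
  thus ?thesis
  proof cases
    case 1
    have "f (\<rho> / 2) (z / J) = (2 * J) powi k * ee (of_nat m * of_int c * (2 * z)\<^sup>2 / (2 * J)) * f (2 * \<tau>) (2 * z)"
    proof (rule f_modular'[of a' "2 * d" b c])
      show "\<rho> / 2 * (2 * J) = of_int a' * (2 * \<tau>) + of_int b"
        using \<rho> by (simp add: 1)
      show "of_int c * (2 * \<tau>) + of_int (2 * d) = 2 * J" by (simp add: J)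
      show "z / J * (2 * J) = 2 * z" using J0 by simp
    qed (use det \<tau> J0 in \<open>simp_all add: 1 mult_ac\<close>)
    also have "of_nat m * of_int c * (2 * z)\<^sup>2 / (2 * J) = of_nat (2 * m) * of_int c * z\<^sup>2 / J"
      by (simp add: power2_eq_square)
    also have "(2 * J) powi k * ee (of_nat (2 * m) * of_int c * z\<^sup>2 / J) = F * 2 powi k"
      by (simp only: F_def power_int_mult_distrib mult_ac)
    finally show ?thesis using 1 by (simp add: p mult.assoc)
  next
    case 2
    have "f (\<rho> / 2) (z / J) = J powi k * ee (of_nat m * of_int (2 * c) * z\<^sup>2 / J) * f (\<tau> / 2) z"
    proof (rule f_modular'[of a d b' "2 * c"])
      show "\<rho> / 2 * J = of_int a * (\<tau> / 2) + of_int b'"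
        using \<rho> by (simp add: 2 field_simps)
    qed (use det \<tau> J0 in \<open>simp_all add: 2 J mult_ac\<close>)
    also have "of_nat m * of_int (2 * c) * z\<^sup>2 / J = of_nat (2 * m) * of_int c * z\<^sup>2 / J"
      by simp
    finally have "f (\<rho> / 2) (z / J) = F * f (\<tau> / 2) z" by (simp only: F_def)
    thus ?thesis using 2 by simp
  next
    case 3
    have b: "b = 2 * b' + a" using 3 by simp
    have "f (\<rho> / 2) (z / J) = J powi k * ee (of_nat m * of_int (2 * c) * z\<^sup>2 / J) * f (\<tau> / 2 + 1 / 2) z"
    proof (rule f_modular'[of a "d - c" b' "2 * c"])
      show "\<rho> / 2 * J = of_int a * (\<tau> / 2 + 1 / 2) + of_int b'"
        using \<rho> by (simp add: b field_simps)
      show "of_int (2 * c) * (\<tau> / 2 + 1 / 2) + of_int (d - c) = J" by (simp add: J field_simps)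
      show "z / J * J = z" using J0 by simp
    qed (use det \<tau> J0 in \<open>simp_all add: b algebra_simps\<close>)
    also have "of_nat m * of_int (2 * c) * z\<^sup>2 / J = of_nat (2 * m) * of_int c * z\<^sup>2 / J"
      by simp
    finally have "f (\<rho> / 2) (z / J) = F * f (\<tau> / 2 + 1 / 2) z" by (simp only: F_def)
    thus ?thesis using 3 by simp
  qed
qed

text \<open>The argument (\<rho> + 1)/2 is covered by the preceding lemma for the matrix with top
  row (a + c, b + d), which sends \<tau> to \<rho> + 1. Altogether the three terms are
  permuted.\<close>

lemma hecke_V2_modular:
  assumes det: "a * d - b * c = (1::int)" and \<tau>: "0 < Im \<tau>"
  shows "hecke_V2 k f ((of_int a * \<tau> + of_int b) / (of_int c * \<tau> + of_int d)) (z / (of_int c * \<tau> + of_int d)) =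
    (of_int c * \<tau> + of_int d) powi k *
      ee (of_nat (2 * m) * of_int c * z\<^sup>2 / (of_int c * \<tau> + of_int d)) * hecke_V2 k f \<tau> z"
proof -
  define J where "J = of_int c * \<tau> + of_int d"
  define \<rho> where "\<rho> = (of_int a * \<tau> + of_int b) / J"
  define F where "F = J powi k * ee (of_nat (2 * m) * of_int c * z\<^sup>2 / J)"
  have J0: "J \<noteq> 0" using Im_moebius_pos(1)[OF det \<tau>] by (simp add: J_def)
  have \<rho>: "\<rho> * J = of_int a * \<tau> + of_int b" using J0 by (simp add: \<rho>_def)
  have \<rho>1: "(\<rho> + 1) * J = of_int (a + c) * \<tau> + of_int (b + d)"
    using \<rho> by (simp add: algebra_simps J_def)
  have det1: "(a + c) * d - (b + d) * c = 1" using det by (simp add: algebra_simps)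
  have "even (a * d) \<noteq> even (b * c)"
    using det by (metis even_add even_diff odd_one)
  \<comment> \<open>An odd determinant leaves exactly the parity patterns for which the three images
    are distinct.\<close>
  hence oddness: "(even a \<or> even d) \<noteq> (even b \<or> even c)" by simp
  have h: "\<rho> / 2 + 1 / 2 = (\<rho> + 1) / 2" by (simp add: add_divide_distrib)
  note s = hecke_V2_double[OF det \<tau> J_def \<rho>, of z, folded F_def]
    hecke_V2_half[OF det \<tau> J_def \<rho>, of z, folded F_def] hecke_V2_half[OF det1 \<tau> J_def \<rho>1, of z, folded F_def]
  have "2 * hecke_V2 k f \<rho> (z / J) =
     2 * 2 powi (k - 1) * f (2 * \<rho>) (2 * (z / J)) + f (\<rho> / 2) (z / J) + f ((\<rho> + 1) / 2) (z / J)"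
    unfolding hecke_V2_def h by (simp add: algebra_simps)
  also have "\<dots> = F * (2 * 2 powi (k - 1) * f (2 * \<tau>) (2 * z) + f (\<tau> / 2) z + f (\<tau> / 2 + 1 / 2) z)"
    unfolding s using oddness
    by (cases "even a"; cases "even b"; cases "even c"; cases "even d") (simp_all add: algebra_simps)
  also have "\<dots> = 2 * (F * hecke_V2 k f \<tau> z)"
    unfolding hecke_V2_def by (simp add: algebra_simps)
  finally show ?thesis by (simp add: F_def \<rho>_def J_def)
qed

lemma hecke_V2_elliptic:
  assumes \<tau>: "0 < Im \<tau>"
  shows "hecke_V2 k f \<tau> (z + of_int l * \<tau> + of_int u) =
    ee (- (of_nat (2 * m) * (of_int l)\<^sup>2 * \<tau>) - 2 * of_nat (2 * m) * of_int l * z) * hecke_V2 k f \<tau> z"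
    (is "_ = ?E * _")
proof -
  have "f (2 * \<tau>) (2 * (z + of_int l * \<tau> + of_int u)) = f (2 * \<tau>) (2 * z + of_int l * (2 * \<tau>) + of_int (2 * u))"
    by (simp add: algebra_simps)
  also have "\<dots> = ee (- (of_nat m * (of_int l)\<^sup>2 * (2 * \<tau>)) - 2 * of_nat m * of_int l * (2 * z)) * f (2 * \<tau>) (2 * z)"
    by (rule f_elliptic) (use \<tau> in auto)
  also have "ee (- (of_nat m * (of_int l)\<^sup>2 * (2 * \<tau>)) - 2 * of_nat m * of_int l * (2 * z)) = ?E"
    by (rule arg_cong[of _ _ ee]) (simp add: algebra_simps)
  finally have 1: "f (2 * \<tau>) (2 * (z + of_int l * \<tau> + of_int u)) = ?E * f (2 * \<tau>) (2 * z)" .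
  have "f (\<tau> / 2) (z + of_int l * \<tau> + of_int u) = f (\<tau> / 2) (z + of_int (2 * l) * (\<tau> / 2) + of_int u)"
    by (simp add: algebra_simps)
  also have "\<dots> = ee (- (of_nat m * (of_int (2 * l))\<^sup>2 * (\<tau> / 2)) - 2 * of_nat m * of_int (2 * l) * z) * f (\<tau> / 2) z"
    by (rule f_elliptic) (use \<tau> in auto)
  also have "ee (- (of_nat m * (of_int (2 * l))\<^sup>2 * (\<tau> / 2)) - 2 * of_nat m * of_int (2 * l) * z) = ?E"
    by (rule arg_cong[of _ _ ee]) (simp add: algebra_simps power2_eq_square)
  finally have 2: "f (\<tau> / 2) (z + of_int l * \<tau> + of_int u) = ?E * f (\<tau> / 2) z" .
  have "f (\<tau> / 2 + 1 / 2) (z + of_int l * \<tau> + of_int u) =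
      f (\<tau> / 2 + 1 / 2) (z + of_int (2 * l) * (\<tau> / 2 + 1 / 2) + of_int (u - l))"
    by (simp add: algebra_simps)
  also have "\<dots> = ee (- (of_nat m * (of_int (2 * l))\<^sup>2 * (\<tau> / 2 + 1 / 2)) - 2 * of_nat m * of_int (2 * l) * z) * f (\<tau> / 2 + 1 / 2) z"
    by (rule f_elliptic) (use \<tau> in auto)
  \<comment> \<open>Rewriting l \<tau> as 2 l (\<tau> + 1)/2 - l leaves the extra exponent -2 m l^2,
    an integer, on which \<open>ee\<close> is 1.\<close>
  also have "ee (- (of_nat m * (of_int (2 * l))\<^sup>2 * (\<tau> / 2 + 1 / 2)) - 2 * of_nat m * of_int (2 * l) * z) =
     ee ((- (of_nat (2 * m) * (of_int l)\<^sup>2 * \<tau>) - 2 * of_nat (2 * m) * of_int l * z) + of_int (- (2 * int m * l\<^sup>2)))"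
    by (rule arg_cong[of _ _ ee]) (simp add: algebra_simps power2_eq_square)
  also have "\<dots> = ?E" by (simp only: ee_add[of _ "of_int _"] ee_of_int mult_1_right)
  finally have 3: "f (\<tau> / 2 + 1 / 2) (z + of_int l * \<tau> + of_int u) = ?E * f (\<tau> / 2 + 1 / 2) z" .
  show ?thesis unfolding hecke_V2_def 1 2 3 by (simp add: algebra_simps)
qed

text \<open>Where \<open>f\<close> is nonzero the weight k cancels, and index 2m over index m leaves
  index m; the remaining points follow by density.\<close>

lemma quotient_transforms:
  assumes hol: "\<And>\<tau> z. 0 < Im \<tau> \<Longrightarrow> hol_at (\<lambda>p. g (fst p) (snd p)) (\<tau>, z)"
    and quot: "\<And>\<tau> z. 0 < Im \<tau> \<Longrightarrow> f \<tau> z \<noteq> 0 \<Longrightarrow> g \<tau> z = hecke_V2 k f \<tau> z / f \<tau> z"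
    and \<tau>: "0 < Im \<tau>"
  shows "a * d - b * c = (1::int) \<Longrightarrow>
      g ((of_int a * \<tau> + of_int b) / (of_int c * \<tau> + of_int d)) (z / (of_int c * \<tau> + of_int d)) =
      ee (of_nat m * of_int c * z\<^sup>2 / (of_int c * \<tau> + of_int d)) * g \<tau> z"
    and "g \<tau> (z + of_int l * \<tau> + of_int u) =
      ee (- (of_nat m * (of_int l)\<^sup>2 * \<tau>) - 2 * of_nat m * of_int l * z) * g \<tau> z"
proof -
  have gc: "isCont (g \<sigma>) w" if "0 < Im \<sigma>" for \<sigma> w
    using isCont_line[OF hol_at_isCont[OF hol[OF that, of w]]] by simp
  have iee: "isCont ee w" for w
    using ee_has_field_derivative DERIV_isCont by blast
  {
    assume det: "a * d - b * c = (1::int)"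
    define J where "J = of_int c * \<tau> + of_int d"
    define \<rho> where "\<rho> = (of_int a * \<tau> + of_int b) / J"
    have J0: "J \<noteq> 0" and \<rho>: "0 < Im \<rho>" using Im_moebius_pos[OF det \<tau>] by (auto simp: J_def \<rho>_def)
    have "g \<rho> (z / J) = ee (of_nat m * of_int c * z\<^sup>2 / J) * g \<tau> z"
    proof (rule eq_by_density[where u = "\<lambda>z. g \<rho> (z / J)" and z = z and
          v = "\<lambda>z. ee (of_nat m * of_int c * z\<^sup>2 / J) * g \<tau> z"])
      show "isCont (\<lambda>z. g \<rho> (z / J)) z"
        by (rule isCont_o2[OF _ gc[OF \<rho>]]) (use J0 in \<open>auto intro!: continuous_intros\<close>)
      show "isCont (\<lambda>z. ee (of_nat m * of_int c * z\<^sup>2 / J) * g \<tau> z) z"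
        by (intro continuous_intros gc \<tau> isCont_o2[OF _ iee]) (use J0 in auto)
      show "eventually (\<lambda>w. g \<rho> (w / J) = ee (of_nat m * of_int c * w\<^sup>2 / J) * g \<tau> w) (at z)"
        using f_nonzero_near[OF \<tau>]
      proof eventually_elim
        case (elim w)
        have fm: "f \<rho> (w / J) = J powi k * ee (of_nat m * of_int c * w\<^sup>2 / J) * f \<tau> w"
          unfolding \<rho>_def J_def by (rule f_modular[OF det \<tau>])
        have "ee (of_nat (2 * m) * of_int c * w\<^sup>2 / J) =
            ee (of_nat m * of_int c * w\<^sup>2 / J + of_nat m * of_int c * w\<^sup>2 / J)"
          by (rule arg_cong[of _ _ ee]) (simp add: field_simps)
        hence e2: "ee (of_nat (2 * m) * of_int c * w\<^sup>2 / J) =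
            ee (of_nat m * of_int c * w\<^sup>2 / J) * ee (of_nat m * of_int c * w\<^sup>2 / J)"
          by (simp only: ee_add)
        have nz: "f \<rho> (w / J) \<noteq> 0" using elim J0 by (simp add: fm)
        have "g \<rho> (w / J) = hecke_V2 k f \<rho> (w / J) / f \<rho> (w / J)" by (rule quot[OF \<rho> nz])
        also have "hecke_V2 k f \<rho> (w / J) = J powi k * (ee (of_nat m * of_int c * w\<^sup>2 / J) *
            ee (of_nat m * of_int c * w\<^sup>2 / J)) * hecke_V2 k f \<tau> w"
          unfolding \<rho>_def J_def e2[unfolded J_def, symmetric] by (rule hecke_V2_modular[OF det \<tau>])
        also have "\<dots> / f \<rho> (w / J) = ee (of_nat m * of_int c * w\<^sup>2 / J) * g \<tau> w"
          unfolding fm quot[OF \<tau> elim] using J0 elim by simp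
        finally show ?case .
      qed
    qed
    thus "g ((of_int a * \<tau> + of_int b) / (of_int c * \<tau> + of_int d)) (z / (of_int c * \<tau> + of_int d)) =
      ee (of_nat m * of_int c * z\<^sup>2 / (of_int c * \<tau> + of_int d)) * g \<tau> z"
      by (simp add: J_def \<rho>_def)
  }
  define E where "E = (\<lambda>z. ee (- (of_nat m * (of_int l)\<^sup>2 * \<tau>) - 2 * of_nat m * of_int l * z))"
  have "g \<tau> (z + of_int l * \<tau> + of_int u) = E z * g \<tau> z"
  proof (rule eq_by_density[where u = "\<lambda>z. g \<tau> (z + of_int l * \<tau> + of_int u)" and z = z and
        v = "\<lambda>z. E z * g \<tau> z"])
    show "isCont (\<lambda>z. g \<tau> (z + of_int l * \<tau> + of_int u)) z"
      by (rule isCont_o2[OF _ gc[OF \<tau>]]) (auto intro!: continuous_intros)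
    show "isCont (\<lambda>z. E z * g \<tau> z) z"
      unfolding E_def by (intro continuous_intros gc \<tau> isCont_o2[OF _ iee])
    show "eventually (\<lambda>w. g \<tau> (w + of_int l * \<tau> + of_int u) = E w * g \<tau> w) (at z)"
      using f_nonzero_near[OF \<tau>]
    proof eventually_elim
      case (elim w)
      have fm: "f \<tau> (w + of_int l * \<tau> + of_int u) = E w * f \<tau> w"
        unfolding E_def by (rule f_elliptic[OF \<tau>])
      have Enz: "E w \<noteq> 0" by (simp add: E_def)
      have e2: "ee (- (of_nat (2 * m) * (of_int l)\<^sup>2 * \<tau>) - 2 * of_nat (2 * m) * of_int l * w) = E w * E w"
        unfolding E_def ee_add[symmetric] by (rule arg_cong[of _ _ ee]) (simp add: algebra_simps)
      have nz: "f \<tau> (w + of_int l * \<tau> + of_int u) \<noteq> 0" using elim Enz by (simp add: fm)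
      show ?case unfolding quot[OF \<tau> nz] quot[OF \<tau> elim] hecke_V2_elliptic[OF \<tau>] e2 fm
        using Enz elim by simp
    qed
  qed
  thus "g \<tau> (z + of_int l * \<tau> + of_int u) =
      ee (- (of_nat m * (of_int l)\<^sup>2 * \<tau>) - 2 * of_nat m * of_int l * z) * g \<tau> z"
    by (simp add: E_def)
qed

end


section \<open>Fourier expansions\<close>

lemma ee_has_integral:
  "((\<lambda>u. ee (of_int j * of_real u)) has_integral (if j = 0 then 1 else 0)) {0..1::real}"
proof (cases "j = 0")
  case True
  thus ?thesis using has_integral_const_real[of "1::complex" 0 1] by simp
next
  case False
  define c where "c = 2 * of_real pi * \<i> * (of_int j :: complex)"
  have c: "c \<noteq> 0" using False by (simp add: c_def)
  have "((\<lambda>u. ee (of_int j * of_real u)) has_integral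
     (ee (of_int j * of_real 1) / c - ee (of_int j * of_real 0) / c)) {0..1}"
  proof (rule fundamental_theorem_of_calculus)
    fix x :: real assume "x \<in> {0..1}"
    have "((\<lambda>w. exp (c * w) / c) has_field_derivative exp (c * of_real x)) (at (of_real x))"
      using c by (auto intro!: derivative_eq_intros)
    hence "((\<lambda>u. exp (c * of_real u) / c) has_vector_derivative exp (c * of_real x)) (at x within {0..1})"
      by (rule has_vector_derivative_real_field)
    thus "((\<lambda>u. ee (of_int j * of_real u) / c) has_vector_derivative ee (of_int j * of_real x)) (at x within {0..1})"
      by (simp add: ee_def c_def mult_ac)
  qed auto
  thus ?thesis using False by simp
qed

text \<open>The coefficient is an integral of the sum over one period at height v. As v is free,
  moving it against the sign of r later produces exponential decay in r.\<close>

lemma laurent_coefficient_bound: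
  assumes S: "finite S" "r \<in> S"
    and bnd: "\<And>u. 0 \<le> u \<Longrightarrow> u \<le> 1 \<Longrightarrow> norm (\<Sum>s\<in>S. c s * ee (of_int s * Complex u v)) \<le> B"
  shows "norm (c r) * exp (- 2 * pi * of_int r * v) \<le> B"
proof -
  have B: "0 \<le> B" by (rule order_trans[OF norm_ge_zero bnd[of 0]]) auto
  define F where "F = (\<lambda>u. \<Sum>s\<in>S. (c s * ee (of_int s * (\<i> * of_real v))) * ee (of_int (s - r) * of_real u))"
  have "(F has_integral (\<Sum>s\<in>S. (c s * ee (of_int s * (\<i> * of_real v))) * (if s - r = 0 then 1 else 0))) {0..1}"
    unfolding F_def by (intro has_integral_sum has_integral_mult_right ee_has_integral S)
  also have "(\<Sum>s\<in>S. (c s * ee (of_int s * (\<i> * of_real v))) * (if s - r = 0 then 1 else 0)) =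
      c r * ee (of_int r * (\<i> * of_real v))"
    using S by (simp add: if_distrib cong: if_cong)
  finally have "(F has_integral c r * ee (of_int r * (\<i> * of_real v))) (cbox 0 1)" by simp
  hence "norm (c r * ee (of_int r * (\<i> * of_real v))) \<le> B * measure lborel (cbox 0 (1::real))"
  proof (rule has_integral_bound[OF B])
    fix u :: real assume u: "u \<in> cbox 0 1"
    have "F u = ee (- of_int r * of_real u) * (\<Sum>s\<in>S. c s * ee (of_int s * Complex u v))"
      unfolding F_def sum_distrib_left
    proof (rule sum.cong[OF refl])
      fix s
      have "ee (of_int s * (\<i> * of_real v)) * ee (of_int (s - r) * of_real u) =
         ee (- of_int r * of_real u) * ee (of_int s * Complex u v)"
        unfolding ee_add[symmetric] by (rule arg_cong[of _ _ ee]) (simp add: Complex_eq algebra_simps)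
      thus "c s * ee (of_int s * (\<i> * of_real v)) * ee (of_int (s - r) * of_real u) =
         ee (- of_int r * of_real u) * (c s * ee (of_int s * Complex u v))"
        by (simp add: mult_ac)
    qed
    also have "norm \<dots> = norm (\<Sum>s\<in>S. c s * ee (of_int s * Complex u v))"
      by (simp add: norm_mult norm_ee)
    also have "\<dots> \<le> B" using u by (intro bnd) auto
    finally show "norm (F u) \<le> B" .
  qed
  thus ?thesis by (simp add: norm_mult norm_ee mult_ac)
qed

lemma summable_on_exp_abs:
  fixes a :: real
  assumes "a > 0" shows "(\<lambda>r::int. exp (- a * of_int \<bar>r\<bar>)) summable_on UNIV"
proof -
  have "summable (\<lambda>n. norm (exp (- a) ^ n :: real))" using assms by (simp add: norm_power)
  hence "(\<lambda>n. exp (- a) ^ n :: real) summable_on (UNIV :: nat set)"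
    by (rule norm_summable_imp_summable_on)
  moreover have "exp (- a) ^ n = (exp (- a * of_int \<bar>int n\<bar>) :: real)" "exp (- a) ^ n = (exp (- a * of_int \<bar>- int n\<bar>) :: real)" for n
    by (simp_all add: exp_of_nat_mult[symmetric] mult.commute)
  ultimately have "((\<lambda>r. exp (- a * of_int \<bar>r\<bar>)) \<circ> int) summable_on UNIV"
    "((\<lambda>r. exp (- a * of_int \<bar>r\<bar>)) \<circ> (\<lambda>n. - int n)) summable_on UNIV"
    by (simp_all add: o_def)
  hence "(\<lambda>r. exp (- a * of_int \<bar>r\<bar>)) summable_on range int"
    "(\<lambda>r. exp (- a * of_int \<bar>r\<bar>)) summable_on range (\<lambda>n. - int n)"
    by (subst summable_on_reindex; auto simp: inj_on_def)+
  hence "(\<lambda>r. exp (- a * of_int \<bar>r\<bar>)) summable_on (range int \<union> range (\<lambda>n. - int n))"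
    by (rule summable_on_union)
  also have "range int \<union> range (\<lambda>n. - int n) = UNIV"
  proof -
    have "x \<in> range int \<union> range (\<lambda>n. - int n)" for x :: int
      by (cases x rule: int_cases2) auto
    thus ?thesis by blast
  qed
  finally show ?thesis .
qed

lemma summable_on_geometric_exp:
  fixes a t M :: real
  assumes "0 \<le> t" "t < 1" "a > 0"
  shows "(\<lambda>(n, r). M * t ^ n * exp (- a * of_int \<bar>r\<bar>)) summable_on (UNIV :: (nat \<times> int) set)"
proof -
  define E where "E = (\<Sum>\<^sub>\<infinity>r::int. exp (- a * of_int \<bar>r\<bar>))"
  have e: "(\<lambda>r::int. exp (- a * of_int \<bar>r\<bar>)) summable_on UNIV" by (rule summable_on_exp_abs[OF assms(3)])
  have "Infinite_Sum.abs_summable_on (\<lambda>(n, r). M * t ^ n * exp (- a * of_int \<bar>r\<bar>)) (UNIV \<times> UNIV :: (nat \<times> int) set)"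
  proof (subst Infinite_Sum.abs_summable_on_Sigma_iff, intro conjI ballI)
    fix n :: nat
    show "Infinite_Sum.abs_summable_on (\<lambda>r. case (n, r) of (n, r) \<Rightarrow> M * t ^ n * exp (- a * of_int \<bar>r\<bar>)) (UNIV :: int set)"
      using summable_on_cmult_right[OF e, of "\<bar>M * t ^ n\<bar>"] by (simp add: abs_mult)
  next
    have "(\<Sum>\<^sub>\<infinity>r::int. norm (M * t ^ n * exp (- a * of_int \<bar>r\<bar>))) = \<bar>M\<bar> * E * t ^ n" for n
    proof -
      have "(\<Sum>\<^sub>\<infinity>r::int. norm (M * t ^ n * exp (- a * of_int \<bar>r\<bar>))) = (\<Sum>\<^sub>\<infinity>r::int. \<bar>M\<bar> * t ^ n * exp (- a * of_int \<bar>r\<bar>))"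
        using assms by (intro infsum_cong) (simp add: abs_mult)
      also have "\<dots> = \<bar>M\<bar> * t ^ n * E" unfolding E_def by (rule infsum_cmult_right')
      finally show ?thesis by (simp add: mult_ac)
    qed
    moreover have "Infinite_Sum.abs_summable_on (\<lambda>n. \<bar>M\<bar> * E * t ^ n) UNIV"
    proof -
      have "summable (\<lambda>n. norm (t ^ n))" using assms by (simp add: norm_power)
      hence "(\<lambda>n. norm (t ^ n)) summable_on UNIV"
        by (intro norm_summable_imp_summable_on) simp
      from summable_on_cmult_right[OF this, of "\<bar>\<bar>M\<bar> * E\<bar>"] show ?thesis by (simp add: abs_mult)
    qed
    ultimately show "Infinite_Sum.abs_summable_on
        (\<lambda>n. \<Sum>\<^sub>\<infinity>r. norm (case (n, r) of (n, r) \<Rightarrow> M * t ^ n * exp (- a * of_int \<bar>r\<bar>))) UNIV" by simp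
  qed
  thus ?thesis using abs_summable_summable by fastforce
qed

lemma periodic_int:
  assumes per: "\<And>\<tau>. 0 < Im \<tau> \<Longrightarrow> G (\<tau> + 1) = G \<tau>" and "0 < Im \<tau>"
  shows "G (\<tau> + of_int n) = (G \<tau> :: complex)"
proof (induction n rule: int_induct[where k = 0])
  case (step1 i)
  thus ?case using per[of "\<tau> + of_int i"] assms(2) by (simp add: add_ac)
next
  case (step2 i)
  thus ?case using per[of "\<tau> + of_int i - 1"] assms(2) by (simp add: algebra_simps)
qed simp

lemma ee_Ln: "q \<noteq> 0 \<Longrightarrow> ee (Ln q / (2 * of_real pi * \<i>)) = q"
  by (simp add: ee_def)

lemma Im_Ln_div: "q \<noteq> 0 \<Longrightarrow> Im (Ln q / (2 * of_real pi * \<i>)) = - ln (norm q) / (2 * pi)"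
  by (simp add: Im_divide power2_eq_square field_simps)

text \<open>A function of period 1 descends to the punctured disc, and the function
  \<open>F\<close>, which matches it for large Im \<tau> only, fills in q = 0. The given power
  series thus belongs to a function holomorphic on the whole disc.\<close>

lemma q_expansion_unit_disc:
  fixes G :: "complex \<Rightarrow> complex"
  assumes hol: "G holomorphic_on {\<tau>. 0 < Im \<tau>}"
    and per: "\<And>\<tau>. 0 < Im \<tau> \<Longrightarrow> G (\<tau> + 1) = G \<tau>"
    and F: "F has_fps_expansion X" and y: "\<And>\<tau>. 0 < Im \<tau> \<Longrightarrow> y < Im \<tau> \<Longrightarrow> G \<tau> = F (ee \<tau>)"
  obtains P where "P holomorphic_on ball 0 1" "\<And>\<tau>. 0 < Im \<tau> \<Longrightarrow> P (ee \<tau>) = G \<tau>"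
    "P has_fps_expansion X"
proof
  define L where "L = (\<lambda>q. Ln q / (2 * of_real pi * \<i>))"
  define P where "P = (\<lambda>q. if q = 0 then fps_nth X 0 else G (L q))"
  show P: "P (ee \<tau>) = G \<tau>" if "0 < Im \<tau>" for \<tau>
  proof -
    have "ee (L (ee \<tau>) - \<tau>) = 1" by (simp add: ee_diff L_def ee_Ln)
    then obtain n :: int where "L (ee \<tau>) - \<tau> = of_int n" using ee_eq_1_iff by blast
    hence "L (ee \<tau>) = \<tau> + of_int n" by (simp add: algebra_simps)
    thus ?thesis using periodic_int[of G \<tau> n] per that by (simp add: P_def)
  qed
  have ImL: "Im (L q) = - ln (norm q) / (2 * pi)" if "q \<noteq> 0" for q
    using Im_Ln_div[OF that] by (simp add: L_def)
  show exp: "P has_fps_expansion X"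
  proof -
    have ev: "eventually (\<lambda>q. F q = P q) (nhds 0)"
    proof -
      \<comment> \<open>The bound by 1 gives the logarithm of q a positive imaginary part, the other
        bound one above y.\<close>
      define d where "d = min 1 (exp (- 2 * pi * y))"
      have d: "d > 0" by (simp add: d_def)
      have "F q = P q" if q: "norm q < d" for q
      proof (cases "q = 0")
        case True
        thus ?thesis using has_fps_expansion_imp_0_eq_fps_nth_0[OF F] by (simp add: P_def)
      next
        case False
        have "ln (norm q) < ln d" using q False d by simp
        also have "ln d \<le> ln (exp (- 2 * pi * y))" using d by (subst ln_le_cancel_iff) (auto simp: d_def)
        finally have "ln (norm q) < - 2 * pi * y" by simp
        hence "2 * pi * y < 2 * pi * Im (L q)" using ImL[OF False] by (simp add: field_simps)
        hence "y < Im (L q)" by (simp add: mult_less_cancel_left_pos)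
        moreover have "norm q < 1" using q by (simp add: d_def)
        hence "ln (norm q) < 0" using False by simp
        hence "0 < 2 * pi * Im (L q)" using ImL[OF False] by (simp add: field_simps)
        hence "0 < Im (L q)" by (simp add: zero_less_mult_iff)
        ultimately show ?thesis using y[of "L q"] False by (simp add: P_def L_def ee_Ln)
      qed
      thus ?thesis unfolding eventually_nhds_metric using d by (intro exI[of _ d]) auto
    qed
    show ?thesis using F has_fps_expansion_cong[OF ev refl] by simp
  qed
  show "P holomorphic_on ball 0 1"
    unfolding holomorphic_on_open[OF open_ball]
  proof (intro ballI)
    fix q0 :: complex assume q0: "q0 \<in> ball 0 1"
    show "\<exists>f'. (P has_field_derivative f') (at q0)"
    proof (cases "q0 = 0")
      case True
      obtain s where s: "open s" "0 \<in> s" "P holomorphic_on s"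
        using has_fps_expansion_imp_holomorphic[OF exp] by metis
      thus ?thesis using True by (auto simp: holomorphic_on_open)
    next
      case False
      define \<tau>0 where "\<tau>0 = L q0"
      have "ln (norm q0) < 0" using q0 False by simp
      hence "0 < 2 * pi * Im \<tau>0" using ImL[OF False] by (simp add: \<tau>0_def field_simps)
      hence "0 < Im \<tau>0" by (simp add: zero_less_mult_iff)
      \<comment> \<open>A branch of the logarithm around q0 with value \<tau>0 there:
        \<open>Ln\<close> is evaluated near 1 only, away from its cut.\<close>
      define K where "K = (\<lambda>q. \<tau>0 + L (q / q0))"
      have K0: "K q0 = \<tau>0" using False by (simp add: K_def L_def)
      have Kd: "(K has_field_derivative 1 / q0 / (2 * of_real pi * \<i>)) (at q0)"
        unfolding K_def L_def using False by (auto intro!: derivative_eq_intros)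
      have GH: "(G has_field_derivative deriv G \<tau>0) (at (K q0))"
        unfolding K0 using hol \<open>0 < Im \<tau>0\<close>
        by (intro holomorphic_derivI[where S = "{\<tau>. 0 < Im \<tau>}"]) (auto simp: open_halfspace_Im_gt)
      have D: "((\<lambda>q. G (K q)) has_field_derivative deriv G \<tau>0 * (1 / q0 / (2 * of_real pi * \<i>))) (at q0)"
        using DERIV_chain2[OF GH Kd] .
      have "isCont K q0" using Kd by (rule DERIV_isCont)
      hence "(K \<longlongrightarrow> \<tau>0) (nhds q0)"
        using tendsto_at_iff_tendsto_nhds[of K q0] by (simp add: isCont_def K0)
      moreover have "eventually (\<lambda>\<tau>. \<tau> \<in> {\<tau>. 0 < Im \<tau>}) (nhds \<tau>0)"
        by (rule eventually_nhds_in_open) (use \<open>0 < Im \<tau>0\<close> in \<open>auto simp: open_halfspace_Im_gt\<close>)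
      ultimately have "eventually (\<lambda>q. K q \<in> {\<tau>. 0 < Im \<tau>}) (nhds q0)"
        by (rule eventually_compose_filterlim[rotated])
      moreover have "eventually (\<lambda>q. q \<in> - {0}) (nhds q0)"
        by (rule eventually_nhds_in_open) (use False in auto)
      ultimately have "eventually (\<lambda>q. P q = G (K q)) (nhds q0)"
      proof eventually_elim
        case (elim q)
        have "ee (K q) = q" using elim False by (simp add: K_def L_def ee_add ee_Ln \<tau>0_def)
        thus ?case using P[of "K q"] elim by simp
      qed
      hence "(P has_field_derivative deriv G \<tau>0 * (1 / q0 / (2 * of_real pi * \<i>))) (at q0)"
        using D by (subst DERIV_cong_ev[OF refl _ refl]) auto
      thus ?thesis by blast
    qed
  qed
qed

text \<open>The radius in q granted by the hypothesis may depend on z, but the Laurent polynomials h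
  n do not. Cauchy's estimate in q bounds h n uniformly at a given height Im z, a second one in zeta
  bounds its coefficients, and the resulting majorant is summable over both indices. The power N
  clears the pole at q = 0.\<close>

lemma jacobi_fourier_of_q_expansion:
  fixes g :: "complex \<Rightarrow> complex \<Rightarrow> complex" and c :: "nat \<Rightarrow> int \<Rightarrow> complex" and N :: nat
  assumes cont: "\<And>\<tau> z. 0 < Im \<tau> \<Longrightarrow> isCont (\<lambda>p. g (fst p) (snd p)) (\<tau>, z)"
    and hol: "\<And>z. (\<lambda>\<tau>. g \<tau> z) holomorphic_on {\<tau>. 0 < Im \<tau>}"
    and per: "\<And>\<tau> z. 0 < Im \<tau> \<Longrightarrow> g (\<tau> + 1) z = g \<tau> z"
    and fin: "\<And>n. finite {r. c n r \<noteq> 0}"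
    and exp: "\<And>z. \<exists>F y. F has_fps_expansion Abs_fps (\<lambda>n. \<Sum>r | c n r \<noteq> 0. c n r * ee (of_int r * z)) \<and>
       (\<forall>\<tau>. 0 < Im \<tau> \<longrightarrow> y < Im \<tau> \<longrightarrow> ee \<tau> ^ N * g \<tau> z = F (ee \<tau>))"
  shows "jacobi_fourier g (\<lambda>n r. if n + int N \<ge> 0 then c (nat (n + int N)) r else 0)"
proof -
  define h where "h = (\<lambda>n z. \<Sum>r | c n r \<noteq> 0. c n r * ee (of_int r * z))"
  have "\<exists>P. P holomorphic_on ball 0 1 \<and> (\<forall>\<tau>. 0 < Im \<tau> \<longrightarrow> P (ee \<tau>) = ee \<tau> ^ N * g \<tau> z) \<and>
      P has_fps_expansion Abs_fps (\<lambda>n. h n z)" for z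
  proof -
    obtain F y where F: "F has_fps_expansion Abs_fps (\<lambda>n. h n z)"
      "\<And>\<tau>. 0 < Im \<tau> \<Longrightarrow> y < Im \<tau> \<Longrightarrow> ee \<tau> ^ N * g \<tau> z = F (ee \<tau>)"
      using exp[of z] unfolding h_def by blast
    have "(\<lambda>\<tau>. ee \<tau> ^ N * g \<tau> z) holomorphic_on {\<tau>. 0 < Im \<tau>}"
      by (intro holomorphic_intros hol)
    moreover have "ee (\<tau> + 1) ^ N * g (\<tau> + 1) z = ee \<tau> ^ N * g \<tau> z" if "0 < Im \<tau>" for \<tau>
      using per[OF that] by (simp add: ee_add)
    ultimately obtain P where "P holomorphic_on ball 0 1" "P has_fps_expansion Abs_fps (\<lambda>n. h n z)"
       "\<And>\<tau>. 0 < Im \<tau> \<Longrightarrow> P (ee \<tau>) = ee \<tau> ^ N * g \<tau> z"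
      using q_expansion_unit_disc[of "\<lambda>\<tau>. ee \<tau> ^ N * g \<tau> z", OF _ _ F(1), of y] F(2) by blast
    thus ?thesis by blast
  qed
  hence "\<exists>P. \<forall>z. P z holomorphic_on ball 0 1 \<and>
      (\<forall>\<tau>. 0 < Im \<tau> \<longrightarrow> P z (ee \<tau>) = ee \<tau> ^ N * g \<tau> z) \<and> P z has_fps_expansion Abs_fps (\<lambda>n. h n z)"
    by (intro choice allI)
  then obtain P where P: "\<And>z. P z holomorphic_on ball 0 1"
    "\<And>z \<tau>. 0 < Im \<tau> \<Longrightarrow> P z (ee \<tau>) = ee \<tau> ^ N * g \<tau> z"
    "\<And>z. P z has_fps_expansion Abs_fps (\<lambda>n. h n z)"
    by blast
  have h_deriv: "h n z = (deriv ^^ n) (P z) 0 / fact n" for n z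
    using fps_nth_fps_expansion[OF P(3)[of z], of n] by simp
  have bound: "\<exists>M. \<forall>u n. 0 \<le> u \<longrightarrow> u \<le> 1 \<longrightarrow> norm (h n (Complex u v)) \<le> M / \<rho> ^ n"
    if \<rho>: "0 < \<rho>" "\<rho> < 1" for v \<rho> :: real
  proof -
    define y where "y = - ln \<rho> / (2 * pi)"
    have y: "y > 0" using \<rho> by (simp add: y_def field_simps)
    have y\<rho>: "exp (- 2 * pi * y) = \<rho>" using \<rho> by (simp add: y_def)
    \<comment> \<open>One period of Re \<tau> already covers the circle of radius \<rho> in q, so a
      compact set of arguments suffices.\<close>
    define K where "K = (\<lambda>w::real \<times> real. (Complex (fst w) y, Complex (snd w) v)) ` ({0..1} \<times> {0..1})"
    have "compact K" unfolding K_def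
      by (intro compact_continuous_image compact_Times)
         (auto intro!: continuous_intros simp: Complex_eq)
    moreover have "continuous_on K (\<lambda>p. g (fst p) (snd p))"
      by (intro continuous_at_imp_continuous_on ballI) (use cont y in \<open>auto simp: K_def\<close>)
    ultimately have "bounded ((\<lambda>p. g (fst p) (snd p)) ` K)"
      by (intro compact_imp_bounded compact_continuous_image)
    then obtain M where M: "\<And>p. p \<in> K \<Longrightarrow> norm (g (fst p) (snd p)) \<le> M"
      by (auto simp: bounded_iff)
    have "norm (h n (Complex u v)) \<le> M / \<rho> ^ n" if u: "0 \<le> u" "u \<le> 1" for u n
    proof -
      define z where "z = Complex u v"
      have "norm ((deriv ^^ n) (P z) 0) \<le> fact n * M / \<rho> ^ n"
      proof (rule Cauchy_inequality)
        show "P z holomorphic_on ball 0 \<rho>" by (rule holomorphic_on_subset[OF P(1)]) (use \<rho> in auto)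
        show "continuous_on (cball 0 \<rho>) (P z)"
          by (rule holomorphic_on_imp_continuous_on[OF holomorphic_on_subset[OF P(1)]]) (use \<rho> in auto)
        show "0 < \<rho>" by (rule \<rho>)
        fix q :: complex assume "norm (0 - q) = \<rho>"
        hence q: "norm q = \<rho>" "q \<noteq> 0" using \<rho> by auto
        define t where "t = Ln q / (2 * of_real pi * \<i>)"
        define x where "x = frac (Re t)"
        have Imt: "Im t = y" using Im_Ln_div[OF q(2)] q by (simp add: t_def y_def)
        have "ee (Complex x y) = ee (t + of_int (- floor (Re t)))"
          by (rule arg_cong[of _ _ ee]) (simp add: complex_eq_iff x_def frac_def Imt)
        also have "\<dots> = ee t" by (simp only: ee_add ee_of_int mult_1_right)
        also have "\<dots> = q" using q by (simp add: t_def ee_Ln)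
        finally have eq: "ee (Complex x y) = q" .
        have "P z q = q ^ N * g (Complex x y) z" using P(2)[of "Complex x y" z] y by (simp add: eq)
        hence "norm (P z q) = \<rho> ^ N * norm (g (Complex x y) z)" using q by (simp add: norm_mult norm_power)
        also have "\<dots> \<le> 1 * norm (g (Complex x y) z)"
          using \<rho> by (intro mult_right_mono power_le_one) auto
        also have "\<dots> \<le> M"
        proof -
          have "x \<in> {0..1}" using frac_ge_0[of "Re t"] frac_lt_1[of "Re t"] unfolding x_def by simp
          hence "(Complex x y, z) \<in> K" unfolding K_def z_def using u
            by (intro image_eqI[of _ _ "(x, u)"]) auto
          from M[OF this] show ?thesis by simp
        qed
        finally show "norm (P z q) \<le> M" .
      qed
      hence "norm ((deriv ^^ n) (P z) 0) / fact n \<le> M / \<rho> ^ n" by (simp add: field_simps)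
      thus ?thesis by (simp add: h_deriv norm_divide z_def)
    qed
    thus ?thesis by blast
  qed
  have main: "((\<lambda>(n, r). c n r * ee \<tau> ^ n * ee (of_int r * z)) has_sum (ee \<tau> ^ N * g \<tau> z)) UNIV"
    if \<tau>: "0 < Im \<tau>" for \<tau> z
  proof -
    define q where "q = ee \<tau>"
    have q: "norm q < 1" "norm q > 0" using \<tau> by (auto simp: q_def)
    \<comment> \<open>A radius strictly beyond |q| makes \<open>norm q / \<rho>\<close>, the ratio
      of the dominating geometric series, less than 1.\<close>
    obtain \<rho> where \<rho>: "norm q < \<rho>" "\<rho> < 1" using q dense by blast
    have \<rho>0: "\<rho> > 0" using \<rho> q by linarith
    define T where "T = (\<lambda>(n, r). c n r * q ^ n * ee (of_int r * z))"
    obtain M1 where M1: "\<And>u n. 0 \<le> u \<Longrightarrow> u \<le> 1 \<Longrightarrow> norm (h n (Complex u (Im z - 1))) \<le> M1 / \<rho> ^ n"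
      using bound[OF \<rho>0 \<rho>(2)] by metis
    obtain M2 where M2: "\<And>u n. 0 \<le> u \<Longrightarrow> u \<le> 1 \<Longrightarrow> norm (h n (Complex u (Im z + 1))) \<le> M2 / \<rho> ^ n"
      using bound[OF \<rho>0 \<rho>(2)] by metis
    define M where "M = max M1 M2"
    have M: "norm (h n (Complex u v)) \<le> M / \<rho> ^ n" if "0 \<le> u" "u \<le> 1" "v = Im z - 1 \<or> v = Im z + 1" for u v n
    proof -
      have "M1 / \<rho> ^ n \<le> M / \<rho> ^ n" "M2 / \<rho> ^ n \<le> M / \<rho> ^ n"
        using \<rho>0 by (auto simp: M_def intro!: divide_right_mono)
      thus ?thesis using M1[OF that(1,2), of n] M2[OF that(1,2), of n] that(3) by auto
    qed
    have M0: "0 \<le> M"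
    proof -
      have "0 \<le> M / \<rho> ^ 0" using M[of 0 "Im z - 1" 0] norm_ge_zero order_trans by blast
      thus ?thesis by simp
    qed
    define t where "t = norm q / \<rho>"
    have t: "0 \<le> t" "t < 1" using \<rho>(1) \<rho>0 by (simp_all add: t_def)
    have Tb: "norm (T (n, r)) \<le> M * t ^ n * exp (- (2 * pi) * of_int \<bar>r\<bar>)" for n r
    proof (cases "c n r = 0")
      case True
      thus ?thesis using M0 t by (simp add: T_def)
    next
      case False
      \<comment> \<open>Evaluating one unit below Im z for r \<ge> 0 and one unit above it for r < 0
        gains the factor exp(- 2 pi |r|).\<close>
      define v where "v = (if r \<ge> 0 then Im z - 1 else Im z + 1)"
      have "norm (c n r) * exp (- 2 * pi * of_int r * v) \<le> M / \<rho> ^ n"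
        by (rule laurent_coefficient_bound[where S = "{r. c n r \<noteq> 0}"])
           (use False fin M[of _ v n] in \<open>auto simp: h_def v_def\<close>)
      hence "norm (c n r) \<le> M / \<rho> ^ n * exp (2 * pi * of_int r * v)"
        by (simp add: exp_minus field_simps)
      hence "norm (c n r) * (norm q ^ n * exp (- 2 * pi * of_int r * Im z)) \<le>
          M / \<rho> ^ n * exp (2 * pi * of_int r * v) * (norm q ^ n * exp (- 2 * pi * of_int r * Im z))"
        by (intro mult_right_mono) auto
      also have "\<dots> = M * t ^ n * (exp (2 * pi * of_int r * v) * exp (- 2 * pi * of_int r * Im z))"
        by (simp add: t_def power_divide)
      also have "exp (2 * pi * of_int r * v) * exp (- 2 * pi * of_int r * Im z) = exp (- (2 * pi) * of_int \<bar>r\<bar>)"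
        unfolding exp_add[symmetric] v_def by (rule arg_cong[of _ _ exp]) (auto simp: algebra_simps)
      finally show ?thesis by (simp add: T_def norm_mult norm_power norm_ee mult_ac)
    qed
    have "Infinite_Sum.abs_summable_on T UNIV"
      by (rule Infinite_Sum.abs_summable_on_comparison_test'[OF summable_on_geometric_exp[OF t, of "2 * pi" M]])
         (use Tb in auto)
    hence "T summable_on UNIV" by (rule abs_summable_summable)
    hence sum1: "(T has_sum infsum T UNIV) (Sigma UNIV (\<lambda>_. UNIV))" by simp
    \<comment> \<open>Summing over r first recovers the convergent expansion of \<open>P z\<close>
      at q, which identifies the value of the double sum.\<close>
    have "((\<lambda>n. h n z * q ^ n) has_sum infsum T UNIV) UNIV"
    proof (rule has_sum_SigmaD[OF sum1])
      fix n
      show "((\<lambda>r. T (n, r)) has_sum h n z * q ^ n) UNIV"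
      proof (rule has_sum_finite_neutralI[OF fin[of n]])
        show "h n z * q ^ n = (\<Sum>x | c n x \<noteq> 0. T (n, x))"
          unfolding h_def sum_distrib_right T_def by (intro sum.cong) (auto simp: mult_ac)
      qed (auto simp: T_def)
    qed
    hence "(\<lambda>n. h n z * q ^ n) sums infsum T UNIV" by (rule has_sum_imp_sums)
    moreover have "(\<lambda>n. h n z * q ^ n) sums P z q"
      using has_fps_expansion_imp_sums_complex[OF P(3), of z 1 q] P(1)[of z] q
      by (simp add: one_ereal_def)
    ultimately have "infsum T UNIV = P z q" by (rule sums_unique2)
    also have "\<dots> = ee \<tau> ^ N * g \<tau> z" using P(2)[OF \<tau>] by (simp add: q_def)
    finally show ?thesis using sum1 by (simp add: T_def q_def)
  qed
  show ?thesis unfolding jacobi_fourier_def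
  proof (intro conjI allI impI exI[of _ "- int N"])
    fix n r assume "(if 0 \<le> n + int N then c (nat (n + int N)) r else 0) \<noteq> 0"
    thus "- int N \<le> n" by (auto split: if_splits)
  next
    fix \<tau> z :: complex assume \<tau>: "0 < Im \<tau>"
    define j where "j = (\<lambda>(n, r). (int n - int N, r :: int))"
    define T where "T = (\<lambda>(n, r). (if 0 \<le> n + int N then c (nat (n + int N)) r else 0) * ee (of_int n * \<tau>) * ee (of_int r * z))"
    have "((\<lambda>x. inverse (ee \<tau> ^ N) * (case x of (n, r) \<Rightarrow> c n r * ee \<tau> ^ n * ee (of_int r * z)))
        has_sum inverse (ee \<tau> ^ N) * (ee \<tau> ^ N * g \<tau> z)) UNIV"
      by (rule has_sum_cmult_right[OF main[OF \<tau>]])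
    also have "(\<lambda>x. inverse (ee \<tau> ^ N) * (case x of (n, r) \<Rightarrow> c n r * ee \<tau> ^ n * ee (of_int r * z))) = T \<circ> j"
    proof (rule ext)
      fix x :: "nat \<times> int"
      obtain n r where [simp]: "x = (n, r)" by force
      have "ee (of_int (int n - int N) * \<tau>) = ee \<tau> ^ n * inverse (ee \<tau> ^ N)"
        by (simp add: left_diff_distrib ee_diff ee_of_nat_mult divide_inverse)
      thus "inverse (ee \<tau> ^ N) * (case x of (n, r) \<Rightarrow> c n r * ee \<tau> ^ n * ee (of_int r * z)) = (T \<circ> j) x"
        by (simp add: T_def j_def)
    qed
    finally have "(T \<circ> j has_sum g \<tau> z) UNIV" by (simp add: mult.assoc[symmetric] o_def)
    hence "(T has_sum g \<tau> z) (range j)"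
      by (subst has_sum_reindex) (auto simp: inj_on_def j_def)
    also have "?this \<longleftrightarrow> (T has_sum g \<tau> z) UNIV"
    proof (rule has_sum_cong_neutral)
      fix x assume x: "x \<in> UNIV - range j"
      obtain n r where [simp]: "x = (n, r)" by force
      have "\<not> 0 \<le> n + int N"
      proof
        assume "0 \<le> n + int N"
        hence "x = j (nat (n + int N), r)" by (simp add: j_def)
        thus False using x by blast
      qed
      thus "T x = 0" by (simp add: T_def)
    qed auto
    finally show "((\<lambda>(n, r). (if 0 \<le> n + int N then c (nat (n + int N)) r else 0) * ee (of_int n * \<tau>) * ee (of_int r * z))
        has_sum g \<tau> z) UNIV" by (simp add: T_def)
  qed
qed


section \<open>Power series with integral Laurent coefficients\<close>

text \<open>Integral Laurent polynomials are kept as functions on the nonzero complex numbers, so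
  ring operations need no normal form; the value at 0 is left open.\<close>

definition int_laurent :: "(complex \<Rightarrow> complex) \<Rightarrow> bool" where
  "int_laurent h \<longleftrightarrow> (\<exists>S c. finite S \<and> (\<forall>w. w \<noteq> 0 \<longrightarrow> h w = (\<Sum>r\<in>S. of_int (c r) * w powi r)))"

text \<open>A coefficient function with finite support can be summed over any larger finite set, so
  that several expansions share one index set.\<close>

lemma int_laurentE:
  assumes "int_laurent h"
  obtains c :: "int \<Rightarrow> int" where "finite {r. c r \<noteq> 0}"
    "\<And>w T. w \<noteq> 0 \<Longrightarrow> finite T \<Longrightarrow> {r. c r \<noteq> 0} \<subseteq> T \<Longrightarrow> h w = (\<Sum>r\<in>T. of_int (c r) * w powi r)"
proof -
  obtain S c where S: "finite S" "\<And>w. w \<noteq> 0 \<Longrightarrow> h w = (\<Sum>r\<in>S. of_int (c r) * w powi r)"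
    using assms by (auto simp: int_laurent_def)
  define d where "d = (\<lambda>r. if r \<in> S then c r else 0)"
  have sub: "{r. d r \<noteq> 0} \<subseteq> S" by (auto simp: d_def)
  have "h w = (\<Sum>r\<in>T. of_int (d r) * w powi r)" if "w \<noteq> 0" "finite T" "{r. d r \<noteq> 0} \<subseteq> T" for w T
  proof -
    have "h w = (\<Sum>r\<in>S. of_int (d r) * w powi r)" using S(2)[OF that(1)] by (simp add: d_def)
    also have "\<dots> = (\<Sum>r | d r \<noteq> 0. of_int (d r) * w powi r)"
      by (rule sum.mono_neutral_right) (use S sub in auto)
    also have "\<dots> = (\<Sum>r\<in>T. of_int (d r) * w powi r)"
      by (rule sum.mono_neutral_left) (use that in auto)
    finally show ?thesis .
  qed
  thus ?thesis using that finite_subset[OF sub S(1)] by blast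
qed

lemma int_laurent_cong:
  assumes "int_laurent h" "\<And>w. w \<noteq> 0 \<Longrightarrow> h w = h' w" shows "int_laurent h'"
proof -
  obtain S c where "finite S" "\<And>w. w \<noteq> 0 \<Longrightarrow> h w = (\<Sum>r\<in>S. of_int (c r) * w powi r)"
    using assms(1) by (auto simp: int_laurent_def)
  thus ?thesis using assms(2) unfolding int_laurent_def by (intro exI[of _ S] exI[of _ c]) auto
qed

lemma int_laurent_monom: "int_laurent (\<lambda>w. of_int a * w powi j)"
  unfolding int_laurent_def by (intro exI[of _ "{j}"] exI[of _ "\<lambda>_. a"]) auto

lemma int_laurent_of_int: "int_laurent (\<lambda>_. of_int a)"
  using int_laurent_monom[of a 0] by simp

lemma int_laurent_0: "int_laurent (\<lambda>_. 0)" and int_laurent_1: "int_laurent (\<lambda>_. 1)"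
  using int_laurent_of_int[of 0] int_laurent_of_int[of 1] by simp_all

lemma int_laurent_powi: "int_laurent (\<lambda>w. w powi j)"
  using int_laurent_monom[of 1 j] by simp

lemma int_laurent_add:
  assumes "int_laurent g" "int_laurent h" shows "int_laurent (\<lambda>w. g w + h w)"
proof -
  obtain c where c: "finite {r. c r \<noteq> 0}"
    "\<And>w T. w \<noteq> 0 \<Longrightarrow> finite T \<Longrightarrow> {r. c r \<noteq> 0} \<subseteq> T \<Longrightarrow> g w = (\<Sum>r\<in>T. of_int (c r) * w powi r)"
    using int_laurentE[OF assms(1)] by blast
  obtain d where d: "finite {r. d r \<noteq> 0}"
    "\<And>w T. w \<noteq> 0 \<Longrightarrow> finite T \<Longrightarrow> {r. d r \<noteq> 0} \<subseteq> T \<Longrightarrow> h w = (\<Sum>r\<in>T. of_int (d r) * w powi r)"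
    using int_laurentE[OF assms(2)] by blast
  define T where "T = {r. c r \<noteq> 0} \<union> {r. d r \<noteq> 0}"
  have "g w + h w = (\<Sum>r\<in>T. of_int (c r + d r) * w powi r)" if "w \<noteq> 0" for w
    using c(2)[OF that, of T] d(2)[OF that, of T] c(1) d(1)
    by (simp add: T_def sum.distrib distrib_right)
  thus ?thesis unfolding int_laurent_def using c(1) d(1)
    by (intro exI[of _ T] exI[of _ "\<lambda>r. c r + d r"]) (auto simp: T_def)
qed

lemma int_laurent_mult:
  assumes "int_laurent g" "int_laurent h" shows "int_laurent (\<lambda>w. g w * h w)"
proof -
  obtain S c where S: "finite S" "\<And>w. w \<noteq> 0 \<Longrightarrow> g w = (\<Sum>r\<in>S. of_int (c r) * w powi r)"
    using assms(1) by (auto simp: int_laurent_def)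
  obtain T d where T: "finite T" "\<And>w. w \<noteq> 0 \<Longrightarrow> h w = (\<Sum>r\<in>T. of_int (d r) * w powi r)"
    using assms(2) by (auto simp: int_laurent_def)
  define K where "K = (\<lambda>(r, s). r + s) ` (S \<times> T)"
  define e where "e = (\<lambda>k. \<Sum>(r, s)\<in>{x \<in> S \<times> T. (\<lambda>(r, s). r + s) x = k}. c r * d s)"
  have "g w * h w = (\<Sum>k\<in>K. of_int (e k) * w powi k)" if w: "w \<noteq> 0" for w
  proof -
    have "g w * h w = (\<Sum>(r, s)\<in>S \<times> T. of_int (c r * d s) * w powi (r + s))"
      using w by (simp add: S(2) T(2) sum_product sum.cartesian_product power_int_add mult_ac)
    also have "\<dots> = (\<Sum>k\<in>K. \<Sum>(r, s)\<in>{x \<in> S \<times> T. (\<lambda>(r, s). r + s) x = k}. of_int (c r * d s) * w powi (r + s))"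
      unfolding K_def using S(1) T(1) by (intro sum.image_gen) auto
    also have "\<dots> = (\<Sum>k\<in>K. of_int (e k) * w powi k)"
    proof (rule sum.cong[OF refl])
      fix k
      show "(\<Sum>(r, s)\<in>{x \<in> S \<times> T. (\<lambda>(r, s). r + s) x = k}. of_int (c r * d s) * w powi (r + s)) =
          of_int (e k) * w powi k"
        unfolding e_def of_int_sum sum_distrib_right by (intro sum.cong) auto
    qed
    finally show ?thesis .
  qed
  thus ?thesis unfolding int_laurent_def using S(1) T(1)
    by (intro exI[of _ K] exI[of _ e]) (auto simp: K_def)
qed

lemma int_laurent_minus: "int_laurent h \<Longrightarrow> int_laurent (\<lambda>w. - h w)"
  using int_laurent_mult[OF int_laurent_of_int[of "-1"]] by simp

lemma int_laurent_sum: "(\<And>i. i \<in> I \<Longrightarrow> int_laurent (h i)) \<Longrightarrow> int_laurent (\<lambda>w. \<Sum>i\<in>I. h i w)"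
  by (induction I rule: infinite_finite_induct) (auto intro: int_laurent_add int_laurent_0)

lemma int_laurent_square_arg:
  assumes "int_laurent h" shows "int_laurent (\<lambda>w. h (w ^ 2))"
proof -
  obtain S c where S: "finite S" "\<And>w. w \<noteq> 0 \<Longrightarrow> h w = (\<Sum>r\<in>S. of_int (c r) * w powi r)"
    using assms by (auto simp: int_laurent_def)
  have "int_laurent (\<lambda>w. \<Sum>r\<in>S. of_int (c r) * w powi (2 * r))"
    by (intro int_laurent_sum int_laurent_monom)
  thus ?thesis
    by (rule int_laurent_cong) (simp add: S(2) power_int_mult)
qed

lemma int_laurent_if:
  "int_laurent g \<Longrightarrow> int_laurent h \<Longrightarrow> int_laurent (\<lambda>w. if b then g w else h w)"
  by (cases b) simp_all

text \<open>These model the power series in q over the ring of integral Laurent polynomials, as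
  families of complex series indexed by w.\<close>

definition fps_int_laurent :: "(complex \<Rightarrow> complex fps) \<Rightarrow> bool" where
  "fps_int_laurent X \<longleftrightarrow> (\<forall>n. int_laurent (\<lambda>w. fps_nth (X w) n))"

lemma fps_int_laurent_mult:
  "fps_int_laurent X \<Longrightarrow> fps_int_laurent Y \<Longrightarrow> fps_int_laurent (\<lambda>w. X w * Y w)"
  unfolding fps_int_laurent_def fps_mult_nth
  by (auto intro!: int_laurent_sum int_laurent_mult)

lemma fps_int_laurent_const: "int_laurent h \<Longrightarrow> fps_int_laurent (\<lambda>w. fps_const (h w))"
  unfolding fps_int_laurent_def by (auto intro: int_laurent_if int_laurent_0)

lemma fps_int_laurent_1: "fps_int_laurent (\<lambda>w. 1)"
  unfolding fps_int_laurent_def by (auto simp: int_laurent_0 int_laurent_1)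

lemma fps_int_laurent_prod:
  "(\<And>i. i \<in> I \<Longrightarrow> fps_int_laurent (X i)) \<Longrightarrow> fps_int_laurent (\<lambda>w. \<Prod>i\<in>I. X i w)"
  by (induction I rule: infinite_finite_induct) (auto intro: fps_int_laurent_1 fps_int_laurent_mult)

text \<open>With constant term 1 the recursion for the coefficients of the inverse involves no
  division.\<close>

lemma fps_int_laurent_inverse:
  assumes X: "fps_int_laurent X" and X0: "\<And>w. w \<noteq> 0 \<Longrightarrow> fps_nth (X w) 0 = 1"
  shows "fps_int_laurent (\<lambda>w. inverse (X w))"
  unfolding fps_int_laurent_def
proof
  fix n show "int_laurent (\<lambda>w. fps_nth (inverse (X w)) n)"
  proof (induction n rule: less_induct)
    case (less n)
    show ?case
    proof (cases "n = 0")
      case True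
      show ?thesis by (rule int_laurent_cong[OF int_laurent_1]) (simp add: True X0)
    next
      case False
      have "int_laurent (\<lambda>w. - (\<Sum>i=1..n. fps_nth (X w) i * fps_nth (inverse (X w)) (n - i)))"
        using X less False unfolding fps_int_laurent_def
        by (intro int_laurent_minus int_laurent_sum int_laurent_mult) auto
      thus ?thesis
      proof (rule int_laurent_cong)
        fix w :: complex assume w: "w \<noteq> 0"
        have "X w * inverse (X w) = 1" using X0[OF w] by (intro inverse_mult_eq_1') simp
        hence "0 = fps_nth (X w * inverse (X w)) n" using False by simp
        also have "\<dots> = (\<Sum>i=0..n. fps_nth (X w) i * fps_nth (inverse (X w)) (n - i))"
          by (rule fps_mult_nth)
        also have "\<dots> = fps_nth (inverse (X w)) n + (\<Sum>i=1..n. fps_nth (X w) i * fps_nth (inverse (X w)) (n - i))"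
          using X0[OF w] by (subst sum.atLeast_Suc_atMost) simp_all
        finally show "- (\<Sum>i=1..n. fps_nth (X w) i * fps_nth (inverse (X w)) (n - i)) = fps_nth (inverse (X w)) n"
          by (metis minus_unique add.commute)
      qed
    qed
  qed
qed

text \<open>The radius of convergence in q may depend on w: for each fixed w only the germ at q = 0
  is described.\<close>

definition int_series :: "(complex \<Rightarrow> complex \<Rightarrow> complex) \<Rightarrow> bool" where
  "int_series F \<longleftrightarrow> (\<exists>X. fps_int_laurent X \<and> (\<forall>w. w \<noteq> 0 \<longrightarrow> (\<lambda>q. F q w) has_fps_expansion X w))"

lemma int_seriesI:
  "fps_int_laurent X \<Longrightarrow> (\<And>w. w \<noteq> 0 \<Longrightarrow> (\<lambda>q. F q w) has_fps_expansion X w) \<Longrightarrow> int_series F"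
  unfolding int_series_def by blast

lemma int_series_mult:
  assumes "int_series F" "int_series G" shows "int_series (\<lambda>q w. F q w * G q w)"
proof -
  obtain X where X: "fps_int_laurent X" "\<And>w. w \<noteq> 0 \<Longrightarrow> (\<lambda>q. F q w) has_fps_expansion X w"
    using assms(1) by (auto simp: int_series_def)
  obtain Y where Y: "fps_int_laurent Y" "\<And>w. w \<noteq> 0 \<Longrightarrow> (\<lambda>q. G q w) has_fps_expansion Y w"
    using assms(2) by (auto simp: int_series_def)
  show ?thesis
    by (rule int_seriesI[OF fps_int_laurent_mult[OF X(1) Y(1)]]) (intro has_fps_expansion_mult X Y)
qed

lemma int_series_const: "int_laurent h \<Longrightarrow> int_series (\<lambda>q. h)"
  by (rule int_seriesI[OF fps_int_laurent_const]) auto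

lemma int_series_power_q: "int_series (\<lambda>q w. q ^ n)"
proof (rule int_seriesI)
  show "fps_int_laurent (\<lambda>w. fps_X ^ n)"
    unfolding fps_int_laurent_def by (auto simp: int_laurent_0 int_laurent_1)
qed (auto intro: has_fps_expansion_fps_X_power)

lemma int_series_inverse:
  assumes "int_series F" "\<And>w. w \<noteq> 0 \<Longrightarrow> F 0 w = 1" shows "int_series (\<lambda>q w. inverse (F q w))"
proof -
  obtain X where X: "fps_int_laurent X" "\<And>w. w \<noteq> 0 \<Longrightarrow> (\<lambda>q. F q w) has_fps_expansion X w"
    using assms(1) by (auto simp: int_series_def)
  have X0: "fps_nth (X w) 0 = 1" if "w \<noteq> 0" for w
    using has_fps_expansion_imp_0_eq_fps_nth_0[OF X(2)[OF that]] assms(2)[OF that] by simp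
  show ?thesis
    by (rule int_seriesI[OF fps_int_laurent_inverse[OF X(1) X0]])
       (auto intro!: has_fps_expansion_inverse X simp: X0)
qed

lemma int_series_power: "int_series F \<Longrightarrow> int_series (\<lambda>q w. F q w ^ n)"
  by (induction n) (auto intro: int_series_mult int_series_const[OF int_laurent_1])

lemma int_series_powi:
  assumes "int_series F" "\<And>w. w \<noteq> 0 \<Longrightarrow> F 0 w = 1" shows "int_series (\<lambda>q w. F q w powi n)"
proof (cases "n \<ge> 0")
  case True
  thus ?thesis using int_series_power[OF assms(1), of "nat n"] by (simp add: power_int_def)
next
  case False
  thus ?thesis using int_series_power[OF int_series_inverse[OF assms], of "nat (-n)"]
    by (simp add: power_int_def)
qed

lemma int_series_prod:
  "(\<And>i. i \<in> I \<Longrightarrow> int_series (F i)) \<Longrightarrow> int_series (\<lambda>q w. \<Prod>i\<in>I. F i q w)"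
  by (induction I rule: infinite_finite_induct)
     (auto intro: int_series_mult int_series_const[OF int_laurent_1])

lemma int_series_square_arg:
  assumes "int_series F" shows "int_series (\<lambda>q w. F (q ^ 2) (w ^ 2))"
proof -
  obtain X where X: "fps_int_laurent X" "\<And>w. w \<noteq> 0 \<Longrightarrow> (\<lambda>q. F q w) has_fps_expansion X w"
    using assms(1) by (auto simp: int_series_def)
  show ?thesis
  proof (rule int_seriesI)
    show "fps_int_laurent (\<lambda>w. X (w ^ 2) oo fps_X ^ 2)"
      unfolding fps_int_laurent_def fps_nth_compose_X_power
    proof
      fix n show "int_laurent (\<lambda>w. if 2 dvd n then fps_nth (X (w ^ 2)) (n div 2) else 0)"
        using X(1) int_laurent_square_arg[of "\<lambda>w. fps_nth (X w) (n div 2)"]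
        by (cases "2 dvd n") (auto simp: int_laurent_0 fps_int_laurent_def)
    qed
    fix w :: complex assume "w \<noteq> 0"
    hence "((\<lambda>q. F q (w ^ 2)) \<circ> (\<lambda>q. q ^ 2)) has_fps_expansion (X (w ^ 2) oo fps_X ^ 2)"
      by (intro has_fps_expansion_compose X has_fps_expansion_fps_X_power) auto
    thus "(\<lambda>q. F (q ^ 2) (w ^ 2)) has_fps_expansion (X (w ^ 2) oo fps_X ^ 2)" by (simp add: o_def)
  qed
qed

section \<open>Integrality of the product expansion\<close>

lemma qp_0_left [simp]: "qp 0 u = 1"
  by (simp add: qp_def)

text \<open>The factor with exponent N + 1 alters coefficients from N + 1 on only, so the first j
  factors determine the j-th coefficient.\<close>

lemma fps_nth_qp_partial_stable:
  fixes u :: complex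
  assumes "j \<le> N"
  shows "fps_nth (\<Prod>n<N. 1 - fps_X ^ Suc n * fps_const u) j = fps_nth (\<Prod>n<j. 1 - fps_X ^ Suc n * fps_const u) j"
  using assms
proof (induction N rule: dec_induct)
  case (step N)
  define Y where "Y = (\<Prod>n<N. 1 - fps_X ^ Suc n * fps_const u)"
  have "(\<Prod>n<Suc N. 1 - fps_X ^ Suc n * fps_const u) = Y - fps_X ^ Suc N * (Y * fps_const u)"
    by (simp add: Y_def algebra_simps)
  hence "fps_nth (\<Prod>n<Suc N. 1 - fps_X ^ Suc n * fps_const u) j = fps_nth Y j"
    using step by (simp only: fps_sub_nth fps_X_power_mult_nth) simp
  thus ?case using step by (simp add: Y_def)
qed simp

text \<open>Derivatives at 0 of a locally uniform limit are limits of derivatives, and the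
  coefficients of the partial products are eventually constant.\<close>

lemma qp_has_fps_expansion:
  "(\<lambda>q. qp q u) has_fps_expansion Abs_fps (\<lambda>j. fps_nth (\<Prod>n<j. 1 - fps_X ^ Suc n * fps_const u) j)"
proof -
  define f where "f = (\<lambda>N q. \<Prod>n<N. 1 - q ^ Suc n * u)"
  obtain r R where r: "0 < r" "r < 1" "0 < R" "(0::complex) \<in> ball 0 r" "u \<in> ball 0 R"
    using qp_uniform_pt[of 0 u] by auto
  have "uniform_limit ((\<lambda>q. (q, u)) -` (cball 0 r \<times> cball 0 R)) f (\<lambda>q. qp q u) sequentially"
    using uniform_limit_compose'[OF qp_uniform[OF r(1,2,3)], of "\<lambda>q. (q, u)"] by (simp add: f_def)
  hence ul: "uniform_limit (ball 0 r) f (\<lambda>q. qp q u) sequentially"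
    by (rule uniform_limit_on_subset) (use r in \<open>auto simp: dist_norm less_imp_le\<close>)
  have exp: "(\<lambda>q. qp q u) has_fps_expansion fps_expansion (\<lambda>q. qp q u) 0"
    by (rule analytic_at_imp_has_fps_expansion_0)
       (use qp_holomorphic_fst[of u] in \<open>auto simp: analytic_at intro!: exI[of _ "ball 0 1"]\<close>)
  have fexp: "f N has_fps_expansion (\<Prod>n<N. 1 - fps_X ^ Suc n * fps_const u)" for N
    unfolding f_def by (intro has_fps_expansion_prod has_fps_expansion_diff has_fps_expansion_mult
        has_fps_expansion_fps_X_power has_fps_expansion_const has_fps_expansion_1)
  have "fps_nth (fps_expansion (\<lambda>q. qp q u) 0) j = fps_nth (\<Prod>n<j. 1 - fps_X ^ Suc n * fps_const u) j" for j
  proof -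
    have "(\<lambda>N. (deriv ^^ j) (f N) 0) \<longlonglongrightarrow> (deriv ^^ j) (\<lambda>q. qp q u) 0"
      by (rule higher_deriv_complex_uniform_limit[OF ul])
         (use r in \<open>auto simp: f_def intro!: always_eventually holomorphic_intros\<close>)
    hence "(\<lambda>N. (deriv ^^ j) (f N) 0 / fact j) \<longlonglongrightarrow> (deriv ^^ j) (\<lambda>q. qp q u) 0 / fact j"
      by (intro tendsto_intros) auto
    hence "(\<lambda>N. fps_nth (\<Prod>n<N. 1 - fps_X ^ Suc n * fps_const u) j) \<longlonglongrightarrow> fps_nth (fps_expansion (\<lambda>q. qp q u) 0) j"
      by (simp only: fps_nth_fps_expansion[OF fexp] fps_nth_fps_expansion[OF exp])
    moreover have "eventually (\<lambda>N. fps_nth (\<Prod>n<N. 1 - fps_X ^ Suc n * fps_const u) j =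
        fps_nth (\<Prod>n<j. 1 - fps_X ^ Suc n * fps_const u) j) sequentially"
      using eventually_ge_at_top[of j] by eventually_elim (rule fps_nth_qp_partial_stable)
    hence "(\<lambda>N. fps_nth (\<Prod>n<N. 1 - fps_X ^ Suc n * fps_const u) j) \<longlonglongrightarrow>
        fps_nth (\<Prod>n<j. 1 - fps_X ^ Suc n * fps_const u) j"
      by (rule tendsto_eventually)
    ultimately show ?thesis by (rule LIMSEQ_unique)
  qed
  hence "fps_expansion (\<lambda>q. qp q u) 0 = Abs_fps (\<lambda>j. fps_nth (\<Prod>n<j. 1 - fps_X ^ Suc n * fps_const u) j)"
    by (simp add: fps_eq_iff)
  thus ?thesis using exp by simp
qed

lemma int_series_qp: "int_series (\<lambda>q w. qp q (w powi j))"
proof (rule int_seriesI[OF _ qp_has_fps_expansion])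
  have "fps_int_laurent (\<lambda>w. 1 - fps_X ^ Suc n * fps_const (w powi j))" for n
    unfolding fps_int_laurent_def
  proof
    fix i
    have "int_laurent (\<lambda>w. (if i = 0 then 1 else 0) + - (if i = Suc n then w powi j else 0))"
      by (intro int_laurent_add int_laurent_minus)
         (auto intro!: int_laurent_if int_laurent_0 int_laurent_1 int_laurent_powi)
    thus "int_laurent (\<lambda>w. fps_nth (1 - fps_X ^ Suc n * fps_const (w powi j)) i)"
      by (rule int_laurent_cong) (auto simp: fps_X_power_mult_nth simp del: power_Suc)
  qed
  hence "fps_int_laurent (\<lambda>w. \<Prod>n<i. 1 - fps_X ^ Suc n * fps_const (w powi j))" for i
    by (intro fps_int_laurent_prod)
  thus "fps_int_laurent (\<lambda>w. Abs_fps (\<lambda>i. fps_nth (\<Prod>n<i. 1 - fps_X ^ Suc n * fps_const (w powi j)) i))"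
    by (simp add: fps_int_laurent_def)
qed

text \<open>Summing over the two square roots \<open>Q\<close> of \<open>q\<close> keeps the exponents of \<open>Q\<close> that are even.\<close>

lemma int_series_even_part:
  assumes F: "int_series F" and a: "2 * a - A \<in> {0, 1}"
  obtains E where "int_series E"
    "\<And>w. w \<noteq> 0 \<Longrightarrow> eventually (\<lambda>Q. Q \<noteq> 0 \<longrightarrow>
        1/2 * (Q powi A * F Q w + (- Q) powi A * F (- Q) w) = (Q ^ 2) powi a * E (Q ^ 2) w) (nhds 0)"
proof -
  obtain X where X: "fps_int_laurent X" "\<And>w. w \<noteq> 0 \<Longrightarrow> (\<lambda>q. F q w) has_fps_expansion X w"
    using F by (auto simp: int_series_def)
  \<comment> \<open>As 2 a - A is 0 or 1, a is A/2 rounded up. The exponent A + n is even exactly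
    for n = 2 i + \<delta>, and then equals 2 (a + i).\<close>
  define \<delta> where "\<delta> = nat (2 * a - A)"
  have \<delta>: "int \<delta> = 2 * a - A" "\<delta> = 0 \<or> \<delta> = 1" using a by (auto simp: \<delta>_def)
  define Y where "Y = (\<lambda>w. Abs_fps (\<lambda>i. fps_nth (X w) (2 * i + \<delta>)))"
  define E where "E = (\<lambda>q w. eval_fps (Y w) q)"
  have key: "eventually (\<lambda>Q. Q \<noteq> 0 \<longrightarrow> (\<lambda>i. fps_nth (Y w) i * (Q ^ 2) ^ i) sums
      (Q powi (- int \<delta>) * (1/2 * (F Q w + (-1) powi A * F (- Q) w)))) (nhds 0)" if w: "w \<noteq> 0" for w
  proof -
    have cr: "fps_conv_radius (X w) > 0" and ev: "eventually (\<lambda>Q. eval_fps (X w) Q = F Q w) (nhds 0)"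
      using X(2)[OF w] by (auto simp: has_fps_expansion_def)
    have "((\<lambda>Q. - Q) \<longlongrightarrow> - 0) (nhds (0::complex))" by (intro tendsto_minus) (simp add: filterlim_ident)
    hence "eventually (\<lambda>Q. eval_fps (X w) (- Q) = F (- Q) w) (nhds 0)"
      using eventually_compose_filterlim[OF ev, of "\<lambda>Q. - Q" "nhds 0"] by simp
    moreover have "eventually (\<lambda>Q. Q \<in> eball 0 (fps_conv_radius (X w))) (nhds 0)"
      using cr by (intro eventually_nhds_in_open) (auto simp: zero_ereal_def)
    ultimately show ?thesis using ev
    proof eventually_elim
      case (elim Q)
      show ?case
      proof
        assume Q: "Q \<noteq> 0"
        have nQ: "ereal (norm Q) < fps_conv_radius (X w)" using elim(2) by (simp add: in_eball_iff)
        have s1: "(\<lambda>n. fps_nth (X w) n * Q ^ n) sums F Q w"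
          using sums_eval_fps[OF nQ] elim(3) by simp
        have s2: "(\<lambda>n. fps_nth (X w) n * (- Q) ^ n) sums F (- Q) w"
          using sums_eval_fps[of "- Q" "X w"] nQ elim(1) by simp
        have "(\<lambda>n. 1/2 * (fps_nth (X w) n * Q ^ n + (-1) powi A * (fps_nth (X w) n * (- Q) ^ n))) sums
            (1/2 * (F Q w + (-1) powi A * F (- Q) w))"
          by (intro sums_mult sums_add s1 s2)
        also have "(\<lambda>n. 1/2 * (fps_nth (X w) n * Q ^ n + (-1) powi A * (fps_nth (X w) n * (- Q) ^ n))) =
            (\<lambda>n. if even (int n + A) then fps_nth (X w) n * Q ^ n else 0)"
        proof
          fix n
          have "(-1) powi A * (- Q) ^ n = (if even (int n + A) then 1 else -1) * Q ^ n"
            by (cases "even n"; cases "even A") (auto simp: power_int_minus_left)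
          hence e: "(-1) powi A * (fps_nth (X w) n * (- Q) ^ n) =
              (if even (int n + A) then 1 else -1) * (fps_nth (X w) n * Q ^ n)"
            by (metis mult.left_commute)
          show "1/2 * (fps_nth (X w) n * Q ^ n + (-1) powi A * (fps_nth (X w) n * (- Q) ^ n)) =
              (if even (int n + A) then fps_nth (X w) n * Q ^ n else 0)"
            unfolding e by simp
        qed
        finally have "(\<lambda>n. if even (int n + A) then fps_nth (X w) n * Q ^ n else 0) sums
            (1/2 * (F Q w + (-1) powi A * F (- Q) w))" .
        also have "?this \<longleftrightarrow> (\<lambda>i. if even (int (2 * i + \<delta>) + A) then fps_nth (X w) (2 * i + \<delta>) * Q ^ (2 * i + \<delta>) else 0) sums
            (1/2 * (F Q w + (-1) powi A * F (- Q) w))"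
        proof (rule sums_mono_reindex[symmetric])
          show "strict_mono (\<lambda>i. 2 * i + \<delta>)" by (auto simp: strict_mono_def)
          fix n assume n: "n \<notin> range (\<lambda>i. 2 * i + \<delta>)"
          have "odd (int n + A)"
          proof
            assume "even (int n + A)"
            hence "even (int n + int \<delta>)" using \<delta>(1) by presburger
            hence "\<exists>i. n = 2 * i + \<delta>" using \<delta>(2) by presburger
            thus False using n by blast
          qed
          thus "(if even (int n + A) then fps_nth (X w) n * Q ^ n else 0) = 0" by simp
        qed
        also have "(\<lambda>i. if even (int (2 * i + \<delta>) + A) then fps_nth (X w) (2 * i + \<delta>) * Q ^ (2 * i + \<delta>) else 0) =
            (\<lambda>i. Q ^ \<delta> * (fps_nth (Y w) i * (Q ^ 2) ^ i))"
        proof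
          fix i
          have "even (int (2 * i + \<delta>) + A)" using \<delta>(1) by simp
          thus "(if even (int (2 * i + \<delta>) + A) then fps_nth (X w) (2 * i + \<delta>) * Q ^ (2 * i + \<delta>) else 0) =
              Q ^ \<delta> * (fps_nth (Y w) i * (Q ^ 2) ^ i)"
            by (simp add: Y_def power_add power_mult)
        qed
        finally have "(\<lambda>i. inverse (Q ^ \<delta>) * (Q ^ \<delta> * (fps_nth (Y w) i * (Q ^ 2) ^ i))) sums
            (inverse (Q ^ \<delta>) * (1/2 * (F Q w + (-1) powi A * F (- Q) w)))" by (rule sums_mult)
        thus "(\<lambda>i. fps_nth (Y w) i * (Q ^ 2) ^ i) sums
            (Q powi (- int \<delta>) * (1/2 * (F Q w + (-1) powi A * F (- Q) w)))"
          using Q by (simp add: power_int_minus mult.assoc[symmetric])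
      qed
    qed
  qed
  \<comment> \<open>Convergence at a single nonzero argument already gives a positive
    radius.\<close>
  have crY: "fps_conv_radius (Y w) > 0" if w: "w \<noteq> 0" for w
  proof -
    obtain d where d: "d > 0" "\<And>Q. dist Q 0 < d \<Longrightarrow> Q \<noteq> 0 \<Longrightarrow> summable (\<lambda>i. fps_nth (Y w) i * (Q ^ 2) ^ i)"
      using key[OF w] unfolding eventually_nhds_metric by (metis sums_summable)
    define Q where "Q = complex_of_real (d / 2)"
    have "summable (\<lambda>i. fps_nth (Y w) i * (Q ^ 2) ^ i)" using d by (intro d(2)) (auto simp: Q_def)
    hence "fps_conv_radius (Y w) \<ge> norm (Q ^ 2)"
      unfolding fps_conv_radius_def by (rule conv_radius_geI)
    moreover have "norm (Q ^ 2) > 0" using d by (simp add: Q_def norm_power)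
    ultimately show ?thesis by (meson ereal_less(2) less_le_trans)
  qed
  have "int_series E"
  proof (rule int_seriesI)
    show "fps_int_laurent Y" using X(1) by (simp add: fps_int_laurent_def Y_def)
    show "(\<lambda>q. E q w) has_fps_expansion Y w" if "w \<noteq> 0" for w
      unfolding E_def using eval_fps_has_fps_expansion[OF crY[OF that]] by simp
  qed
  moreover have "eventually (\<lambda>Q. Q \<noteq> 0 \<longrightarrow>
        1/2 * (Q powi A * F Q w + (- Q) powi A * F (- Q) w) = (Q ^ 2) powi a * E (Q ^ 2) w) (nhds 0)"
    if w: "w \<noteq> 0" for w
    using key[OF w]
  proof eventually_elim
    case (elim Q)
    show ?case
    proof
      assume Q: "Q \<noteq> 0"
      have "E (Q ^ 2) w = Q powi (- int \<delta>) * (1/2 * (F Q w + (-1) powi A * F (- Q) w))"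
        using elim Q unfolding E_def eval_fps_def by (simp add: sums_iff)
      hence "(Q ^ 2) powi a * E (Q ^ 2) w =
          ((Q ^ 2) powi a * Q powi (- int \<delta>)) * (1/2 * (F Q w + (-1) powi A * F (- Q) w))"
        by (simp add: mult_ac)
      also have "(Q ^ 2) powi a * Q powi (- int \<delta>) = Q powi A"
      proof -
        have "(Q ^ 2) powi a = Q powi (2 * a)" by (simp add: power_int_mult)
        thus ?thesis using Q \<delta>(1) by (simp add: power_int_add[symmetric])
      qed
      also have "Q powi A * (1/2 * (F Q w + (-1) powi A * F (- Q) w)) =
          1/2 * (Q powi A * F Q w + (- Q) powi A * F (- Q) w)"
      proof -
        have "(- Q) powi A = (-1) powi A * Q powi A"
          by (subst power_int_mult_distrib[symmetric]) simp
        thus ?thesis by (simp add: algebra_simps)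
      qed
      finally show "1/2 * (Q powi A * F Q w + (- Q) powi A * F (- Q) w) = (Q ^ 2) powi a * E (Q ^ 2) w" by simp
    qed
  qed
  ultimately show ?thesis using that by blast
qed


section \<open>Baby theta blocks\<close>

lemma laurent_eval_superset:
  assumes "finite S" "Poly_Mapping.keys p \<subseteq> S"
  shows "laurent_eval p w = (\<Sum>n\<in>S. Poly_Mapping.lookup p n * w powi n)"
  unfolding laurent_eval_def
  by (rule sum.mono_neutral_left) (use assms in \<open>auto simp: in_keys_iff\<close>)

lemma laurent_eval_add: "laurent_eval (p + q) w = laurent_eval p w + laurent_eval q w"
proof -
  define S where "S = Poly_Mapping.keys p \<union> Poly_Mapping.keys q"
  have "finite S" "Poly_Mapping.keys (p + q) \<subseteq> S" "Poly_Mapping.keys p \<subseteq> S" "Poly_Mapping.keys q \<subseteq> S"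
    using keys_add[of p q] by (auto simp: S_def)
  thus ?thesis by (simp add: laurent_eval_superset lookup_add distrib_right sum.distrib)
qed

lemma laurent_eval_0 [simp]: "laurent_eval 0 w = 0"
  by (simp add: laurent_eval_def)

lemma laurent_eval_single [simp]: "laurent_eval (Poly_Mapping.single n a) w = a * w powi n"
  by (simp add: laurent_eval_def)

lemma laurent_eval_sum: "laurent_eval (\<Sum>i\<in>I. p i) w = (\<Sum>i\<in>I. laurent_eval (p i) w)"
  by (induction I rule: infinite_finite_induct) (auto simp: laurent_eval_add)

lemma laurent_poly_sum_single:
  "(\<Sum>n\<in>Poly_Mapping.keys p. Poly_Mapping.single n (Poly_Mapping.lookup p n)) = (p :: laurent_poly)"
proof (rule poly_mapping_eqI)
  fix k
  have "Poly_Mapping.lookup (\<Sum>n\<in>Poly_Mapping.keys p. Poly_Mapping.single n (Poly_Mapping.lookup p n)) k =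
     (\<Sum>n\<in>Poly_Mapping.keys p. if n = k then Poly_Mapping.lookup p n else 0)"
    by (simp add: lookup_sum lookup_single when_def)
  also have "\<dots> = Poly_Mapping.lookup p k" by (simp add: in_keys_iff)
  finally show "Poly_Mapping.lookup (\<Sum>n\<in>Poly_Mapping.keys p. Poly_Mapping.single n (Poly_Mapping.lookup p n)) k =
     Poly_Mapping.lookup p k" .
qed

lemma laurent_eval_mult:
  assumes w: "w \<noteq> 0"
  shows "laurent_eval (p * q) w = laurent_eval p w * laurent_eval q w"
proof -
  have "p * q = (\<Sum>n\<in>Poly_Mapping.keys p. \<Sum>k\<in>Poly_Mapping.keys q.
      Poly_Mapping.single (n + k) (Poly_Mapping.lookup p n * Poly_Mapping.lookup q k))"
    by (subst (1 2) laurent_poly_sum_single[symmetric]) (simp add: sum_product mult_single)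
  hence "laurent_eval (p * q) w = (\<Sum>n\<in>Poly_Mapping.keys p. \<Sum>k\<in>Poly_Mapping.keys q.
      Poly_Mapping.lookup p n * Poly_Mapping.lookup q k * w powi (n + k))"
    by (simp add: laurent_eval_sum)
  also have "\<dots> = laurent_eval p w * laurent_eval q w"
    unfolding laurent_eval_def sum_product using w by (simp add: power_int_add mult_ac)
  finally show ?thesis .
qed

lemma laurent_eval_subst_square: "laurent_eval (subst_square p) w = laurent_eval p (w ^ 2)"
  unfolding subst_square_def by (simp add: laurent_eval_sum) (simp add: laurent_eval_def power_int_mult)

text \<open>The unit circle suffices: the coefficient bound with v = 0 and B = 0 makes every
  difference of coefficients vanish.\<close>

lemma laurent_poly_eqI:
  assumes "\<And>w. w \<noteq> 0 \<Longrightarrow> laurent_eval p w = laurent_eval q w"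
  shows "p = q"
proof (rule poly_mapping_eqI)
  fix r
  define S where "S = insert r (Poly_Mapping.keys p \<union> Poly_Mapping.keys q)"
  define c where "c = (\<lambda>s. Poly_Mapping.lookup p s - Poly_Mapping.lookup q s)"
  have S: "finite S" "r \<in> S" "Poly_Mapping.keys p \<subseteq> S" "Poly_Mapping.keys q \<subseteq> S" by (auto simp: S_def)
  have "norm (c r) * exp (- 2 * pi * of_int r * 0) \<le> 0"
  proof (rule laurent_coefficient_bound[OF S(1,2)])
    fix u :: real
    have "laurent_eval p (ee (Complex u 0)) = laurent_eval q (ee (Complex u 0))" by (rule assms) simp
    hence "(\<Sum>s\<in>S. c s * ee (Complex u 0) powi s) = 0"
      using S by (simp add: laurent_eval_superset c_def left_diff_distrib sum_subtractf)
    thus "norm (\<Sum>s\<in>S. c s * ee (of_int s * Complex u 0)) \<le> 0" by (simp add: ee_of_int_mult)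
  qed
  thus "Poly_Mapping.lookup p r = Poly_Mapping.lookup q r" by (simp add: c_def)
qed

definition laurent_of_poly :: "int \<Rightarrow> complex poly \<Rightarrow> laurent_poly" where
  "laurent_of_poly h p = (\<Sum>i\<le>degree p. Poly_Mapping.single (int i - h) (coeff p i))"

lemma laurent_eval_of_poly:
  "w \<noteq> 0 \<Longrightarrow> laurent_eval (laurent_of_poly h p) w = w powi (- h) * poly p w"
  unfolding laurent_of_poly_def poly_altdef
  by (simp add: laurent_eval_sum sum_distrib_left power_int_diff power_int_minus field_simps)

lemma isCont_laurent_eval: "w \<noteq> 0 \<Longrightarrow> isCont (laurent_eval p) w"
  unfolding laurent_eval_def by (intro continuous_intros) auto

section \<open>Root multiplicities and integral quotients of polynomials\<close>

lemma complex_poly_dvdI: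
  fixes p q :: "complex poly"
  assumes "p \<noteq> 0" "q \<noteq> 0" and ord: "\<And>a. order a p \<le> order a q"
  shows "p dvd q"
proof -
  have fin: "finite {z. poly p z = 0}" "finite {z. poly q z = 0}"
    using assms by (simp_all add: poly_roots_finite)
  have sub: "{z. poly p z = 0} \<subseteq> {z. poly q z = 0}"
  proof
    fix z assume "z \<in> {z. poly p z = 0}"
    hence "order z p \<noteq> 0" using assms(1) by (simp add: order_root)
    hence "order z q \<noteq> 0" using ord[of z] by simp
    thus "z \<in> {z. poly q z = 0}" using order_root by auto
  qed
  have "(\<Prod>z | poly p z = 0. [:- z, 1:] ^ order z p) dvd (\<Prod>z | poly p z = 0. [:- z, 1:] ^ order z q)"
    by (intro prod_dvd_prod le_imp_power_dvd ord)
  also have "\<dots> dvd (\<Prod>z | poly q z = 0. [:- z, 1:] ^ order z q)"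
    using fin sub by (intro prod_dvd_prod_subset)
  also have "\<dots> dvd smult (lead_coeff q) \<dots>" by (rule dvd_smult) simp
  also have "\<dots> = q" by (rule complex_poly_decompose)
  finally have "smult (lead_coeff p) (\<Prod>z | poly p z = 0. [:- z, 1:] ^ order z p) dvd q"
    using assms(1) by (simp add: smult_dvd_iff)
  thus ?thesis by (simp only: complex_poly_decompose)
qed

lemma order_prod_nonzero:
  fixes p :: "'i \<Rightarrow> complex poly"
  assumes "\<And>i. i \<in> I \<Longrightarrow> p i \<noteq> 0"
  shows "order a (\<Prod>i\<in>I. p i) = (\<Sum>i\<in>I. order a (p i))"
  using assms
proof (induction I rule: infinite_finite_induct)
  case (insert i I)
  thus ?case by (subst prod.insert, simp, simp, subst order_mult) (auto simp: prod_zero_iff)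
qed auto

lemma order_power_nonzero:
  fixes p :: "complex poly"
  assumes "p \<noteq> 0" shows "order a (p ^ n) = n * order a p"
  using order_prod_nonzero[of "{..<n}" "\<lambda>_. p" a] assms by simp

text \<open>The derivative r X^(r-1) does not vanish at a root of unity, so all roots are
  simple.\<close>

lemma order_unity_poly:
  assumes "r \<ge> 1"
  shows "order a (monom 1 r - 1 :: complex poly) = (if a ^ r = 1 then 1 else 0)"
proof (cases "a ^ r = 1")
  case False
  thus ?thesis by (simp add: order_0I poly_monom)
next
  case True
  have nz: "monom 1 r - 1 \<noteq> (0 :: complex poly)"
    using assms by (metis degree_1 degree_monom_eq eq_iff_diff_eq_0 not_one_le_zero zero_neq_one)
  have a: "a \<noteq> 0" using True assms by (metis power_0_left not_one_le_zero zero_neq_one)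
  have "order a (pderiv (monom 1 r - 1 :: complex poly)) = 0"
    by (rule order_0I) (use a assms in \<open>simp add: pderiv_diff pderiv_monom poly_monom\<close>)
  thus ?thesis using order_pderiv[OF nz, of a] True by (simp add: poly_monom)
qed

text \<open>Substituting X^2 splits X - a^2 into (X - a)(X + a). At a = 0 the order doubles, so in
  general there is only an inequality.\<close>

lemma order_pcompose_square:
  fixes p :: "complex poly"
  assumes "p \<noteq> 0"
  shows "order (a ^ 2) p \<le> order a (pcompose p (monom 1 2))"
proof -
  have nz: "pcompose p (monom 1 2) \<noteq> 0"
  proof
    assume 0: "pcompose p (monom 1 2) = 0"
    have "poly p x = 0" for x
    proof -
      obtain y where "y ^ 2 = x" using power2_csqrt by blast
      thus ?thesis using arg_cong[OF 0, of "\<lambda>r. poly r y"] by (simp add: poly_pcompose poly_monom)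
    qed
    thus False using assms poly_all_0_iff_0 by blast
  qed
  obtain r where "p = [:- (a ^ 2), 1:] ^ order (a ^ 2) p * r" using order_1[of "a ^ 2" p] by (auto elim: dvdE)
  hence "pcompose p (monom 1 2) = pcompose ([:- (a ^ 2), 1:] ^ order (a ^ 2) p) (monom 1 2) * pcompose r (monom 1 2)"
    by (metis pcompose_mult)
  also have "pcompose ([:- (a ^ 2), 1:] ^ order (a ^ 2) p) (monom 1 2) = ([:- a, 1:] * [:a, 1:]) ^ order (a ^ 2) p"
  proof -
    have "pcompose [:- (a ^ 2), 1:] (monom 1 2) = [:- a, 1:] * [:a, 1:]"
      by (simp add: pcompose_pCons monom_altdef power2_eq_square)
    moreover have "pcompose (q ^ n) (monom 1 2) = pcompose q (monom 1 2) ^ n" for q :: "complex poly" and n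
      by (induction n) (simp_all add: pcompose_1 pcompose_mult)
    ultimately show ?thesis by metis
  qed
  finally have "[:- a, 1:] ^ order (a ^ 2) p dvd pcompose p (monom 1 2)"
    by (simp only: power_mult_distrib mult.assoc) (rule dvd_triv_left)
  thus ?thesis using nz by (simp add: order_divides)
qed

lemma coeff_Ints_mult:
  "(\<And>i. coeff p i \<in> \<int>) \<Longrightarrow> (\<And>i. coeff q i \<in> \<int>) \<Longrightarrow> coeff (p * q) i \<in> (\<int> :: complex set)"
  unfolding coeff_mult by (intro Ints_sum Ints_mult)

lemma coeff_Ints_power: "(\<And>i. coeff p i \<in> \<int>) \<Longrightarrow> coeff (p ^ n) i \<in> (\<int> :: complex set)"
  by (induction n arbitrary: i) (auto intro!: coeff_Ints_mult simp: coeff_1)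

lemma coeff_Ints_prod: "(\<And>j i. j \<in> J \<Longrightarrow> coeff (p j) i \<in> \<int>) \<Longrightarrow> coeff (\<Prod>j\<in>J. p j) i \<in> (\<int> :: complex set)"
  by (induction J arbitrary: i rule: infinite_finite_induct) (auto intro!: coeff_Ints_mult simp: coeff_1)

text \<open>The coefficients of p are solved for from degree 0 upwards, and each step divides by the
  constant coefficient of d only, a unit of the integers.\<close>

lemma coeff_Ints_quotient:
  fixes p d :: "complex poly"
  assumes pd: "\<And>i. coeff (p * d) i \<in> \<int>" and d: "\<And>i. coeff d i \<in> \<int>" and d0: "coeff d 0 = 1 \<or> coeff d 0 = -1"
  shows "coeff p n \<in> \<int>"
proof (induction n rule: less_induct)
  case (less n)
  have "coeff (p * d) n = (\<Sum>i\<le>n. coeff p i * coeff d (n - i))" by (rule coeff_mult)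
  also have "\<dots> = (\<Sum>i<n. coeff p i * coeff d (n - i)) + coeff p n * coeff d 0"
    by (simp add: lessThan_Suc_atMost[symmetric])
  finally have e: "coeff p n * coeff d 0 = coeff (p * d) n - (\<Sum>i<n. coeff p i * coeff d (n - i))" by simp
  have "coeff p n * coeff d 0 \<in> \<int>" unfolding e
    by (intro Ints_diff pd Ints_sum Ints_mult d less) auto
  thus ?case using d0 by auto
qed

lemma eventually_not_in_finite:
  fixes F :: "complex set" assumes "finite F" shows "eventually (\<lambda>w. w \<notin> F) (at a)"
proof -
  have "eventually (\<lambda>w. w \<in> - (F - {a})) (nhds a)"
    by (rule eventually_nhds_in_open[OF open_Compl[OF finite_imp_closed]]) (use assms in auto)
  thus ?thesis unfolding eventually_at_filter by eventually_elim auto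
qed

lemma finite_roots_of_unity_power:
  assumes "r \<ge> 1" shows "finite {w::complex. w ^ r = 1}"
  using finite_roots_unity[of r] assms by simp

lemma half_angle_factor: "ee (of_nat r * z / 2) - ee (- (of_nat r * z / 2)) = ee (- (of_nat r * z / 2)) * (ee z ^ r - 1)"
proof -
  have "ee (- (of_nat r * z / 2)) * ee z ^ r = ee (of_nat r * z / 2)"
    by (subst ee_of_nat_mult[symmetric], subst ee_add[symmetric], rule arg_cong[of _ _ ee]) simp
  thus ?thesis by (simp add: algebra_simps)
qed

lemma half_angle_eq_iff: "ee (of_nat r * z / 2) = ee (- (of_nat r * z / 2)) \<longleftrightarrow> ee z ^ r = 1"
proof -
  have "ee (of_nat r * z / 2) = ee (- (of_nat r * z / 2)) \<longleftrightarrow>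
      ee (of_nat r * z / 2) - ee (- (of_nat r * z / 2)) = 0" by simp
  also have "\<dots> \<longleftrightarrow> ee z ^ r - 1 = 0" unfolding half_angle_factor by simp
  finally show ?thesis by simp
qed

section \<open>The baby theta block as a Laurent polynomial\<close>

context holomorphic_theta_block
begin

definition supp :: "nat set" where "supp = {r. 1 \<le> r \<and> \<phi> r \<noteq> 0}"

lemma finite_supp: "finite supp" and supp_ge_1: "r \<in> supp \<Longrightarrow> 1 \<le> r"
  using finite_subset[OF _ fin, of supp] by (auto simp: supp_def)

text \<open>Truncation by \<open>nat\<close> splits the product of the powers of X^r - 1 with
  exponents \<phi>(r) into its positive part here and its negative part in
  \<open>denom\<close>.\<close>

definition numer :: "complex poly" where
  "numer = (\<Prod>r\<in>supp. (monom 1 r - 1) ^ nat (\<phi> r))"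

definition denom :: "complex poly" where
  "denom = (\<Prod>r\<in>supp. (monom 1 r - 1) ^ nat (- \<phi> r))"

lemma poly_unity: "poly (monom 1 r - 1) w = w ^ r - (1::complex)"
  by (simp add: poly_monom)

lemma unity_nonzero: "r \<in> supp \<Longrightarrow> monom 1 r - 1 \<noteq> (0 :: complex poly)"
  using supp_ge_1[of r] by (metis degree_1 degree_monom_eq eq_iff_diff_eq_0 not_one_le_zero zero_neq_one)

lemma coeff_0_unity_powers:
  "coeff (\<Prod>r\<in>supp. (monom 1 r - 1) ^ n r) 0 = (1 :: complex) \<or> coeff (\<Prod>r\<in>supp. (monom 1 r - 1) ^ n r) 0 = (-1 :: complex)"
proof -
  have "coeff (\<Prod>r\<in>supp. (monom 1 r - 1) ^ n r) 0 = (\<Prod>r\<in>supp. (- 1 :: complex) ^ n r)"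
    unfolding poly_0_coeff_0[symmetric] poly_prod poly_power poly_unity
  proof (rule prod.cong[OF refl])
    fix r assume "r \<in> supp"
    hence "(0::complex) ^ r = 0" using supp_ge_1[of r] by (simp add: power_0_left)
    thus "(0 ^ r - 1 :: complex) ^ n r = (- 1) ^ n r" by (simp only: diff_0)
  qed
  also have "\<dots> = (-1) ^ (\<Sum>r\<in>supp. n r)" by (simp add: power_sum)
  finally show ?thesis by (metis minus_one_power_iff)
qed

lemma numer_nonzero: "numer \<noteq> 0" and denom_nonzero: "denom \<noteq> 0"
  using coeff_0_unity_powers[of "\<lambda>r. nat (\<phi> r)", folded numer_def]
    coeff_0_unity_powers[of "\<lambda>r. nat (- \<phi> r)", folded denom_def] by auto

lemma order_numer_denom: "int (order a numer) - int (order a denom) = (\<Sum>r\<in>supp. if a ^ r = 1 then \<phi> r else 0)"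
proof -
  have "int (order a numer) - int (order a denom) =
      (\<Sum>r\<in>supp. int (nat (\<phi> r) * (if a ^ r = 1 then 1 else 0)) - int (nat (- \<phi> r) * (if a ^ r = 1 then 1 else 0)))"
    unfolding numer_def denom_def using unity_nonzero supp_ge_1
    by (simp add: order_prod_nonzero order_power_nonzero order_unity_poly sum_subtractf)
  also have "\<dots> = (\<Sum>r\<in>supp. if a ^ r = 1 then \<phi> r else 0)"
    by (intro sum.cong) auto
  finally show ?thesis .
qed

lemma power_ee_eq_1_iff: "ee (of_real \<beta>) ^ r = 1 \<longleftrightarrow> annihilates 0 \<beta> r"
proof -
  have "ee (of_real \<beta>) ^ r = 1 \<longleftrightarrow> (\<exists>n::int. of_nat r * complex_of_real \<beta> = of_int n)"
    by (simp add: ee_of_nat_mult[symmetric] ee_eq_1_iff)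
  also have "\<dots> \<longleftrightarrow> (\<exists>n::int. of_nat r * \<beta> = of_int n)"
  proof (intro iff_exI)
    fix n :: int
    have "of_nat r * complex_of_real \<beta> = of_int n \<longleftrightarrow> complex_of_real (of_nat r * \<beta>) = complex_of_real (of_int n)"
      by simp
    thus "of_nat r * complex_of_real \<beta> = of_int n \<longleftrightarrow> of_nat r * \<beta> = of_int n"
      by (simp only: of_real_eq_iff)
  qed
  also have "\<dots> \<longleftrightarrow> annihilates 0 \<beta> r" by (auto simp: annihilates_def elim!: Ints_cases)
  finally show ?thesis .
qed

lemma order_numer_denom_ee: "int (order (ee (of_real \<beta>)) numer) - int (order (ee (of_real \<beta>)) denom) = vanishing_order \<phi> 0 \<beta>"
  unfolding order_numer_denom vanishing_order_def power_ee_eq_1_iff supp_def ..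

lemma vanishing_order_nonneg: "0 \<le> vanishing_order \<phi> 0 \<beta>"
  by (rule f_local[of \<i> "of_real \<beta>" 0 \<beta>]) simp_all

lemma root_of_unity_ee:
  assumes "a ^ r = 1" "r \<ge> 1" obtains \<beta> where "a = ee (of_real \<beta>)"
proof -
  have a: "a \<noteq> 0" using assms by (metis power_0_left not_one_le_zero zero_neq_one)
  define w where "w = Ln a / (2 * of_real pi * \<i>)"
  have w: "ee w = a" using a by (simp add: w_def ee_Ln)
  hence "ee (of_nat r * w) = 1" using assms by (simp add: ee_of_nat_mult)
  then obtain n :: int where "of_nat r * w = of_int n" using ee_eq_1_iff by blast
  hence "Im (of_nat r * w) = 0" by simp
  hence "Im w = 0" using assms by simp
  hence "w = of_real (Re w)" by (simp add: complex_eq_iff)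
  thus ?thesis using that w by metis
qed

text \<open>Here the holomorphy of \<open>f\<close> enters: its orders along the lines z = \<beta>
  are nonnegative, and they are the differences of the multiplicities at \<open>ee \<beta>\<close>.
  All roots of the denominator are such roots of unity.\<close>

lemma denom_dvd_numer: "denom dvd numer"
proof (rule complex_poly_dvdI[OF denom_nonzero numer_nonzero])
  fix a
  have "0 \<le> int (order a numer) - int (order a denom)"
  proof (cases "\<exists>r\<in>supp. a ^ r = 1")
    case False
    thus ?thesis unfolding order_numer_denom by (intro sum_nonneg) auto
  next
    case True
    then obtain r where r: "r \<in> supp" "a ^ r = 1" by blast
    obtain \<beta> where "a = ee (of_real \<beta>)"
      using root_of_unity_ee[OF r(2) supp_ge_1[OF r(1)]] by blast
    thus ?thesis using order_numer_denom_ee vanishing_order_nonneg by simp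
  qed
  thus "order a denom \<le> order a numer" by simp
qed

text \<open>This is the baby theta block multiplied by zeta to the power
  \<open>half_weight\<close>.\<close>

definition baby_poly :: "complex poly" where
  "baby_poly = (SOME B. numer = B * denom)"

lemma numer_eq: "numer = baby_poly * denom"
proof -
  have "\<exists>B. numer = B * denom" using denom_dvd_numer by (metis dvdE mult.commute)
  thus ?thesis unfolding baby_poly_def by (rule someI_ex)
qed

lemma baby_poly_nonzero: "baby_poly \<noteq> 0"
  using numer_eq numer_nonzero by auto

text \<open>This unit is what keeps b(zeta^2) / b(zeta) integral.\<close>

lemma coeff_0_baby_poly: "coeff baby_poly 0 = 1 \<or> coeff baby_poly 0 = -1"
proof -
  have "coeff numer 0 = coeff baby_poly 0 * coeff denom 0"
    by (subst numer_eq) (simp add: coeff_mult)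
  thus ?thesis using coeff_0_unity_powers[of "\<lambda>r. nat (\<phi> r)", folded numer_def]
    coeff_0_unity_powers[of "\<lambda>r. nat (- \<phi> r)", folded denom_def] by (auto simp: minus_equation_iff)
qed

lemma coeff_unity_Ints: "coeff (monom 1 r - 1 :: complex poly) i \<in> \<int>"
  by (simp add: coeff_1)

lemma coeff_baby_poly_Ints: "coeff baby_poly i \<in> \<int>"
proof (rule coeff_Ints_quotient)
  show "coeff (baby_poly * denom) i \<in> \<int>" for i
    unfolding numer_eq[symmetric] numer_def by (intro coeff_Ints_prod coeff_Ints_power coeff_unity_Ints)
  show "coeff denom i \<in> \<int>" for i
    unfolding denom_def by (intro coeff_Ints_prod coeff_Ints_power coeff_unity_Ints)
  show "coeff denom 0 = 1 \<or> coeff denom 0 = -1"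
    unfolding denom_def by (rule coeff_0_unity_powers)
qed

lemma order_baby_poly: "int (order (ee (of_real \<beta>)) baby_poly) = vanishing_order \<phi> 0 \<beta>"
proof -
  have "order (ee (of_real \<beta>)) numer = order (ee (of_real \<beta>)) baby_poly + order (ee (of_real \<beta>)) denom"
    by (subst numer_eq, rule order_mult) (use numer_eq numer_nonzero in auto)
  thus ?thesis using order_numer_denom_ee[of \<beta>] by simp
qed

lemma order_baby_poly_nonzero_imp:
  assumes "order a baby_poly \<noteq> 0" obtains \<beta> where "a = ee (of_real \<beta>)"
proof -
  have "order a numer = order a baby_poly + order a denom"
    by (subst numer_eq, rule order_mult) (use numer_eq numer_nonzero in auto)
  hence ne: "(\<Sum>r\<in>supp. if a ^ r = 1 then \<phi> r else 0) \<noteq> 0" using order_numer_denom[of a] assms by simp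
  have "\<exists>r\<in>supp. a ^ r = 1"
  proof (rule ccontr)
    assume "\<not> ?thesis"
    hence "(\<Sum>r\<in>supp. if a ^ r = 1 then \<phi> r else 0) = 0" by (intro sum.neutral) auto
    with ne show False ..
  qed
  then obtain r where r: "r \<in> supp" "a ^ r = 1" by blast
  show ?thesis by (rule root_of_unity_ee[OF r(2) supp_ge_1[OF r(1)]]) (rule that)
qed

lemma poly_baby_poly:
  assumes "\<And>r. r \<in> supp \<Longrightarrow> \<phi> r < 0 \<Longrightarrow> w ^ r \<noteq> 1"
  shows "poly baby_poly w = (\<Prod>r\<in>supp. (w ^ r - 1) powi \<phi> r)"
proof -
  have d: "poly denom w = (\<Prod>r\<in>supp. (w ^ r - 1) ^ nat (- \<phi> r))"
    by (simp only: denom_def poly_prod poly_power poly_unity)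
  have n: "poly numer w = (\<Prod>r\<in>supp. (w ^ r - 1) ^ nat (\<phi> r))"
    by (simp only: numer_def poly_prod poly_power poly_unity)
  have d0: "poly denom w \<noteq> 0"
    unfolding d using assms finite_supp by (auto simp: prod_zero_iff)
  have "poly baby_poly w = poly numer w / poly denom w"
    using d0 by (subst numer_eq) simp
  also have "\<dots> = (\<Prod>r\<in>supp. (w ^ r - 1) ^ nat (\<phi> r) / (w ^ r - 1) ^ nat (- \<phi> r))"
    unfolding n d by (simp add: prod_dividef)
  also have "\<dots> = (\<Prod>r\<in>supp. (w ^ r - 1) powi \<phi> r)"
    by (intro prod.cong) (auto simp: power_int_def field_simps)
  finally show ?thesis .
qed

definition weight_sum :: int where "weight_sum = (\<Sum>r\<in>supp. int r * \<phi> r)"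

text \<open>Under z + 1 the function \<open>f\<close> is invariant while \<open>theta_r r\<close>
  changes by (-1)^r. Comparing at a point where nothing vanishes makes the total sign 1, so b has
  integral exponents in zeta.\<close>

lemma even_weight_sum: "even weight_sum"
proof -
  have i: "0 < Im \<i>" by simp
  have z: "(0::complex) = of_real 0 * \<i> + of_real 0" by simp
  obtain U where U: "eventually (\<lambda>p. torsion_line 0 0 p \<noteq> 0 \<longrightarrow>
        (\<forall>r\<ge>1. \<phi> r \<noteq> 0 \<longrightarrow> theta_r r (fst p) (snd p) \<noteq> 0) \<and>
        theta_block \<phi> (fst p) (snd p) = torsion_line 0 0 p powi vanishing_order \<phi> 0 0 * U p) (nhds (\<i>, 0))"
    using theta_block_local[OF fin i z] by blast
  have "eventually (\<lambda>w. f \<i> w \<noteq> 0 \<and> (\<forall>r\<ge>1. \<phi> r \<noteq> 0 \<longrightarrow> theta_r r \<i> w \<noteq> 0)) (at 0)"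
    using eventually_line[OF U] f_nonzero_near[OF i, of 0] eventually_unit_line[OF tl_line, of 0 0 \<i> 0]
    by eventually_elim auto
  moreover have "at (0::complex) \<noteq> bot" by simp
  ultimately obtain w where w: "f \<i> w \<noteq> 0" "\<And>r. r \<ge> 1 \<Longrightarrow> \<phi> r \<noteq> 0 \<Longrightarrow> theta_r r \<i> w \<noteq> 0"
    using eventually_happens by blast
  have th: "theta_r r \<i> (w + 1) = (-1) powi (int r) * theta_r r \<i> w" for r
    using theta_add_int[of \<i> "of_nat r * w" "int r"] by (simp add: theta_r_def algebra_simps)
  have "f \<i> (w + 1) = f \<i> w" using f_elliptic[OF i, of w 0 1] by simp
  moreover have "f \<i> w = theta_block \<phi> \<i> w" using w by (intro block) auto
  moreover have "f \<i> (w + 1) = theta_block \<phi> \<i> (w + 1)" using w by (intro block) (auto simp: th)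
  moreover have "theta_block \<phi> \<i> (w + 1) = (-1) powi weight_sum * theta_block \<phi> \<i> w"
  proof -
    have "(\<Prod>r\<in>supp. (theta_r r \<i> (w + 1) / eta \<i>) powi \<phi> r) =
       (\<Prod>r\<in>supp. (-1) powi (int r * \<phi> r) * (theta_r r \<i> w / eta \<i>) powi \<phi> r)"
    proof (rule prod.cong[OF refl])
      fix r
      have "theta_r r \<i> (w + 1) / eta \<i> = (-1) powi (int r) * (theta_r r \<i> w / eta \<i>)" by (simp add: th)
      thus "(theta_r r \<i> (w + 1) / eta \<i>) powi \<phi> r = (-1) powi (int r * \<phi> r) * (theta_r r \<i> w / eta \<i>) powi \<phi> r"
        by (simp only: power_int_mult_distrib power_int_mult)
    qed
    also have "\<dots> = (-1) powi weight_sum * (\<Prod>r\<in>supp. (theta_r r \<i> w / eta \<i>) powi \<phi> r)"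
      unfolding weight_sum_def by (subst powi_sum) (simp_all add: prod.distrib)
    finally show ?thesis unfolding theta_block_def supp_def[symmetric] by simp
  qed
  ultimately have "(-1::complex) powi weight_sum = 1" using w(1) by simp
  thus ?thesis by (cases "even weight_sum") (auto simp: power_int_minus_left)
qed

definition half_weight :: int where "half_weight = weight_sum div 2"

definition baby_fun :: "complex \<Rightarrow> complex" where
  "baby_fun w = w powi (- half_weight) * poly baby_poly w"

lemma baby_theta_eq:
  assumes "\<And>r. r \<in> supp \<Longrightarrow> \<phi> r < 0 \<Longrightarrow> ee z ^ r \<noteq> 1"
  shows "baby_theta \<phi> z = baby_fun (ee z)"
proof -
  have "baby_theta \<phi> z = (\<Prod>r\<in>supp. (ee (- (of_nat r * z / 2)) * (ee z ^ r - 1)) powi \<phi> r)"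
    unfolding baby_theta_def supp_def[symmetric] half_angle_factor ..
  also have "\<dots> = (\<Prod>r\<in>supp. ee (- z / 2) powi (int r * \<phi> r)) * (\<Prod>r\<in>supp. (ee z ^ r - 1) powi \<phi> r)"
    unfolding prod.distrib[symmetric]
  proof (rule prod.cong[OF refl])
    fix r
    have "ee (- (of_nat r * z / 2)) = ee (- z / 2) powi int r"
      by (subst ee_of_int_mult[symmetric]) (simp add: field_simps)
    thus "(ee (- (of_nat r * z / 2)) * (ee z ^ r - 1)) powi \<phi> r =
        ee (- z / 2) powi (int r * \<phi> r) * (ee z ^ r - 1) powi \<phi> r"
      by (simp only: power_int_mult_distrib power_int_mult)
  qed
  also have "(\<Prod>r\<in>supp. ee (- z / 2) powi (int r * \<phi> r)) = ee (- z / 2) powi weight_sum"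
    unfolding weight_sum_def by (subst powi_sum) simp_all
  also have "\<dots> = ee z powi (- half_weight)"
  proof -
    have "weight_sum = 2 * half_weight" using even_weight_sum by (simp add: half_weight_def)
    hence "of_int weight_sum * (- z / 2) = of_int (- half_weight) * z" by simp
    thus ?thesis by (metis ee_of_int_mult)
  qed
  also have "(\<Prod>r\<in>supp. (ee z ^ r - 1) powi \<phi> r) = poly baby_poly (ee z)"
    by (rule poly_baby_poly[symmetric]) (use assms in auto)
  finally show ?thesis by (simp add: baby_fun_def)
qed

lemma is_baby_theta_laurent: "is_baby_theta (laurent_of_poly half_weight baby_poly) \<phi>"
  unfolding is_baby_theta_def
proof (intro allI impI)
  fix z assume z: "\<forall>r\<ge>1. \<phi> r < 0 \<longrightarrow> ee (of_nat r * z / 2) \<noteq> ee (- (of_nat r * z / 2))"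
  have "baby_theta \<phi> z = baby_fun (ee z)"
    by (rule baby_theta_eq) (use z half_angle_eq_iff supp_ge_1 in auto)
  thus "laurent_eval (laurent_of_poly half_weight baby_poly) (ee z) = baby_theta \<phi> z"
    by (simp add: laurent_eval_of_poly baby_fun_def)
qed

lemma eventually_generic: "eventually (\<lambda>w::complex. w \<noteq> 0 \<and> (\<forall>r\<in>supp. w ^ r \<noteq> 1)) (at a)"
proof -
  have "finite ({0} \<union> (\<Union>r\<in>supp. {w::complex. w ^ r = 1}))"
    using finite_supp supp_ge_1 by (auto intro!: finite_UN_I finite_roots_of_unity_power)
  from eventually_not_in_finite[OF this, of a] show ?thesis by eventually_elim auto
qed

lemma is_baby_theta_eval:
  assumes "is_baby_theta b \<phi>" "w \<noteq> 0" "\<And>r. r \<in> supp \<Longrightarrow> w ^ r \<noteq> 1"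
  shows "laurent_eval b w = baby_fun w"
proof -
  define z where "z = Ln w / (2 * of_real pi * \<i>)"
  have z: "ee z = w" using assms by (simp add: z_def ee_Ln)
  have "laurent_eval b (ee z) = baby_theta \<phi> z"
  proof -
    have "\<forall>r\<ge>1. \<phi> r < 0 \<longrightarrow> ee z ^ r \<noteq> 1" using assms(3) z by (auto simp: supp_def)
    thus ?thesis using assms(1) unfolding is_baby_theta_def half_angle_eq_iff by blast
  qed
  thus ?thesis using baby_theta_eq[of z] assms(3) z by simp
qed

text \<open>At a = e(1/(2r)) the order of b(zeta) is \<open>zero_mult \<phi> (2 * r)\<close>; that
  of b(zeta^2) is the order of b at a^2 = e(1/r), namely \<open>zero_mult \<phi> r\<close>.
  Divisibility orders the two.\<close>

lemma baby_dvd_imp_mono: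
  assumes b: "is_baby_theta b \<phi>" "b dvd subst_square b" and r: "r \<ge> 1"
  shows "zero_mult \<phi> (2 * r) \<le> zero_mult \<phi> r"
proof -
  obtain p where p: "subst_square b = b * p" using b(2) by (auto elim: dvdE)
  define \<beta> where "\<beta> = (1 / of_nat (2 * r) :: real)"
  define a where "a = ee (of_real \<beta>)"
  have r2: "2 * r \<ge> 1" using r by simp
  have \<beta>2: "2 * \<beta> = 1 / of_nat r" by (simp add: \<beta>_def)
  have a2: "a ^ 2 = ee (of_real (2 * \<beta>))" using ee_of_nat_mult[of 2 "of_real \<beta>"] by (simp add: a_def)
  define n where "n = order a baby_poly"
  define n' where "n' = order (a ^ 2) baby_poly"
  have n: "int n = zero_mult \<phi> (2 * r)"
    unfolding n_def a_def order_baby_poly using vanishing_order_inverse[OF r2] by (simp add: \<beta>_def)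
  have n': "int n' = zero_mult \<phi> r"
    unfolding n'_def a2 order_baby_poly \<beta>2 by (rule vanishing_order_inverse[OF r])
  obtain R where R: "baby_poly = [:- a, 1:] ^ n * R"
    using order_1[of a baby_poly] by (auto simp: n_def elim: dvdE)
  \<comment> \<open>The exact order matters here: R' must not vanish at a^2, so that b(w^2) has
    order no larger than n' at a.\<close>
  obtain R' where R': "baby_poly = [:- (a ^ 2), 1:] ^ n' * R'" "\<not> [:- (a ^ 2), 1:] dvd R'"
    using order_decomp[OF baby_poly_nonzero, of "a ^ 2"] by (auto simp: n'_def)
  have a0: "a \<noteq> 0" by (simp add: a_def)
  \<comment> \<open>Both w and w^2 must avoid the roots of unity belonging to the support, where
    \<open>is_baby_theta_eval\<close> is silent. Near a the square differs from a^2 except at a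
    itself, so genericity near a^2 pulls back.\<close>
  have "((\<lambda>w::complex. w ^ 2) \<longlongrightarrow> a ^ 2) (at a)" by (intro tendsto_intros)
  moreover have "eventually (\<lambda>w. w \<in> - {- a}) (nhds a)"
    by (rule eventually_nhds_in_open) (use a0 in auto)
  hence "eventually (\<lambda>w. w \<noteq> - a \<and> w \<noteq> a) (at a)"
    unfolding eventually_at_filter by eventually_elim auto
  hence "eventually (\<lambda>w. w ^ 2 \<noteq> a ^ 2) (at a)" by eventually_elim (auto simp: power2_eq_iff)
  ultimately have "filterlim (\<lambda>w. w ^ 2) (at (a ^ 2)) (at a)" by (simp add: filterlim_at)
  from eventually_compose_filterlim[OF eventually_generic this]
  have sq: "eventually (\<lambda>w. w ^ 2 \<noteq> 0 \<and> (\<forall>r\<in>supp. (w ^ 2) ^ r \<noteq> 1)) (at a)" .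
  have "eventually (\<lambda>w. (w - a) powi int n * (w powi (- half_weight) * poly R w * laurent_eval p w) =
      (w - a) powi int n' * ((w ^ 2) powi (- half_weight) * (w + a) ^ n' * poly R' (w ^ 2))) (at a)"
    using eventually_generic[of a] sq
  proof eventually_elim
    case (elim w)
    have "baby_fun (w ^ 2) = laurent_eval b (w ^ 2)" using elim is_baby_theta_eval[OF b(1), of "w ^ 2"] by auto
    also have "\<dots> = laurent_eval b w * laurent_eval p w"
      using elim by (simp add: laurent_eval_subst_square[symmetric] p laurent_eval_mult)
    also have "laurent_eval b w = baby_fun w" using elim is_baby_theta_eval[OF b(1), of w] by auto
    finally have e: "baby_fun (w ^ 2) = baby_fun w * laurent_eval p w" .
    have f1: "baby_fun w = w powi (- half_weight) * ((w - a) ^ n * poly R w)"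
      by (subst baby_fun_def, subst R) (simp add: poly_power)
    have "(w ^ 2 - a ^ 2) ^ n' = (w - a) ^ n' * (w + a) ^ n'"
      by (simp add: power_mult_distrib[symmetric] power2_eq_square algebra_simps)
    hence f2: "baby_fun (w ^ 2) = (w ^ 2) powi (- half_weight) * ((w - a) ^ n' * (w + a) ^ n' * poly R' (w ^ 2))"
      by (subst baby_fun_def, subst R'(1)) (simp add: poly_power)
    show ?case using e unfolding f1 f2 by (simp add: mult_ac)
  qed
  hence "int n \<le> int n'"
  proof (rule order_le)
    show "isCont (\<lambda>w. w powi (- half_weight) * poly R w * laurent_eval p w) a"
      using a0 isCont_laurent_eval[OF a0] by (intro continuous_intros) auto
    show "isCont (\<lambda>w. (w ^ 2) powi (- half_weight) * (w + a) ^ n' * poly R' (w ^ 2)) a"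
      using a0 by (intro continuous_intros) auto
    have "poly R' (a ^ 2) \<noteq> 0" using R'(2) by (simp add: poly_eq_0_iff_dvd)
    thus "(a ^ 2) powi (- half_weight) * (a + a) ^ n' * poly R' (a ^ 2) \<noteq> 0" using a0 by simp
  qed
  thus ?thesis using n n' by simp
qed

text \<open>All roots of \<open>baby_poly\<close> are of the form \<open>ee \<beta>\<close>. By
  monotonicity the order there is at most that at the square of the root, which in turn bounds the
  order of b(zeta^2) from below.\<close>

lemma baby_square_quotient:
  assumes mono: "\<And>t. t \<ge> 1 \<Longrightarrow> zero_mult \<phi> (2 * t) \<le> zero_mult \<phi> t"
  obtains C where "pcompose baby_poly (monom 1 2) = C * baby_poly" "\<And>i. coeff C i \<in> \<int>"
proof -
  define B2 where "B2 = pcompose baby_poly (monom 1 2)"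
  have B20: "poly B2 0 = poly baby_poly 0" by (simp add: B2_def poly_pcompose poly_monom)
  have b0: "poly baby_poly 0 \<noteq> 0" using coeff_0_baby_poly by (auto simp: poly_0_coeff_0)
  hence B2nz: "B2 \<noteq> 0" using B20 by auto
  have "baby_poly dvd B2"
  proof (rule complex_poly_dvdI[OF baby_poly_nonzero B2nz])
    fix a
    show "order a baby_poly \<le> order a B2"
    proof (cases "order a baby_poly = 0")
      case False
      then obtain \<beta> where a: "a = ee (of_real \<beta>)" by (rule order_baby_poly_nonzero_imp)
      have a2: "a ^ 2 = ee (of_real (2 * \<beta>))" using ee_of_nat_mult[of 2 "of_real \<beta>"] by (simp add: a)
      have "vanishing_order \<phi> 0 \<beta> \<le> vanishing_order \<phi> 0 (2 * \<beta>)"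
        by (rule vanishing_order_mono[OF mono annihilates_double(1) annihilates_half(1)])
      hence "order a baby_poly \<le> order (a ^ 2) baby_poly"
        using order_baby_poly[of \<beta>] order_baby_poly[of "2 * \<beta>"] unfolding a2 by (simp add: a)
      also have "\<dots> \<le> order a B2" unfolding B2_def by (rule order_pcompose_square[OF baby_poly_nonzero])
      finally show ?thesis .
    qed simp
  qed
  then obtain C where C: "B2 = C * baby_poly" by (metis dvdE mult.commute)
  have "coeff C i \<in> \<int>" for i
  proof (rule coeff_Ints_quotient[OF _ coeff_baby_poly_Ints coeff_0_baby_poly])
    fix i
    have "pcompose p (monom 1 2) = (\<Sum>j\<le>degree p. monom (coeff p j) (2 * j))" for p :: "complex poly"
    proof -
      have "pcompose p (monom 1 2) = pcompose (\<Sum>j\<le>degree p. monom (coeff p j) j) (monom 1 2)"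
        by (simp add: poly_as_sum_of_monoms)
      also have "\<dots> = (\<Sum>j\<le>degree p. monom (coeff p j) (2 * j))"
        unfolding pcompose_sum
      proof (rule sum.cong[OF refl])
        fix j
        have "poly (pcompose (monom (coeff p j) j) (monom 1 2)) = poly (monom (coeff p j) (2 * j))"
          by (simp add: fun_eq_iff poly_pcompose poly_monom power_mult)
        thus "pcompose (monom (coeff p j) j) (monom 1 2) = monom (coeff p j) (2 * j)"
          by (simp only: poly_eq_poly_eq_iff)
      qed
      finally show ?thesis .
    qed
    hence "coeff B2 i = (\<Sum>j\<le>degree baby_poly. if 2 * j = i then coeff baby_poly j else 0)"
      by (simp add: B2_def coeff_sum)
    also have "\<dots> \<in> \<int>" by (intro Ints_sum) (auto simp: coeff_baby_poly_Ints)
    finally show "coeff (C * baby_poly) i \<in> \<int>" by (simp add: C)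
  qed
  thus ?thesis using that C unfolding B2_def by blast
qed

end


section \<open>Expansion at the cusp\<close>

lemma qp_nonzero:
  assumes "norm q < 1" "norm (q * u) < 1" shows "qp q u \<noteq> 0"
proof
  assume "qp q u = 0"
  then obtain n where "q ^ n * (q * u) = 1" using qp_eq_0_iff[OF assms(1)] by (auto simp: mult_ac)
  hence "norm q ^ n * norm (q * u) = 1" by (metis norm_mult norm_one norm_power)
  moreover have "norm q ^ n * norm (q * u) \<le> 1 * norm (q * u)"
    using assms(1) by (intro mult_right_mono power_le_one) auto
  ultimately show False using assms(2) by simp
qed

lemma cdiff2_field_differentiable_fst:
  assumes "cdiff2 F (\<tau>, z)" shows "(\<lambda>\<tau>. F (\<tau>, z)) field_differentiable (at \<tau>)"
proof -
  obtain a b where F: "(F has_derivative (\<lambda>h. a * fst h + b * snd h)) (at (\<tau>, z))"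
    using assms by (auto simp: cdiff2_def)
  have "((\<lambda>\<tau>. (\<tau>, z)) has_derivative (\<lambda>h. (h, 0))) (at \<tau>)"
    by (auto intro!: derivative_eq_intros)
  from has_derivative_compose[OF this F] show ?thesis
    by (auto simp: field_differentiable_def has_field_derivative_def)
qed

lemma norm_ee_powi: "norm (ee \<tau> * ee z powi j) < 1 \<longleftrightarrow> 0 < Im \<tau> + of_int j * Im z"
  unfolding ee_of_int_mult[symmetric] ee_add[symmetric] norm_ee by (auto simp: zero_less_mult_iff mult_less_0_iff)

context holomorphic_theta_block
begin

text \<open>The series P of the expansion. Taking the two products for r and - r together gives both
  signs the same exponent \<phi>(|r|).\<close>

definition tail :: "complex \<Rightarrow> complex \<Rightarrow> complex" where
  "tail q w = qp q 1 powi \<phi> 0 * (\<Prod>r\<in>supp. (qp q (w powi int r) * qp q (w powi (- int r))) powi \<phi> r)"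

lemma int_series_tail: "int_series tail" and tail_0: "tail 0 w = 1"
proof -
  have "int_series (\<lambda>q w. qp q (w powi 0) powi \<phi> 0 * (\<Prod>r\<in>supp. (qp q (w powi int r) * qp q (w powi (- int r))) powi \<phi> r))"
    by (intro int_series_mult int_series_prod int_series_powi int_series_qp) auto
  moreover have "(\<lambda>q w. qp q (w powi 0) powi \<phi> 0 * (\<Prod>r\<in>supp. (qp q (w powi int r) * qp q (w powi (- int r))) powi \<phi> r)) = tail"
    by (simp add: tail_def fun_eq_iff)
  ultimately show "int_series tail" by simp
  show "tail 0 w = 1" by (simp add: tail_def)
qed

text \<open>Each quotient of theta by eta contributes q^(1/8 - 1/24) = q^(2/24), so
  \<open>\<phi> 0\<close> plus twice the sum of the other exponents is 24 A. Powers of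
  \<open>ee (\<tau> / 24)\<close> keep all exponents integral.\<close>

lemma theta_block_eq:
  assumes A: "q_order \<phi> = of_int A" and \<tau>: "0 < Im \<tau>"
  shows "theta_block \<phi> \<tau> z = ee \<tau> powi A * baby_theta \<phi> z * tail (ee \<tau>) (ee z)"
proof -
  define q where "q = ee \<tau>"
  have q1: "qp q 1 \<noteq> 0" using \<tau> by (simp add: q_def qp_1_nonzero)
  have th: "theta_r r \<tau> z / eta \<tau> = ee (\<tau> / 24) powi 2 * ((ee (of_nat r * z / 2) - ee (- (of_nat r * z / 2))) *
      (qp q (ee z powi int r) * qp q (ee z powi (- int r))))" for r
  proof -
    have "ee (of_nat r * z) = ee z powi int r" "ee (- (of_nat r * z)) = ee z powi (- int r)"
      using ee_of_int_mult[of "int r" z] ee_of_int_mult[of "- int r" z] by simp_all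
    moreover have "ee (\<tau> / 8) = ee (\<tau> / 24) powi 2 * ee (\<tau> / 24)"
      by (subst ee_of_int_mult[symmetric], subst ee_add[symmetric]) simp
    ultimately show ?thesis using q1 \<tau>
      unfolding theta_r_def theta_qp[OF \<tau>] eta_qp[OF \<tau>] q_def[symmetric] by (simp add: field_simps)
  qed
  have 24: "\<phi> 0 + 2 * (\<Sum>r\<in>supp. \<phi> r) = 24 * A"
  proof -
    have "of_int (\<phi> 0 + 2 * (\<Sum>r\<in>supp. \<phi> r)) = (of_int (24 * A) :: rat)"
      using A unfolding q_order_def supp_def[symmetric] by (simp add: field_simps)
    thus ?thesis by (simp only: of_int_eq_iff)
  qed
  have eta0: "eta \<tau> powi \<phi> 0 = ee (\<tau> / 24) powi \<phi> 0 * qp q 1 powi \<phi> 0"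
    by (simp add: eta_qp[OF \<tau>] q_def power_int_mult_distrib)
  have "theta_block \<phi> \<tau> z = (ee (\<tau> / 24) powi \<phi> 0 * qp q 1 powi \<phi> 0) *
      (\<Prod>r\<in>supp. ee (\<tau> / 24) powi (2 * \<phi> r) * ((ee (of_nat r * z / 2) - ee (- (of_nat r * z / 2))) powi \<phi> r *
      (qp q (ee z powi int r) * qp q (ee z powi (- int r))) powi \<phi> r))"
    unfolding theta_block_def supp_def[symmetric] th eta0
    by (simp only: power_int_mult_distrib power_int_mult)
  also have "\<dots> = (ee (\<tau> / 24) powi \<phi> 0 * ee (\<tau> / 24) powi (\<Sum>r\<in>supp. 2 * \<phi> r)) * baby_theta \<phi> z * tail q (ee z)"
    unfolding baby_theta_def tail_def supp_def[symmetric] prod.distrib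
    by (subst powi_sum) (simp_all add: mult_ac)
  also have "ee (\<tau> / 24) powi \<phi> 0 * ee (\<tau> / 24) powi (\<Sum>r\<in>supp. 2 * \<phi> r) = ee (\<tau> / 24) powi (24 * A)"
    by (subst power_int_add[symmetric]) (simp_all add: 24[symmetric] sum_distrib_left)
  also have "\<dots> = q powi A"
    unfolding q_def ee_of_int_mult[symmetric] by (rule arg_cong[of _ _ ee]) simp
  finally show ?thesis by (simp add: q_def)
qed

text \<open>In this region no factor of \<open>tail\<close> vanishes.\<close>

definition near_cusp :: "complex \<Rightarrow> complex \<Rightarrow> bool" where
  "near_cusp \<tau> z \<longleftrightarrow> 0 < Im \<tau> \<and> (\<forall>r\<in>supp. of_nat r * \<bar>Im z\<bar> < Im \<tau>)"

lemma unit_at_tail: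
  assumes "hol_at F p" "hol_at G p" and cusp: "near_cusp (F p) (G p)"
  shows "unit_at (\<lambda>p. tail (ee (F p)) (ee (G p))) p"
proof -
  have im: "0 < Im (F p)" using cusp by (simp add: near_cusp_def)
  have u: "unit_at (\<lambda>p. qp (ee (F p)) (ee (G p) powi j)) p" if "norm (ee (F p) * ee (G p) powi j) < 1" for j
    unfolding unit_at_def
  proof
    show "hol_at (\<lambda>p. qp (ee (F p)) (ee (G p) powi j)) p"
      unfolding ee_of_int_mult[symmetric] by (intro hol_at_qp hol_at_intros assms norm_ee_less_1 im)
    show "qp (ee (F p)) (ee (G p) powi j) \<noteq> 0" by (rule qp_nonzero) (use that im in auto)
  qed
  have b: "norm (ee (F p) * ee (G p) powi int r) < 1" "norm (ee (F p) * ee (G p) powi (- int r)) < 1" if "r \<in> supp" for r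
  proof -
    have "\<bar>of_nat r * Im (G p)\<bar> < Im (F p)" using cusp that by (auto simp: near_cusp_def abs_mult)
    thus "norm (ee (F p) * ee (G p) powi int r) < 1" "norm (ee (F p) * ee (G p) powi (- int r)) < 1"
      unfolding norm_ee_powi by auto
  qed
  have "unit_at (\<lambda>p. qp (ee (F p)) 1) p" using u[of 0] im by simp
  thus ?thesis unfolding tail_def
    by (intro unit_at_mult unit_at_powi unit_at_prod u b)
qed

lemma isCont_tail:
  assumes "near_cusp (c * \<tau> + d) (e * z)"
  shows "isCont (\<lambda>w. tail (ee (c * \<tau> + d)) (ee (e * w))) z" "tail (ee (c * \<tau> + d)) (ee (e * z)) \<noteq> 0"
proof -
  have "unit_at (\<lambda>p. tail (ee (c * fst p + d)) (ee (e * snd p))) (\<tau>, z)"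
    by (rule unit_at_tail) (use assms in \<open>auto intro!: hol_at_intros\<close>)
  from unit_at_line[OF this] show "isCont (\<lambda>w. tail (ee (c * \<tau> + d)) (ee (e * w))) z"
    "tail (ee (c * \<tau> + d)) (ee (e * z)) \<noteq> 0" by simp_all
qed

lemma isCont_ee_comp: "isCont h z \<Longrightarrow> isCont (\<lambda>w. ee (h w)) z"
  by (rule isCont_o2[of z h ee]) (auto intro: DERIV_isCont[OF ee_has_field_derivative])

text \<open>The product formula is available where no theta function vanishes; both sides are
  continuous near the cusp, so it persists at the remaining z.\<close>

lemma f_expansion:
  assumes A: "q_order \<phi> = of_int A" and cusp: "near_cusp \<tau> z"
  shows "f \<tau> z = ee \<tau> powi A * baby_fun (ee z) * tail (ee \<tau>) (ee z)"
proof -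
  have \<tau>: "0 < Im \<tau>" using cusp by (simp add: near_cusp_def)
  show ?thesis
  proof (rule eq_by_density[where u = "f \<tau>" and z = z and v = "\<lambda>z. ee \<tau> powi A * baby_fun (ee z) * tail (ee \<tau>) (ee z)"])
    show "isCont (f \<tau>) z" using isCont_line[OF hol_at_isCont[OF hol_at_f[OF \<tau>]]] by simp
    have "isCont (\<lambda>w. baby_fun (ee w)) z"
      unfolding baby_fun_def by (intro continuous_intros isCont_ee_comp) auto
    moreover have "isCont (\<lambda>w. tail (ee \<tau>) (ee w)) z"
      using isCont_tail(1)[of 1 \<tau> 0 1 z] cusp by simp
    ultimately show "isCont (\<lambda>z. ee \<tau> powi A * baby_fun (ee z) * tail (ee \<tau>) (ee z)) z"
      by (intro continuous_intros)
    obtain \<alpha> \<beta> where z: "z = of_real \<alpha> * \<tau> + of_real \<beta>" using real_coordinates[OF \<tau>] by blast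
    obtain U where U: "eventually (\<lambda>p. torsion_line \<alpha> \<beta> p \<noteq> 0 \<longrightarrow>
        (\<forall>r\<ge>1. \<phi> r \<noteq> 0 \<longrightarrow> theta_r r (fst p) (snd p) \<noteq> 0) \<and>
        theta_block \<phi> (fst p) (snd p) = torsion_line \<alpha> \<beta> p powi vanishing_order \<phi> \<alpha> \<beta> * U p) (nhds (\<tau>, z))"
      using theta_block_local[OF fin \<tau> z] by blast
    show "eventually (\<lambda>w. f \<tau> w = ee \<tau> powi A * baby_fun (ee w) * tail (ee \<tau>) (ee w)) (at z)"
      using eventually_line[OF U] eventually_unit_line[OF tl_line, of \<alpha> \<beta> \<tau> z]
    proof eventually_elim
      case (elim w)
      hence nz: "theta_r r \<tau> w \<noteq> 0" if "r \<ge> 1" "\<phi> r \<noteq> 0" for r using that by simp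
      have "f \<tau> w = theta_block \<phi> \<tau> w" using nz \<tau> by (intro block) auto
      also have "\<dots> = ee \<tau> powi A * baby_theta \<phi> w * tail (ee \<tau>) (ee w)" by (rule theta_block_eq[OF A \<tau>])
      also have "baby_theta \<phi> w = baby_fun (ee w)"
      proof (rule baby_theta_eq)
        fix r assume "r \<in> supp"
        hence "theta \<tau> (of_nat r * w) \<noteq> 0" using nz[of r] by (simp add: supp_def theta_r_def)
        hence "ee (of_nat r * w / 2) \<noteq> ee (- (of_nat r * w / 2))" by (auto simp: theta_qp[OF \<tau>])
        thus "ee w ^ r \<noteq> 1" by (simp add: half_angle_eq_iff)
      qed
      finally show ?case .
    qed
  qed
qed

section \<open>The quotient for large Im \<tau>\<close>

lemma near_cusp_half:
  assumes "near_cusp (\<tau> / 2) z"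
  shows "near_cusp \<tau> z" "near_cusp (2 * \<tau>) (2 * z)" "near_cusp (\<tau> / 2 + 1 / 2) z"
  using assms by (auto simp: near_cusp_def abs_mult)

lemma eventually_near_cusp:
  assumes "near_cusp \<tau> z" shows "eventually (near_cusp \<tau>) (at z)"
proof -
  have "eventually (\<lambda>w. \<forall>r\<in>supp. of_nat r * \<bar>Im w\<bar> < Im \<tau>) (at z)"
  proof (intro eventually_ball_finite finite_supp ballI)
    fix r assume "r \<in> supp"
    have "((\<lambda>w. of_nat r * \<bar>Im w\<bar>) \<longlongrightarrow> of_nat r * \<bar>Im z\<bar>) (at z)" by (intro tendsto_intros)
    thus "eventually (\<lambda>w. of_nat r * \<bar>Im w\<bar> < Im \<tau>) (at z)"
      by (rule order_tendstoD) (use assms \<open>r \<in> supp\<close> in \<open>auto simp: near_cusp_def\<close>)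
  qed
  thus ?thesis using assms by (auto simp: near_cusp_def elim!: eventually_mono)
qed

lemma ee_double: "ee (2 * z) = ee z ^ 2" and ee_half_square: "ee (\<tau> / 2) ^ 2 = ee \<tau>"
  using ee_of_nat_mult[of 2 z] ee_of_nat_mult[of 2 "\<tau> / 2"] by simp_all

lemma ee_half_shift: "ee (\<tau> / 2 + 1 / 2) = - ee (\<tau> / 2)"
  by (simp only: ee_add ee_half) simp

text \<open>b(zeta) is a common factor and cancels: the terms at \<tau>/2 and (\<tau> + 1)/2 contain
  it because z is unchanged, the doubled term because b(zeta^2) = c(zeta) b(zeta). The region is
  stated for \<tau>/2, the strictest of the arguments.\<close>

lemma quotient_near_cusp:
  assumes A: "q_order \<phi> = of_int A"
    and C: "pcompose baby_poly (monom 1 2) = C * baby_poly"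
    and hol: "\<And>\<tau> z. 0 < Im \<tau> \<Longrightarrow> hol_at (\<lambda>p. g (fst p) (snd p)) (\<tau>, z)"
    and quot: "\<And>\<tau> z. 0 < Im \<tau> \<Longrightarrow> f \<tau> z \<noteq> 0 \<Longrightarrow> g \<tau> z = hecke_V2 k f \<tau> z / f \<tau> z"
    and cusp: "near_cusp (\<tau> / 2) z"
  defines "c \<equiv> \<lambda>w. w powi (- half_weight) * poly C w"
  shows "ee \<tau> powi A * tail (ee \<tau>) (ee z) * g \<tau> z =
     2 powi (k - 1) * (ee \<tau> powi (2 * A) * c (ee z) * tail (ee \<tau> ^ 2) (ee z ^ 2)) +
     1/2 * (ee (\<tau> / 2) powi A * tail (ee (\<tau> / 2)) (ee z) + (- ee (\<tau> / 2)) powi A * tail (- ee (\<tau> / 2)) (ee z))"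
    (is "?L z = ?R z")
proof -
  have \<tau>: "0 < Im \<tau>" using cusp by (simp add: near_cusp_def)
  have cR: "isCont ?R z"
  proof -
    have "isCont (\<lambda>w. tail (ee \<tau> ^ 2) (ee w ^ 2)) z"
      using isCont_tail(1)[of 2 \<tau> 0 2 z] near_cusp_half(2)[OF cusp] by (simp add: ee_double)
    moreover have "isCont (\<lambda>w. tail (ee (\<tau> / 2)) (ee w)) z"
      using isCont_tail(1)[of "1/2" \<tau> 0 1 z] cusp by simp
    moreover have "isCont (\<lambda>w. tail (- ee (\<tau> / 2)) (ee w)) z"
      using isCont_tail(1)[of "1/2" \<tau> "1/2" 1 z] near_cusp_half(3)[OF cusp] by (simp add: ee_half_shift)
    moreover have "isCont (\<lambda>w. c (ee w)) z"
      unfolding c_def by (intro continuous_intros isCont_ee_comp) auto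
    ultimately show ?thesis by (intro continuous_intros)
  qed
  have cL: "isCont ?L z"
  proof -
    have "isCont (\<lambda>w. tail (ee \<tau>) (ee w)) z"
      using isCont_tail(1)[of 1 \<tau> 0 1 z] near_cusp_half(1)[OF cusp] by simp
    moreover have "isCont (g \<tau>) z" using isCont_line[OF hol_at_isCont[OF hol[OF \<tau>]]] by simp
    ultimately show ?thesis by (intro continuous_intros)
  qed
  show ?thesis
  proof (rule eq_by_density[OF cL cR])
    show "eventually (\<lambda>w. ?L w = ?R w) (at z)"
      using eventually_near_cusp[OF cusp] f_nonzero_near[OF \<tau>]
    proof eventually_elim
      case (elim w)
      have fe: "f \<tau> w = ee \<tau> powi A * baby_fun (ee w) * tail (ee \<tau>) (ee w)"
        by (rule f_expansion[OF A near_cusp_half(1)[OF elim(1)]])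
      have f2: "f (2 * \<tau>) (2 * w) = ee \<tau> powi (2 * A) * baby_fun (ee w ^ 2) * tail (ee \<tau> ^ 2) (ee w ^ 2)"
        using f_expansion[OF A near_cusp_half(2)[OF elim(1)]] by (simp add: ee_double power_int_mult)
      have f3: "f (\<tau> / 2) w = ee (\<tau> / 2) powi A * baby_fun (ee w) * tail (ee (\<tau> / 2)) (ee w)"
        by (rule f_expansion[OF A elim(1)])
      have f4: "f (\<tau> / 2 + 1 / 2) w = (- ee (\<tau> / 2)) powi A * baby_fun (ee w) * tail (- ee (\<tau> / 2)) (ee w)"
        using f_expansion[OF A near_cusp_half(3)[OF elim(1)]] by (simp add: ee_half_shift)
      have bf: "baby_fun (ee w ^ 2) = c (ee w) * baby_fun (ee w)"
      proof -
        have "poly baby_poly (ee w ^ 2) = poly C (ee w) * poly baby_poly (ee w)"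
          using arg_cong[OF C, of "\<lambda>p. poly p (ee w)"] by (simp add: poly_pcompose poly_monom)
        moreover have "(ee w ^ 2) powi (- half_weight) = ee w powi (- half_weight) * ee w powi (- half_weight)"
          by (simp add: power2_eq_square power_int_mult_distrib)
        ultimately show ?thesis by (simp add: baby_fun_def c_def)
      qed
      have V: "hecke_V2 k f \<tau> w = baby_fun (ee w) * ?R w"
        unfolding hecke_V2_def f2 f3 f4 bf by (simp add: algebra_simps)
      have "baby_fun (ee w) * ?L w = f \<tau> w * g \<tau> w" unfolding fe by (simp add: mult_ac)
      also have "\<dots> = hecke_V2 k f \<tau> w" using quot[OF \<tau> elim(2)] elim(2) by simp
      finally have "baby_fun (ee w) * ?L w = baby_fun (ee w) * ?R w" unfolding V .
      moreover have "baby_fun (ee w) \<noteq> 0" using elim(2) fe by auto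
      ultimately show ?case by (metis mult_left_cancel)
    qed
  qed
qed

text \<open>The two series are kept apart because only the doubled term carries 2^(k-1). The bound y
  depends on z, as the region of validity recedes when |Im z| grows.\<close>

lemma quotient_q_expansion:
  assumes A: "q_order \<phi> = of_int A"
    and mono: "\<And>t. t \<ge> 1 \<Longrightarrow> zero_mult \<phi> (2 * t) \<le> zero_mult \<phi> t"
    and hol: "\<And>\<tau> z. 0 < Im \<tau> \<Longrightarrow> hol_at (\<lambda>p. g (fst p) (snd p)) (\<tau>, z)"
    and quot: "\<And>\<tau> z. 0 < Im \<tau> \<Longrightarrow> f \<tau> z \<noteq> 0 \<Longrightarrow> g \<tau> z = hecke_V2 k f \<tau> z / f \<tau> z"
  obtains S1 S2 N where "int_series S1" "int_series S2"
    "\<And>z. \<exists>y. \<forall>\<tau>. 0 < Im \<tau> \<longrightarrow> y < Im \<tau> \<longrightarrow>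
        ee \<tau> ^ N * g \<tau> z = 2 powi (k - 1) * S1 (ee \<tau>) (ee z) + S2 (ee \<tau>) (ee z)"
proof -
  obtain C where C: "pcompose baby_poly (monom 1 2) = C * baby_poly" "\<And>i. coeff C i \<in> \<int>"
    using baby_square_quotient[OF mono] by blast
  define c where "c = (\<lambda>w. w powi (- half_weight) * poly C w)"
  have c: "int_laurent c"
  proof -
    have "\<forall>i. \<exists>n. coeff C i = of_int n" using C(2) Ints_cases by blast
    then obtain d where d: "\<And>i. coeff C i = of_int (d i)" by metis
    have "int_laurent (\<lambda>w. w powi (- half_weight) * (\<Sum>i\<le>degree C. of_int (d i) * w powi int i))"
      by (intro int_laurent_mult int_laurent_powi int_laurent_sum int_laurent_monom)
    thus ?thesis by (rule int_laurent_cong) (simp add: c_def poly_altdef d)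
  qed
  \<comment> \<open>Enough to clear the poles: after division by q^A the doubled term starts at
    exponent A and the even part at a - A, both at least - |A|.\<close>
  define N where "N = nat \<bar>A\<bar>"
  \<comment> \<open>A/2 rounded up, expressed by floor division of - A.\<close>
  define a where "a = - ((- A) div 2)"
  have "2 * a - A = 0 \<or> 2 * a - A = 1" unfolding a_def by presburger
  hence a: "2 * a - A \<in> {0, 1}" by simp
  obtain E where E: "int_series E"
    "\<And>w. w \<noteq> 0 \<Longrightarrow> eventually (\<lambda>Q. Q \<noteq> 0 \<longrightarrow>
        1/2 * (Q powi A * tail Q w + (- Q) powi A * tail (- Q) w) = (Q ^ 2) powi a * E (Q ^ 2) w) (nhds 0)"
    by (rule int_series_even_part[OF int_series_tail a]) (rule that)
  define n1 where "n1 = nat (int N + A)"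
  define n2 where "n2 = nat (int N + a - A)"
  have n: "int n1 = int N + A" "int n2 = int N + a - A"
    using a by (auto simp: n1_def n2_def N_def)
  define S1 where "S1 = (\<lambda>q w. q ^ n1 * (c w * (tail (q ^ 2) (w ^ 2) * inverse (tail q w))))"
  define S2 where "S2 = (\<lambda>q w. q ^ n2 * (E q w * inverse (tail q w)))"
  have inv: "int_series (\<lambda>q w. inverse (tail q w))"
    by (rule int_series_inverse[OF int_series_tail]) (rule tail_0)
  have "int_series S1" unfolding S1_def
    by (intro int_series_mult int_series_power_q int_series_const[OF c] int_series_square_arg[OF int_series_tail] inv)
  moreover have "int_series S2" unfolding S2_def
    by (intro int_series_mult int_series_power_q E(1) inv)
  moreover have "\<exists>y. \<forall>\<tau>. 0 < Im \<tau> \<longrightarrow> y < Im \<tau> \<longrightarrow>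
        ee \<tau> ^ N * g \<tau> z = 2 powi (k - 1) * S1 (ee \<tau>) (ee z) + S2 (ee \<tau>) (ee z)" for z
  proof -
    obtain \<delta> where \<delta>: "\<delta> > 0" "\<And>Q. dist Q 0 < \<delta> \<Longrightarrow> Q \<noteq> 0 \<Longrightarrow>
        1/2 * (Q powi A * tail Q (ee z) + (- Q) powi A * tail (- Q) (ee z)) = (Q ^ 2) powi a * E (Q ^ 2) (ee z)"
      using E(2)[of "ee z"] unfolding eventually_nhds_metric by auto
    \<comment> \<open>The first bound puts (\<tau>/2, z) near the cusp, the sum over the support
      dominating each of its members; the second makes |Q| = exp(- pi Im \<tau>) smaller than
      \<delta>.\<close>
    define y where "y = max (2 * (of_nat (\<Sum>r\<in>supp. r) * \<bar>Im z\<bar>)) (- ln \<delta> / pi)"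
    have "ee \<tau> ^ N * g \<tau> z = 2 powi (k - 1) * S1 (ee \<tau>) (ee z) + S2 (ee \<tau>) (ee z)"
      if \<tau>: "0 < Im \<tau>" "y < Im \<tau>" for \<tau>
    proof -
      define q where "q = ee \<tau>"
      define Q where "Q = ee (\<tau> / 2)"
      have q0: "q \<noteq> 0" "Q \<noteq> 0" and Q2: "Q ^ 2 = q" by (auto simp: q_def Q_def ee_half_square)
      have cusp: "near_cusp (\<tau> / 2) z"
        unfolding near_cusp_def
      proof (intro conjI ballI)
        fix r assume "r \<in> supp"
        hence "r \<le> (\<Sum>r\<in>supp. r)" using finite_supp by (intro member_le_sum) auto
        hence "real r * \<bar>Im z\<bar> \<le> of_nat (\<Sum>r\<in>supp. r) * \<bar>Im z\<bar>"
          by (intro mult_right_mono) (simp_all only: of_nat_le_iff abs_ge_zero)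
        also have "\<dots> < Im (\<tau> / 2)" using \<tau>(2) by (simp add: y_def)
        finally show "real r * \<bar>Im z\<bar> < Im (\<tau> / 2)" .
      qed (use \<tau> in simp)
      have "norm Q < \<delta>"
      proof -
        have "- ln \<delta> / pi < Im \<tau>" using \<tau>(2) by (simp add: y_def)
        hence "- pi * Im \<tau> < ln \<delta>" by (simp add: field_simps)
        hence "exp (- pi * Im \<tau>) < exp (ln \<delta>)" by (simp only: exp_less_cancel_iff)
        thus ?thesis using \<delta>(1) by (simp add: Q_def norm_ee)
      qed
      hence ev: "1/2 * (Q powi A * tail Q (ee z) + (- Q) powi A * tail (- Q) (ee z)) = q powi a * E q (ee z)"
        using \<delta>(2)[of Q] q0 by (simp add: Q2)
      have t: "tail q (ee z) \<noteq> 0"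
        using isCont_tail(2)[of 1 \<tau> 0 1 z] near_cusp_half(1)[OF cusp] by (simp add: q_def)
      have main: "q powi A * tail q (ee z) * g \<tau> z =
          2 powi (k - 1) * (q powi (2 * A) * c (ee z) * tail (q ^ 2) (ee z ^ 2)) + q powi a * E q (ee z)"
        using quotient_near_cusp[OF A C(1) hol quot cusp] ev unfolding q_def Q_def c_def by simp
      have p1: "q ^ N * q powi (2 * A) = q powi A * q ^ n1"
        using q0(1) n(1) by (simp flip: power_int_of_nat power_int_add add: add_ac)
      have p2: "q ^ N * q powi a = q powi A * q ^ n2"
        using q0(1) n(2) by (simp flip: power_int_of_nat power_int_add add: add_ac)
      have "q powi A * tail q (ee z) * (q ^ N * g \<tau> z) = q ^ N * (q powi A * tail q (ee z) * g \<tau> z)"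
        by (simp add: mult_ac)
      also have "\<dots> = 2 powi (k - 1) * ((q ^ N * q powi (2 * A)) * c (ee z) * tail (q ^ 2) (ee z ^ 2)) +
          (q ^ N * q powi a) * E q (ee z)"
        unfolding main by (simp add: algebra_simps)
      also have "\<dots> = q powi A * tail q (ee z) * (2 powi (k - 1) * S1 q (ee z) + S2 q (ee z))"
        unfolding p1 p2 S1_def S2_def using t by (simp add: field_simps)
      finally show ?thesis using t q0(1) by (simp add: q_def)
    qed
    thus ?thesis by blast
  qed
  ultimately show ?thesis using that by blast
qed

text \<open>The coefficients have the form 2^(k-1) c1 + c2 with integers c1 and c2, which are
  integers themselves as soon as k \<ge> 1.\<close>

lemma quotient_weakly_holomorphic:
  assumes A: "q_order \<phi> = of_int A"
    and mono: "\<And>t. t \<ge> 1 \<Longrightarrow> zero_mult \<phi> (2 * t) \<le> zero_mult \<phi> t"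
  obtains g c where "g \<in> Jwh 0 m" "extends_quotient g (hecke_V2 k f) f" "jacobi_fourier g c"
    "k \<ge> 1 \<Longrightarrow> \<forall>n r. c n r \<in> \<int>"
proof -
  obtain g where hol: "\<And>\<tau> z. 0 < Im \<tau> \<Longrightarrow> hol_at (\<lambda>p. g (fst p) (snd p)) (\<tau>, z)"
    and quot: "\<And>\<tau> z. 0 < Im \<tau> \<Longrightarrow> f \<tau> z \<noteq> 0 \<Longrightarrow> g \<tau> z = hecke_V2 k f \<tau> z / f \<tau> z"
    using quotient_extension[OF mono] by blast
  obtain S1 S2 N where S: "int_series S1" "int_series S2"
    "\<And>z. \<exists>y. \<forall>\<tau>. 0 < Im \<tau> \<longrightarrow> y < Im \<tau> \<longrightarrow>
        ee \<tau> ^ N * g \<tau> z = 2 powi (k - 1) * S1 (ee \<tau>) (ee z) + S2 (ee \<tau>) (ee z)"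
    using quotient_q_expansion[OF A mono hol quot] by blast
  \<comment> \<open>Choice turns the expansions, one for each n, into a single integer array that is
    independent of w.\<close>
  have coeffs: "\<exists>c :: nat \<Rightarrow> int \<Rightarrow> int. (\<forall>n. finite {r. c n r \<noteq> 0}) \<and>
      (\<forall>n w T. w \<noteq> 0 \<longrightarrow> finite T \<longrightarrow> {r. c n r \<noteq> 0} \<subseteq> T \<longrightarrow> fps_nth (X w) n = (\<Sum>r\<in>T. of_int (c n r) * w powi r))"
    if "fps_int_laurent X" for X
  proof -
    have "\<forall>n. \<exists>c :: int \<Rightarrow> int. finite {r. c r \<noteq> 0} \<and> (\<forall>w T. w \<noteq> 0 \<longrightarrow> finite T \<longrightarrow> {r. c r \<noteq> 0} \<subseteq> T \<longrightarrow>
        fps_nth (X w) n = (\<Sum>r\<in>T. of_int (c r) * w powi r))"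
    proof
      fix n
      have "int_laurent (\<lambda>w. fps_nth (X w) n)" using that by (simp add: fps_int_laurent_def)
      thus "\<exists>c :: int \<Rightarrow> int. finite {r. c r \<noteq> 0} \<and> (\<forall>w T. w \<noteq> 0 \<longrightarrow> finite T \<longrightarrow> {r. c r \<noteq> 0} \<subseteq> T \<longrightarrow>
        fps_nth (X w) n = (\<Sum>r\<in>T. of_int (c r) * w powi r))"
        by (rule int_laurentE) blast
    qed
    from choice[OF this] obtain c where "\<forall>n. finite {r. c n r \<noteq> 0} \<and> (\<forall>w T. w \<noteq> 0 \<longrightarrow> finite T \<longrightarrow>
        {r. c n r \<noteq> 0} \<subseteq> T \<longrightarrow> fps_nth (X w) n = (\<Sum>r\<in>T. of_int (c n r :: int) * w powi r))" ..
    thus ?thesis by (intro exI[of _ c] conjI allI impI) simp_all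
  qed
  obtain X1 where X1: "fps_int_laurent X1" "\<And>w. w \<noteq> 0 \<Longrightarrow> (\<lambda>q. S1 q w) has_fps_expansion X1 w"
    using S(1) by (auto simp: int_series_def)
  obtain X2 where X2: "fps_int_laurent X2" "\<And>w. w \<noteq> 0 \<Longrightarrow> (\<lambda>q. S2 q w) has_fps_expansion X2 w"
    using S(2) by (auto simp: int_series_def)
  obtain c1 where c1: "\<And>n. finite {r. c1 n r \<noteq> 0}" "\<And>n w T. w \<noteq> 0 \<Longrightarrow> finite T \<Longrightarrow> {r. c1 n r \<noteq> 0} \<subseteq> T \<Longrightarrow>
      fps_nth (X1 w) n = (\<Sum>r\<in>T. of_int (c1 n r) * w powi r)"
    using coeffs[OF X1(1)] by blast
  obtain c2 where c2: "\<And>n. finite {r. c2 n r \<noteq> 0}" "\<And>n w T. w \<noteq> 0 \<Longrightarrow> finite T \<Longrightarrow> {r. c2 n r \<noteq> 0} \<subseteq> T \<Longrightarrow>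
      fps_nth (X2 w) n = (\<Sum>r\<in>T. of_int (c2 n r) * w powi r)"
    using coeffs[OF X2(1)] by blast
  define c where "c = (\<lambda>n r. 2 powi (k - 1) * of_int (c1 n r) + of_int (c2 n r) :: complex)"
  define T where "T = (\<lambda>n. {r. c1 n r \<noteq> 0} \<union> {r. c2 n r \<noteq> 0})"
  have T: "finite (T n)" "{r. c n r \<noteq> 0} \<subseteq> T n" for n using c1(1) c2(1) by (auto simp: T_def c_def)
  have trans: "g ((of_int a * \<tau> + of_int b) / (of_int c * \<tau> + of_int d)) (z / (of_int c * \<tau> + of_int d)) =
      ee (of_nat m * of_int c * z\<^sup>2 / (of_int c * \<tau> + of_int d)) * g \<tau> z"
    if "0 < Im \<tau>" "a * d - b * c = (1::int)" for a b c d \<tau> z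
    by (rule quotient_transforms(1)[OF hol quot that])
  have ell: "g \<tau> (z + of_int l * \<tau> + of_int u) =
      ee (- (of_nat m * (of_int l)\<^sup>2 * \<tau>) - 2 * of_nat m * of_int l * z) * g \<tau> z"
    if "0 < Im \<tau>" for l u \<tau> z
    by (rule quotient_transforms(2)[OF hol quot that])
  have four: "jacobi_fourier g (\<lambda>n r. if n + int N \<ge> 0 then c (nat (n + int N)) r else 0)"
  proof (rule jacobi_fourier_of_q_expansion)
    show "isCont (\<lambda>p. g (fst p) (snd p)) (\<tau>, z)" if "0 < Im \<tau>" for \<tau> z
      by (rule hol_at_isCont[OF hol[OF that]])
    show "(\<lambda>\<tau>. g \<tau> z) holomorphic_on {\<tau>. 0 < Im \<tau>}" for z
      unfolding holomorphic_on_def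
    proof
      fix \<tau> assume "\<tau> \<in> {\<tau>. 0 < Im \<tau>}"
      hence "cdiff2 (\<lambda>p. g (fst p) (snd p)) (\<tau>, z)" using hol_at_imp_cdiff2[OF hol] by simp
      from cdiff2_field_differentiable_fst[OF this] show "(\<lambda>\<tau>. g \<tau> z) field_differentiable at \<tau> within {\<tau>. 0 < Im \<tau>}"
        by (simp add: field_differentiable_at_within)
    qed
    show "g (\<tau> + 1) z = g \<tau> z" if "0 < Im \<tau>" for \<tau> z
      using trans[OF that, of 1 1 1 0 z] by simp
    show "finite {r. c n r \<noteq> 0}" for n using T finite_subset by blast
    fix z
    obtain y where y: "\<forall>\<tau>. 0 < Im \<tau> \<longrightarrow> y < Im \<tau> \<longrightarrow>
        ee \<tau> ^ N * g \<tau> z = 2 powi (k - 1) * S1 (ee \<tau>) (ee z) + S2 (ee \<tau>) (ee z)" using S(3) by blast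
    have "(\<lambda>q. 2 powi (k - 1) * S1 q (ee z) + S2 q (ee z)) has_fps_expansion fps_const (2 powi (k - 1)) * X1 (ee z) + X2 (ee z)"
      by (intro has_fps_expansion_add has_fps_expansion_cmult_left X1 X2) auto
    also have "fps_const (2 powi (k - 1)) * X1 (ee z) + X2 (ee z) =
        Abs_fps (\<lambda>n. \<Sum>r | c n r \<noteq> 0. c n r * ee (of_int r * z))"
    proof (rule fps_ext)
      fix n
      have "fps_nth (fps_const (2 powi (k - 1)) * X1 (ee z) + X2 (ee z)) n =
          2 powi (k - 1) * (\<Sum>r\<in>T n. of_int (c1 n r) * ee z powi r) + (\<Sum>r\<in>T n. of_int (c2 n r) * ee z powi r)"
        using c1(2)[of "ee z" "T n" n] c2(2)[of "ee z" "T n" n] T(1)[of n] by (simp add: T_def)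
      also have "\<dots> = (\<Sum>r\<in>T n. c n r * ee (of_int r * z))"
        unfolding ee_of_int_mult by (simp add: c_def sum_distrib_left sum.distrib algebra_simps)
      also have "\<dots> = (\<Sum>r | c n r \<noteq> 0. c n r * ee (of_int r * z))"
        by (rule sum.mono_neutral_right) (use T in auto)
      finally show "fps_nth (fps_const (2 powi (k - 1)) * X1 (ee z) + X2 (ee z)) n =
          fps_nth (Abs_fps (\<lambda>n. \<Sum>r | c n r \<noteq> 0. c n r * ee (of_int r * z))) n" by simp
    qed
    finally show "\<exists>F y. F has_fps_expansion Abs_fps (\<lambda>n. \<Sum>r | c n r \<noteq> 0. c n r * ee (of_int r * z)) \<and>
       (\<forall>\<tau>. 0 < Im \<tau> \<longrightarrow> y < Im \<tau> \<longrightarrow> ee \<tau> ^ N * g \<tau> z = F (ee \<tau>))"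
      using y by blast
  qed
  have "holomorphic_HC g"
    unfolding holomorphic_HC_def using hol_at_imp_cdiff2[OF hol] by (auto simp: cdiff2_def)
  hence "g \<in> Jwh 0 m"
    unfolding Jwh_def using trans ell four by auto
  moreover have "extends_quotient g (hecke_V2 k f) f"
    using quot by (simp add: extends_quotient_def)
  moreover have "\<forall>n r. (if n + int N \<ge> 0 then c (nat (n + int N)) r else 0) \<in> \<int>" if "k \<ge> 1"
  proof -
    have "2 powi (k - 1) = (of_int (2 ^ nat (k - 1)) :: complex)" using that by (simp add: power_int_def)
    hence "c n r \<in> \<int>" for n r unfolding c_def by (auto intro!: Ints_add Ints_mult)
    thus ?thesis by auto
  qed
  ultimately show ?thesis using that four by blast
qed

text \<open>The shift by \<open>half_weight\<close> doubles when zeta is squared, so the cofactor C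
  carries the same shift as b, and the polynomial identity becomes one of Laurent
  polynomials.\<close>

lemma baby_theta_dvd_square:
  assumes mono: "\<And>t. t \<ge> 1 \<Longrightarrow> zero_mult \<phi> (2 * t) \<le> zero_mult \<phi> t"
  shows "\<exists>b. is_baby_theta b \<phi> \<and> b dvd subst_square b"
proof -
  obtain C where C: "pcompose baby_poly (monom 1 2) = C * baby_poly"
    using baby_square_quotient[OF mono] by blast
  define b where "b = laurent_of_poly half_weight baby_poly"
  have "subst_square b = b * laurent_of_poly half_weight C"
  proof (rule laurent_poly_eqI)
    fix w :: complex assume w: "w \<noteq> 0"
    have "poly baby_poly (w ^ 2) = poly C w * poly baby_poly w"
      using arg_cong[OF C, of "\<lambda>p. poly p w"] by (simp add: poly_pcompose poly_monom)
    moreover have "(w ^ 2) powi (- half_weight) = w powi (- half_weight) * w powi (- half_weight)"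
      by (simp add: power2_eq_square power_int_mult_distrib)
    ultimately show "laurent_eval (subst_square b) w = laurent_eval (b * laurent_of_poly half_weight C) w"
      using w by (simp add: b_def laurent_eval_subst_square laurent_eval_mult laurent_eval_of_poly)
  qed
  thus ?thesis using is_baby_theta_laurent unfolding b_def by (metis dvd_triv_left)
qed

end

theorem theorem4p2:
  fixes k A :: int and m :: nat
    and \<phi> \<nu> :: "nat \<Rightarrow> int"
    and f :: "complex \<Rightarrow> complex \<Rightarrow> complex"
  assumes "basic_theta_block k m f \<phi>"
    and "q_order \<phi> = of_int A"
    and "atom_decomposition f \<nu>"
  shows "((\<exists>g \<in> Jwh 0 m. extends_quotient g (hecke_V2 k f) f) \<longleftrightarrow>
          (\<exists>b. is_baby_theta b \<phi> \<and> b dvd subst_square b))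
       \<and> ((\<exists>b. is_baby_theta b \<phi> \<and> b dvd subst_square b) \<longleftrightarrow>
          (\<forall>r\<ge>1. \<nu> r \<ge> \<nu> (2 * r)))
       \<and> (k \<ge> 1 \<longrightarrow> (\<exists>g \<in> Jwh 0 m. extends_quotient g (hecke_V2 k f) f) \<longrightarrow>
          (\<exists>g \<in> Jwh_int 0 m. extends_quotient g (hecke_V2 k f) f))"
proof -
  interpret holomorphic_theta_block k m \<phi> f
    by unfold_locales (rule assms(1))
  \<comment> \<open>The hub of the equivalences: each of the three conditions is related to it,
    never directly to another one.\<close>
  define mono where "mono \<longleftrightarrow> (\<forall>t\<ge>1. zero_mult \<phi> (2 * t) \<le> zero_mult \<phi> t)"
  have 3: "(\<forall>r\<ge>1. \<nu> r \<ge> \<nu> (2 * r)) \<longleftrightarrow> mono"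
    unfolding mono_def using atom_exponent[OF assms(3)] by auto
  have 1: "(\<exists>g \<in> Jwh 0 m. extends_quotient g (hecke_V2 k f) f) \<Longrightarrow> mono"
    unfolding mono_def using quotient_imp_zero_mult_mono by blast
  have 2: "(\<exists>b. is_baby_theta b \<phi> \<and> b dvd subst_square b) \<longleftrightarrow> mono"
    using baby_dvd_imp_mono baby_theta_dvd_square unfolding mono_def by blast
  have 4: "\<exists>g c. g \<in> Jwh 0 m \<and> extends_quotient g (hecke_V2 k f) f \<and> jacobi_fourier g c \<and>
      (k \<ge> 1 \<longrightarrow> (\<forall>n r. c n r \<in> \<int>))" if mono
    using quotient_weakly_holomorphic[OF assms(2)] that unfolding mono_def by metis
  have 5: "\<exists>g \<in> Jwh_int 0 m. extends_quotient g (hecke_V2 k f) f" if mono "k \<ge> 1"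
    using 4[OF that(1)] that(2) unfolding Jwh_int_def by blast
  show ?thesis unfolding 2 3 using 1 4 5 by blast
qed

end
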